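(* Let $n,\ell$ be positive integers and let $F:(\mathbb{R}^n,0)\to(\mathbb{R}^{n+\ell},0)$ be a frontal germ. Suppose there exist germs of diffeomorphism $h:(\mathbb{R}^n,0)\to(\mathbb{R}^n,0)$ and $H:(\mathbb{R}^{n+\ell},0)\to(\mathbb{R}^{n+\ell},0)$, an equidimensional map-germ $f:(\mathbb{R}^n,0)\to(\mathbb{R}^n,0)$ with $\dim_{\mathbb{R}}Q(f)\le 3$, and elements $\psi_1,\ldots,\psi_\ell\in\mathcal{R}_f$ such that \[ H\circ F\circ h=(f,\psi_1,\ldots,\psi_\ell). \] Then \[ \left\langle |Jf|^2\right\rangle_{\mathcal{E}_n}+f^*(\mathcal{E}_n)=\mathcal{R}_f. \]
   Context: All germs are $C^\infty$. $\mathcal{E}_n$ is the $\mathbb{R}$-algebra of function-germs $(\mathbb{R}^n,0)\to\mathbb{R}$, $m_n$ its maximal ideal (germs vanishing at $0$). For $f=(f_1,\ldots,f_n):(\mathbb{R}^n,0)\to(\mathbb{R}^n,0)$, $|Jf|$ is its Jacobian determinant, $f^*(\mathcal{E}_n)=\{\eta\circ f:\eta\in\mathcal{E}_n\}$, $\langle |Jf|^2\rangle_{\mathcal{E}_n}$ is the ideal of $\mathcal{E}_n$ generated by $|Jf|^2$, and $Q(f)=\mathcal{E}_n/\langle f_1,\ldots,f_n\rangle_{\mathcal{E}_n}$ (the local algebra; its real dimension is the multiplicity of $f$). The ramification module $\mathcal{R}_f$ is the set of all $\varphi\in\mathcal{E}_n$ such that $d\varphi$ lies in the $\mathcal{E}_n$-module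 generated by $df_1,\ldots,df_n$ (i.e. $d\varphi=\sum_i a_i\,df_i$ for some $a_i\in\mathcal{E}_n$). A vector field along $F:(\mathbb{R}^n,0)\to\mathbb{R}^{n+\ell}$ is a germ $x\mapsto(F(x),\phi(x))$ with $\phi(x)\in T_{F(x)}\mathbb{R}^{n+\ell}\cong\mathbb{R}^{n+\ell}$. $F$ is a frontal if there exist vector fields $(F,\phi_1),\ldots,(F,\phi_\ell)$ along $F$ such that $\phi_i(x)\cdot dF_x(\xi(x))=0$ for every germ of vector field $\xi$ on $(\mathbb{R}^n,0)$ and every $i$, and $\phi_1(0),\ldots,\phi_\ell(0)$ are nonzero and linearly independent. *)

theory Defs
  imports "HOL-Analysis.Analysis"
begin

fun Ck_on :: "nat \<Rightarrow> ('a::euclidean_space \<Rightarrow> 'b::real_normed_vector) \<Rightarrow> 'a set \<Rightarrow> bool" where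
  "Ck_on 0 f U = continuous_on U f"
| "Ck_on (Suc k) f U = (f differentiable_on U \<and>
      (\<forall>v. Ck_on k (\<lambda>x. frechet_derivative f (at x) v) U))"

definition smooth_on :: "('a::euclidean_space \<Rightarrow> 'b::real_normed_vector) \<Rightarrow> 'a set \<Rightarrow> bool" where
  "smooth_on f U = (\<forall>k. Ck_on k f U)"

text \<open>A function represents a C^infinity germ at 0 if it is smooth on an open neighbourhood of 0.
  Germs are represented by functions; germ equality is equality eventually in nhds 0.\<close>
definition smooth_germ :: "('a::euclidean_space \<Rightarrow> 'b::real_normed_vector) \<Rightarrow> bool" where
  "smooth_germ f = (\<exists>U. open U \<and> 0 \<in> U \<and> smooth_on f U)"

definition diffeo_germ :: "('a::euclidean_space \<Rightarrow> 'a) \<Rightarrow> bool" where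
  "diffeo_germ h = (h 0 = 0 \<and> smooth_germ h \<and>
     (\<exists>g. smooth_germ g \<and> g 0 = 0 \<and> (\<forall>\<^sub>F x in nhds 0. g (h x) = x) \<and> (\<forall>\<^sub>F x in nhds 0. h (g x) = x)))"

definition jac :: "(real^'n \<Rightarrow> real^'n) \<Rightarrow> real^'n \<Rightarrow> real" where
  "jac f x = det (matrix (frechet_derivative f (at x)))"

definition germ_ideal1 :: "(real^'n \<Rightarrow> real) \<Rightarrow> (real^'n \<Rightarrow> real) set" where
  "germ_ideal1 g = {\<phi>. \<exists>a. smooth_germ a \<and> (\<forall>\<^sub>F x in nhds 0. \<phi> x = a x * g x)}"

definition comp_ideal :: "(real^'n \<Rightarrow> real^'n) \<Rightarrow> (real^'n \<Rightarrow> real) set" where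
  "comp_ideal f = {\<phi>. \<exists>a. (\<forall>i. smooth_germ (a i)) \<and>
      (\<forall>\<^sub>F x in nhds 0. \<phi> x = (\<Sum>i\<in>UNIV. a i x * f x $ i))}"

definition pullback :: "(real^'n \<Rightarrow> real^'n) \<Rightarrow> (real^'n \<Rightarrow> real) set" where
  "pullback f = {\<phi>. \<exists>\<eta>. smooth_germ \<eta> \<and> (\<forall>\<^sub>F x in nhds 0. \<phi> x = \<eta> (f x))}"

definition germ_sum :: "(real^'n \<Rightarrow> real) set \<Rightarrow> (real^'n \<Rightarrow> real) set \<Rightarrow> (real^'n \<Rightarrow> real) set" where
  "germ_sum A B = {\<phi>. \<exists>u\<in>A. \<exists>v\<in>B. (\<forall>\<^sub>F x in nhds 0. \<phi> x = u x + v x)}"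

text \<open>dim_R Q(f) \<le> k: the local algebra E_n / <f_1,...,f_n> is spanned by (the classes of) at most k germs.\<close>
definition local_algebra_dim_le :: "(real^'n \<Rightarrow> real^'n) \<Rightarrow> nat \<Rightarrow> bool" where
  "local_algebra_dim_le f k = (\<exists>B. finite B \<and> card B \<le> k \<and> (\<forall>b\<in>B. smooth_germ b) \<and>
      (\<forall>\<phi>. smooth_germ \<phi> \<longrightarrow> (\<exists>c. (\<lambda>x. \<phi> x - (\<Sum>b\<in>B. c b * b x)) \<in> comp_ideal f)))"

definition ramification :: "(real^'n \<Rightarrow> real^'n) \<Rightarrow> (real^'n \<Rightarrow> real) set" where
  "ramification f = {\<phi>. smooth_germ \<phi> \<and> (\<exists>a. (\<forall>i. smooth_germ (a i)) \<and>
      (\<forall>\<^sub>F x in nhds 0. (\<phi> has_derivative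
          (\<lambda>v. \<Sum>i\<in>UNIV. a i x * frechet_derivative (\<lambda>y. f y $ i) (at x) v)) (at x)))}"

definition frontal :: "(real^'n \<Rightarrow> real^('n + 'l::finite)) \<Rightarrow> bool" where
  "frontal F = (\<exists>\<phi> :: 'l \<Rightarrow> real^'n \<Rightarrow> real^('n + 'l).
      (\<forall>i. smooth_germ (\<phi> i)) \<and>
      (\<forall>i \<xi>. smooth_germ (\<xi> :: real^'n \<Rightarrow> real^'n) \<longrightarrow>
          (\<forall>\<^sub>F x in nhds 0. \<phi> i x \<bullet> frechet_derivative F (at x) (\<xi> x) = 0)) \<and>
      (\<forall>i. \<phi> i 0 \<noteq> 0) \<and> inj (\<lambda>i. \<phi> i 0) \<and> independent (range (\<lambda>i. \<phi> i 0)))"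

end

theory Submission
  imports Defs
begin

text \<open>
  One inclusion is Cramer's rule: \<open>J \<omega>\<close> is a combination of the \<open>df i\<close> for every 1-form \<open>\<omega>\<close>, where \<open>J\<close> is the Jacobian
  determinant, and \<open>d (a * J\<^sup>2)\<close> has this form.

  For the other inclusion, multiplicity at most 3 forces corank at most 1, so that in suitable coordinates
  \<open>f = (g, y)\<close>, with fibre coordinate \<open>t\<close>, parameters \<open>y\<close> and \<open>J = \<partial>g/\<partial>t\<close>, and a member \<open>\<phi>\<close> of the ramification module
  is characterised by \<open>\<partial>\<phi>/\<partial>t = a * J\<close>. The multiplicity bounds the order of \<open>g\<close> in \<open>t\<close> by 3. If the order is 2, one can
  arrange \<open>J = t * U\<close> with \<open>U\<close> a unit, and \<open>\<phi> - \<phi> (0, y)\<close> is divisible by \<open>t\<^sup>2\<close>. If it is 3, one can arrange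
  \<open>J = (t\<^sup>2 - s y) * U\<close>. Replacing \<open>s y\<close> by an independent variable \<open>s\<close>, integration along the fibre extends \<open>g\<close> and \<open>\<phi>\<close> to
  functions of \<open>(t, s, y)\<close>, and \<open>\<phi> - \<eta> \<circ> f\<close> is divisible by \<open>J\<^sup>2\<close> as soon as it vanishes on the parabola \<open>s = t\<^sup>2\<close>. There,
  up to functions of \<open>y\<close>, \<open>g = t^3 * V\<close> and \<open>\<phi> = t^3 * W\<close>; writing \<open>V\<close> and \<open>W\<close> as \<open>A (t\<^sup>2) + t * B (t\<^sup>2)\<close> by Whitney's
  theorem on even functions gives \<open>\<eta>\<close> explicitly.
\<close>

subsection \<open>Smooth functions and germs\<close>

text \<open>The independent variable \<open>s\<close> answers an obstacle: for a degenerate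
  parameter such as \<open>s y = 0\<close> or \<open>s y = - y^2\<close>, the zeros of
  \<open>t^2 - s y\<close> are too small a set to decide divisibility, whereas in the variables
  \<open>(t, s, y)\<close> the function \<open>s - t^2\<close> is a coordinate and vanishing on the
  parabola is the same as divisibility. There the equation to solve is
  \<open>t^3 * W = q * (t^3 * V) + r\<close>, with \<open>q\<close> and \<open>r\<close> depending
  on \<open>(t^2, y)\<close> only. Writing \<open>V = V0 + t * V1\<close> and
  \<open>W = W0 + t * W1\<close> with even coefficients, \<open>q = W0 / V0\<close> cancels the odd
  power \<open>t^3\<close> and leaves a multiple of \<open>t^4 = s^2\<close>, which is an admissible
  \<open>r\<close>. In Whitney's theorem an even function determines \<open>A\<close> only for
  non-negative arguments. The continuation to negative ones is a series of reflected copies whose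
  weights have prescribed moments \<open>(-1)^n\<close> on the nodes \<open>4^j\<close>; it is
  smooth because its derivatives are again continuations of the same kind. The bound 3 on the order
  of \<open>g\<close> in \<open>t\<close> comes from counting: for a higher order \<open>1\<close>,
  \<open>t\<close>, \<open>t^2\<close>, \<open>t^3\<close> would be linearly independent in the
  local algebra.\<close>

lemma Ck_on_cong:
  assumes "open U" "\<And>x. x \<in> U \<Longrightarrow> f x = g x" "Ck_on k f U"
  shows "Ck_on k g U"
  using assms(2,3)
proof (induction k arbitrary: f g)
  case 0
  then show ?case using continuous_on_cong by fastforce
next
  case (Suc k)
  have d: "(f has_derivative frechet_derivative f (at x)) (at x)" if "x \<in> U" for x
    using Suc.prems(2) that \<open>open U\<close>
    by (auto simp: differentiable_on_eq_differentiable_at frechet_derivative_works[symmetric])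
  have d': "(g has_derivative frechet_derivative f (at x)) (at x)" if "x \<in> U" for x
    using has_derivative_transform_within_open[OF d[OF that] \<open>open U\<close> that] Suc.prems(1) by blast
  have e: "frechet_derivative f (at x) = frechet_derivative g (at x)" if "x \<in> U" for x
    using frechet_derivative_at[OF d'[OF that]] .
  have "g differentiable_on U"
    using d' by (meson differentiable_at_withinI differentiable_def differentiable_on_def)
  moreover have "Ck_on k (\<lambda>x. frechet_derivative g (at x) v) U" for v
    using Suc.IH[of "\<lambda>x. frechet_derivative f (at x) v"] Suc.prems(2) e by simp
  ultimately show ?case by simp
qed

lemma Ck_on_has_derivative:
  assumes "open U" "Ck_on (Suc k) f U" "x \<in> U"
  shows "(f has_derivative frechet_derivative f (at x)) (at x)"
  using assms by (auto simp: differentiable_on_eq_differentiable_at frechet_derivative_works[symmetric])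

lemma Ck_on_SucI:
  assumes "open U" and d: "\<And>x. x \<in> U \<Longrightarrow> (f has_derivative f' x) (at x)"
    and c: "\<And>v. Ck_on k (\<lambda>x. f' x v) U"
  shows "Ck_on (Suc k) f U"
proof -
  have "f differentiable_on U"
    using d by (meson differentiable_at_withinI differentiable_def differentiable_on_def)
  moreover have "Ck_on k (\<lambda>x. frechet_derivative f (at x) v) U" for v
    by (rule Ck_on_cong[OF \<open>open U\<close> _ c[of v]]) (metis d frechet_derivative_at)
  ultimately show ?thesis by simp
qed

lemma Ck_on_Suc_imp: "Ck_on (Suc k) f U \<Longrightarrow> Ck_on k f U"
proof (induction k arbitrary: f)
  case 0
  then show ?case by (auto intro: differentiable_imp_continuous_on)
next
  case (Suc k)
  have "Ck_on k (\<lambda>x. frechet_derivative f (at x) v) U" for v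
    by (rule Suc.IH) (use Suc.prems in simp)
  with Suc.prems show ?case by simp
qed

lemma Ck_on_imp_continuous: "Ck_on k f U \<Longrightarrow> continuous_on U f"
  by (cases k) (auto intro: differentiable_imp_continuous_on)

lemma Ck_on_subset: "Ck_on k f U \<Longrightarrow> V \<subseteq> U \<Longrightarrow> Ck_on k f V"
  by (induction k arbitrary: f) (auto intro: continuous_on_subset differentiable_on_subset)

lemma Ck_on_const: "open U \<Longrightarrow> Ck_on k (\<lambda>x. c) U"
proof (induction k arbitrary: c)
  case (Suc k)
  show ?case
    by (rule Ck_on_SucI[OF \<open>open U\<close>, where f' = "\<lambda>x v. 0"]) (use Suc in auto)
qed simp

lemma Ck_on_linear:
  assumes "open U" "bounded_linear L"
  shows "Ck_on k L U"
proof (cases k)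
  case 0
  then show ?thesis using assms by (simp add: linear_continuous_on)
next
  case (Suc m)
  show ?thesis unfolding Suc
    by (rule Ck_on_SucI[OF \<open>open U\<close>, where f' = "\<lambda>x. L"])
      (use assms in \<open>auto intro: bounded_linear_imp_has_derivative Ck_on_const\<close>)
qed

lemma Ck_on_add:
  assumes "open U"
  shows "Ck_on k f U \<Longrightarrow> Ck_on k g U \<Longrightarrow> Ck_on k (\<lambda>x. f x + g x) U"
proof (induction k arbitrary: f g)
  case 0
  then show ?case by (simp add: continuous_on_add)
next
  case (Suc k)
  show ?case
    by (rule Ck_on_SucI[OF \<open>open U\<close>, where f' = "\<lambda>x v. frechet_derivative f (at x) v + frechet_derivative g (at x) v"])
      (use Suc in \<open>auto intro!: has_derivative_add Ck_on_has_derivative[OF \<open>open U\<close>]\<close>)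
qed

lemma Ck_on_sum:
  assumes "open U" "\<And>i. i \<in> I \<Longrightarrow> Ck_on k (f i) U"
  shows "Ck_on k (\<lambda>x. \<Sum>i\<in>I. f i x) U"
  using assms(2)
  by (induction I rule: infinite_finite_induct) (auto intro: Ck_on_const Ck_on_add assms(1))

lemma Ck_on_bounded_linear:
  assumes "open U" "bounded_linear L"
  shows "Ck_on k f U \<Longrightarrow> Ck_on k (\<lambda>x. L (f x)) U"
proof (induction k arbitrary: f)
  case 0
  then show ?case using assms(2) by (auto intro: bounded_linear.continuous_on)
next
  case (Suc k)
  show ?case
    by (rule Ck_on_SucI[OF \<open>open U\<close>, where f' = "\<lambda>x v. L (frechet_derivative f (at x) v)"])
      (use Suc.prems in \<open>blast intro: bounded_linear.has_derivative[OF assms(2)] Ck_on_has_derivative[OF \<open>open U\<close>]\<close>,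
       use Suc in simp)
qed

lemma Ck_on_bilinear:
  assumes "open U" "bounded_bilinear B"
  shows "Ck_on k f U \<Longrightarrow> Ck_on k g U \<Longrightarrow> Ck_on k (\<lambda>x. B (f x) (g x)) U"
proof (induction k arbitrary: f g)
  case 0
  then show ?case using bounded_bilinear.continuous_on[OF assms(2)] by auto
next
  case (Suc k)
  show ?case
  proof (rule Ck_on_SucI[OF \<open>open U\<close>, where f' = "\<lambda>x v. B (f x) (frechet_derivative g (at x) v) + B (frechet_derivative f (at x) v) (g x)"])
    show "((\<lambda>x. B (f x) (g x)) has_derivative
            (\<lambda>v. B (f x) (frechet_derivative g (at x) v) + B (frechet_derivative f (at x) v) (g x))) (at x)"
      if "x \<in> U" for x
      by (rule bounded_bilinear.FDERIV[OF assms(2)]) (use Suc that in \<open>auto intro: Ck_on_has_derivative[OF \<open>open U\<close>]\<close>)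
    show "Ck_on k (\<lambda>x. B (f x) (frechet_derivative g (at x) v) + B (frechet_derivative f (at x) v) (g x)) U" for v
      by (rule Ck_on_add[OF \<open>open U\<close>]; rule Suc.IH)
        (use Suc.prems in \<open>auto intro: Ck_on_Suc_imp simp del: Ck_on.simps(2)\<close>, use Suc.prems in auto)
  qed
qed

lemma Ck_on_componentwise:
  fixes f :: "'a::euclidean_space \<Rightarrow> 'b::euclidean_space"
  assumes "open U" "\<And>i. i \<in> Basis \<Longrightarrow> Ck_on k (\<lambda>x. f x \<bullet> i) U"
  shows "Ck_on k f U"
proof -
  have "Ck_on k (\<lambda>x. \<Sum>i\<in>Basis. (f x \<bullet> i) *\<^sub>R i) U"
    by (intro Ck_on_sum Ck_on_bounded_linear[where L = "\<lambda>c. c *\<^sub>R _"] assms) (auto intro: bounded_linear_scaleR_left)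
  then show ?thesis by (simp add: euclidean_representation)
qed

lemma Ck_on_compose:
  fixes f :: "'a::euclidean_space \<Rightarrow> 'b::euclidean_space" and g :: "'b \<Rightarrow> 'c::real_normed_vector"
  assumes "open U" "open V"
  shows "Ck_on k f U \<Longrightarrow> Ck_on k g V \<Longrightarrow> f ` U \<subseteq> V \<Longrightarrow> Ck_on k (\<lambda>x. g (f x)) U"
proof (induction k arbitrary: g)
  case 0
  then show ?case by (auto intro: continuous_on_compose2)
next
  case (Suc k)
  let ?Df = "\<lambda>x. frechet_derivative f (at x)" and ?Dg = "\<lambda>x. frechet_derivative g (at x)"
  have df: "(f has_derivative ?Df x) (at x)" if "x \<in> U" for x
    using Suc.prems that by (blast intro: Ck_on_has_derivative[OF \<open>open U\<close>])
  have dg: "(g has_derivative ?Dg (f x)) (at (f x))" if "x \<in> U" for x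
    using Suc.prems that by (blast intro: Ck_on_has_derivative[OF \<open>open V\<close>])
  \<comment> \<open>\<open>Ck_on\<close> differentiates in a fixed direction \<open>v\<close>, while
    the chain rule puts the moving vector \<open>?Df x v\<close> into \<open>?Dg (f x)\<close>.
    Expanding it in the basis leaves only derivatives of \<open>g\<close> in fixed directions
    \<open>b\<close>, to which the induction hypothesis applies.\<close>
  show ?case
  proof (rule Ck_on_SucI[OF \<open>open U\<close>, where f' = "\<lambda>x v. \<Sum>b\<in>Basis. (?Df x v \<bullet> b) *\<^sub>R ?Dg (f x) b"])
    show "((\<lambda>x. g (f x)) has_derivative (\<lambda>v. \<Sum>b\<in>Basis. (?Df x v \<bullet> b) *\<^sub>R ?Dg (f x) b)) (at x)"
      if "x \<in> U" for x
    proof -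
      have lin: "linear (?Dg (f x))" using dg[OF that] has_derivative_linear by blast
      have "?Dg (f x) (?Df x v) = (\<Sum>b\<in>Basis. (?Df x v \<bullet> b) *\<^sub>R ?Dg (f x) b)" for v
        by (subst euclidean_representation[of "?Df x v", symmetric]) (simp add: linear_sum[OF lin] linear_cmul[OF lin])
      with has_derivative_compose[OF df[OF that] dg[OF that]] show ?thesis by simp
    qed
    have f: "Ck_on k f U" using Suc.prems(1) by (rule Ck_on_Suc_imp)
    show "Ck_on k (\<lambda>x. \<Sum>b\<in>Basis. (?Df x v \<bullet> b) *\<^sub>R ?Dg (f x) b) U" for v
    proof (intro Ck_on_sum[OF \<open>open U\<close>] Ck_on_bilinear[OF \<open>open U\<close> bounded_bilinear_scaleR])
      fix b :: 'b assume "b \<in> Basis"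
      show "Ck_on k (\<lambda>x. ?Df x v \<bullet> b) U"
        by (rule Ck_on_bounded_linear[OF \<open>open U\<close>]) (use Suc.prems(1) in \<open>auto intro: bounded_linear_inner_left\<close>)
      show "Ck_on k (\<lambda>x. ?Dg (f x) b) U"
        by (rule Suc.IH[OF f _ Suc.prems(3)]) (use Suc.prems(2) in auto)
    qed
  qed
qed

text \<open>The coordinates are changed one at a time, and the mean value inequality is applied to
  each change; continuity of the partial derivatives makes all these estimates uniform near
  \<open>x\<close>.\<close>

lemma has_derivative_continuous_partials:
  fixes f :: "'a::euclidean_space \<Rightarrow> real"
  assumes "open U" "x \<in> U"
    and d: "\<And>b y. b \<in> Basis \<Longrightarrow> y \<in> U \<Longrightarrow> ((\<lambda>t. f (y + t *\<^sub>R b)) has_real_derivative g b y) (at 0)"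
    and c: "\<And>b. b \<in> Basis \<Longrightarrow> continuous_on U (g b)"
  shows "(f has_derivative (\<lambda>h. \<Sum>b\<in>Basis. (h \<bullet> b) * g b x)) (at x)"
proof -
  obtain r0 where r0: "r0 > 0" "ball x r0 \<subseteq> U" using assms(1,2) open_contains_ball by blast
  \<comment> \<open>The induction is on the set of coordinates that change. The base point
    \<open>y\<close> has to vary near \<open>x\<close>, since after the change of one coordinate the
    hypothesis is used at the displaced point.\<close>
  have main: "\<exists>r>0. \<forall>c y. (\<forall>b\<in>B. \<bar>c b\<bar> < r) \<longrightarrow> y \<in> ball x r \<longrightarrow>
        \<bar>f (y + (\<Sum>b\<in>B. c b *\<^sub>R b)) - f y - (\<Sum>b\<in>B. c b * g b x)\<bar> \<le> e * (\<Sum>b\<in>B. \<bar>c b\<bar>)"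
    if "e > 0" "B \<subseteq> Basis" for e B
    using finite_subset[OF that(2) finite_Basis] that(2)
  proof (induction B rule: finite_induct)
    case empty
    then show ?case by (intro exI[of _ 1]) auto
  next
    case (insert b B)
    then have b: "b \<in> Basis" "B \<subseteq> Basis" by auto
    obtain r1 where r1: "r1 > 0" "\<And>c y. (\<forall>b\<in>B. \<bar>c b\<bar> < r1) \<Longrightarrow> y \<in> ball x r1 \<Longrightarrow>
        \<bar>f (y + (\<Sum>b\<in>B. c b *\<^sub>R b)) - f y - (\<Sum>b\<in>B. c b * g b x)\<bar> \<le> e * (\<Sum>b\<in>B. \<bar>c b\<bar>)"
      using insert.IH b by blast
    obtain r2 where r2: "r2 > 0" "\<And>y. y \<in> U \<Longrightarrow> dist y x < r2 \<Longrightarrow> \<bar>g b y - g b x\<bar> < e"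
      using c[OF b(1)] \<open>x \<in> U\<close> \<open>e > 0\<close> unfolding continuous_on_iff dist_real_def by meson
    \<comment> \<open>Half of each radius: \<open>y\<close> is within \<open>r\<close> of
      \<open>x\<close>, and the step along \<open>b\<close> adds less than another
      \<open>r\<close>.\<close>
    define r where "r = min (min (r1/2) (r2/2)) (r0/2)"
    have r: "r > 0" "r \<le> r1/2" "r \<le> r2/2" "r \<le> r0/2" using r0 r1 r2 by (auto simp: r_def)
    show ?case
    proof (intro exI[of _ r] conjI allI impI)
      fix k y assume k: "\<forall>b'\<in>insert b B. \<bar>k b'\<bar> < r" and y: "y \<in> ball x r"
      \<comment> \<open>Subtracting the linear term makes the derivative
        \<open>g b (y + t *\<^sub>R b) - g b x\<close>, which is smaller than
        \<open>e\<close>.\<close>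
      define q where "q t = f (y + t *\<^sub>R b) - t * g b x" for t
      have near: "dist (y + t *\<^sub>R b) x < 2 * r" if "\<bar>t\<bar> < r" for t
      proof -
        have "dist (y + t *\<^sub>R b) x \<le> dist (y + t *\<^sub>R b) y + dist y x" by (rule dist_triangle)
        also have "dist (y + t *\<^sub>R b) y = \<bar>t\<bar>" using b by (simp add: dist_norm)
        finally show ?thesis using that y by (simp add: dist_commute)
      qed
      have dq: "(q has_real_derivative g b (y + t *\<^sub>R b) - g b x) (at t)" if "\<bar>t\<bar> < r" for t
      proof -
        have "y + t *\<^sub>R b \<in> U" using near[OF that] r r0 by (auto simp: dist_commute subset_iff)
        from d[OF b(1) this] have "((\<lambda>s. f (y + (t + s) *\<^sub>R b)) has_real_derivative g b (y + t *\<^sub>R b)) (at 0)"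
          by (simp add: algebra_simps)
        then have "((\<lambda>s. f (y + s *\<^sub>R b)) has_real_derivative g b (y + t *\<^sub>R b)) (at (t + 0))"
          using DERIV_shift[of "\<lambda>s. f (y + s *\<^sub>R b)" _ 0 t] by (simp add: add.commute)
        then show ?thesis unfolding q_def by (auto intro!: derivative_eq_intros)
      qed
      have "\<bar>q (k b) - q 0\<bar> \<le> e * \<bar>k b - 0\<bar>"
      proof -
        have "norm (q (k b) - q 0) \<le> e * norm (k b - 0)"
        proof (rule field_differentiable_bound[of "{-r<..<r}"])
          fix t assume "t \<in> {-r<..<r}"
          then have t: "\<bar>t\<bar> < r" by auto
          show "(q has_real_derivative g b (y + t *\<^sub>R b) - g b x) (at t within {-r<..<r})"
            using dq[OF t] by (rule has_field_derivative_at_within)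
          have "y + t *\<^sub>R b \<in> U" using near[OF t] r r0 by (auto simp: dist_commute subset_iff)
          with near[OF t] r r2 show "norm (g b (y + t *\<^sub>R b) - g b x) \<le> e" by fastforce
        qed (use k r in auto)
        then show ?thesis by simp
      qed
      then have 1: "\<bar>f (y + k b *\<^sub>R b) - f y - k b * g b x\<bar> \<le> e * \<bar>k b\<bar>"
        by (simp add: q_def algebra_simps)
      have "\<bar>k b\<bar> < r" using k by auto
      then have "y + k b *\<^sub>R b \<in> ball x r1" using near[of "k b"] r by (auto simp: dist_commute)
      moreover have "\<forall>b\<in>B. \<bar>k b\<bar> < r1" using k r by fastforce
      ultimately have 2: "\<bar>f (y + k b *\<^sub>R b + (\<Sum>b\<in>B. k b *\<^sub>R b)) - f (y + k b *\<^sub>R b) - (\<Sum>b\<in>B. k b * g b x)\<bar>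
            \<le> e * (\<Sum>b\<in>B. \<bar>k b\<bar>)" using r1 by blast
      show "\<bar>f (y + (\<Sum>b\<in>insert b B. k b *\<^sub>R b)) - f y - (\<Sum>b\<in>insert b B. k b * g b x)\<bar>
            \<le> e * (\<Sum>b\<in>insert b B. \<bar>k b\<bar>)"
        using 1 2 insert.hyps by (simp add: algebra_simps)
    qed (use r in auto)
  qed
  show ?thesis
    unfolding has_derivative_at_alt
  proof (intro conjI allI impI)
    show "bounded_linear (\<lambda>h. \<Sum>b\<in>Basis. (h \<bullet> b) * g b x)"
      by (intro bounded_linear_sum bounded_linear_mult_const bounded_linear_inner_left)
    fix e :: real assume "e > 0"
    then have e': "e / DIM('a) > 0" by simp
    obtain r where r: "r > 0" and R: "\<And>k y. (\<forall>b\<in>Basis. \<bar>k b\<bar> < r) \<Longrightarrow> y \<in> ball x r \<Longrightarrow>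
        \<bar>f (y + (\<Sum>b\<in>Basis. k b *\<^sub>R b)) - f y - (\<Sum>b\<in>Basis. k b * g b x)\<bar> \<le> e / DIM('a) * (\<Sum>b\<in>Basis. \<bar>k b\<bar>)"
      using main[OF e' order_refl] by blast
    show "\<exists>d>0. \<forall>y. norm (y - x) < d \<longrightarrow>
        norm (f y - f x - (\<Sum>b\<in>Basis. ((y - x) \<bullet> b) * g b x)) \<le> e * norm (y - x)"
    proof (intro exI[of _ r] conjI allI impI r)
      fix y assume y: "norm (y - x) < r"
      have "\<bar>f (x + (\<Sum>b\<in>Basis. ((y - x) \<bullet> b) *\<^sub>R b)) - f x - (\<Sum>b\<in>Basis. ((y - x) \<bullet> b) * g b x)\<bar>
          \<le> e / DIM('a) * (\<Sum>b\<in>Basis. \<bar>(y - x) \<bullet> b\<bar>)"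
        by (rule R) (use y r Basis_le_norm le_less_trans in \<open>auto, blast\<close>)
      moreover have "e / DIM('a) * (\<Sum>b\<in>Basis. \<bar>(y - x) \<bullet> b\<bar>) \<le> e / DIM('a) * (\<Sum>b\<in>(Basis::'a set). norm (y - x))"
        using e' by (intro mult_left_mono sum_mono Basis_le_norm) auto
      ultimately show "norm (f y - f x - (\<Sum>b\<in>Basis. ((y - x) \<bullet> b) * g b x)) \<le> e * norm (y - x)"
        by (simp add: euclidean_representation)
    qed
  qed
qed

text \<open>Directional derivatives of members are linear combinations of members, so the induction
  on the order never leaves the family. This reduces smoothness of a function given by a formula to
  continuity and partial derivatives of a whole class of such formulas.\<close>

lemma smooth_on_closed_family:
  fixes S :: "('a::euclidean_space \<Rightarrow> real) set"
  assumes "open U"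
    and cont: "\<And>f. f \<in> S \<Longrightarrow> continuous_on U f"
    and part: "\<And>f b. f \<in> S \<Longrightarrow> b \<in> Basis \<Longrightarrow>
      \<exists>g\<in>S. \<forall>x\<in>U. ((\<lambda>t. f (x + t *\<^sub>R b)) has_real_derivative g x) (at 0)"
    and "f \<in> S"
  shows "smooth_on f U"
  unfolding smooth_on_def
proof
  fix k
  show "Ck_on k f U" using \<open>f \<in> S\<close>
  proof (induction k arbitrary: f)
    case 0
    then show ?case using cont by simp
  next
    case (Suc k)
    have "\<forall>b\<in>Basis. \<exists>g\<in>S. \<forall>x\<in>U. ((\<lambda>t. f (x + t *\<^sub>R b)) has_real_derivative g x) (at 0)"
      using part[OF Suc.prems] by blast
    then obtain g where gS: "\<And>b. b \<in> Basis \<Longrightarrow> g b \<in> S"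
      and g: "\<And>b x. b \<in> Basis \<Longrightarrow> x \<in> U \<Longrightarrow> ((\<lambda>t. f (x + t *\<^sub>R b)) has_real_derivative g b x) (at 0)"
      by metis
    show ?case
    proof (rule Ck_on_SucI[OF \<open>open U\<close>])
      show "(f has_derivative (\<lambda>h. \<Sum>b\<in>Basis. (h \<bullet> b) * g b x)) (at x)" if "x \<in> U" for x
        by (rule has_derivative_continuous_partials[OF \<open>open U\<close> that g]) (use cont gS in auto)
      show "Ck_on k (\<lambda>x. \<Sum>b\<in>Basis. (v \<bullet> b) * g b x) U" for v
        using gS Suc.IH
        by (intro Ck_on_sum[OF \<open>open U\<close>] Ck_on_bounded_linear[OF \<open>open U\<close> bounded_linear_mult_right]) auto
    qed
  qed
qed

lemma smooth_on_cong: "open U \<Longrightarrow> (\<And>x. x \<in> U \<Longrightarrow> f x = g x) \<Longrightarrow> smooth_on f U \<Longrightarrow> smooth_on g U"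
  unfolding smooth_on_def using Ck_on_cong by blast

lemma smooth_on_subset: "smooth_on f U \<Longrightarrow> V \<subseteq> U \<Longrightarrow> smooth_on f V"
  unfolding smooth_on_def using Ck_on_subset by blast

lemma smooth_on_imp_continuous_on: "smooth_on f U \<Longrightarrow> continuous_on U f"
  unfolding smooth_on_def using Ck_on_imp_continuous by blast

lemma smooth_on_has_derivative:
  "open U \<Longrightarrow> smooth_on f U \<Longrightarrow> x \<in> U \<Longrightarrow> (f has_derivative frechet_derivative f (at x)) (at x)"
  unfolding smooth_on_def using Ck_on_has_derivative by blast

lemma smooth_on_frechet_derivative: "smooth_on f U \<Longrightarrow> smooth_on (\<lambda>x. frechet_derivative f (at x) v) U"
  unfolding smooth_on_def
proof
  fix k assume "\<forall>k. Ck_on k f U"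
  then have "Ck_on (Suc k) f U" by blast
  then show "Ck_on k (\<lambda>x. frechet_derivative f (at x) v) U" by simp
qed

lemma smooth_on_compose:
  fixes f :: "'a::euclidean_space \<Rightarrow> 'b::euclidean_space"
  shows "open U \<Longrightarrow> open V \<Longrightarrow> smooth_on f U \<Longrightarrow> smooth_on g V \<Longrightarrow> f ` U \<subseteq> V
    \<Longrightarrow> smooth_on (\<lambda>x. g (f x)) U"
  unfolding smooth_on_def using Ck_on_compose by blast

lemma smooth_on_linear: "open U \<Longrightarrow> bounded_linear L \<Longrightarrow> smooth_on L U"
  unfolding smooth_on_def using Ck_on_linear by blast

lemma smooth_on_const: "open U \<Longrightarrow> smooth_on (\<lambda>x. c) U"
  unfolding smooth_on_def using Ck_on_const by blast

lemma smooth_on_add: "open U \<Longrightarrow> smooth_on f U \<Longrightarrow> smooth_on g U \<Longrightarrow> smooth_on (\<lambda>x. f x + g x) U"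
  unfolding smooth_on_def using Ck_on_add by blast

lemma smooth_on_bilinear: "open U \<Longrightarrow> bounded_bilinear B \<Longrightarrow> smooth_on f U \<Longrightarrow> smooth_on g U
    \<Longrightarrow> smooth_on (\<lambda>x. B (f x) (g x)) U"
  unfolding smooth_on_def using Ck_on_bilinear by blast

lemmas smooth_on_mult = smooth_on_bilinear[OF _ bounded_bilinear_mult]
lemmas smooth_on_scaleR = smooth_on_bilinear[OF _ bounded_bilinear_scaleR]

section \<open>Smoothness of the reciprocal and of the square root\<close>

lemma inverse_power_has_real_derivative:
  "x \<noteq> 0 \<Longrightarrow> ((\<lambda>t. inverse (x + t) ^ n) has_real_derivative - real n * inverse x ^ Suc n) (at 0)"
proof (induction n)
  case (Suc n)
  have "((\<lambda>t. inverse (x + t) * inverse (x + t) ^ n) has_real_derivative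
      - (inverse x ^ 2) * inverse x ^ n + inverse x * (- real n * inverse x ^ Suc n)) (at 0)"
  proof -
    have "((\<lambda>t. inverse (x + t)) has_real_derivative - (inverse x ^ 2)) (at 0)"
      using Suc.prems by (auto intro!: derivative_eq_intros simp: power2_eq_square)
    from DERIV_mult[OF this Suc.IH[OF Suc.prems]] show ?thesis
      by (rule DERIV_cong) (simp add: algebra_simps)
  qed
  then show ?case by (simp add: algebra_simps power2_eq_square)
qed simp

lemma smooth_on_inverse: "smooth_on (inverse :: real \<Rightarrow> real) (- {0})"
proof (rule smooth_on_closed_family[where S = "range (\<lambda>(c, n). \<lambda>x::real. c * inverse x ^ n)"])
  show "inverse \<in> range (\<lambda>(c, n). \<lambda>x::real. c * inverse x ^ n)"
    by (rule image_eqI[of _ _ "(1, 1)"]) auto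
  fix f :: "real \<Rightarrow> real" assume "f \<in> range (\<lambda>(c, n). \<lambda>x::real. c * inverse x ^ n)"
  then obtain c n where f: "f = (\<lambda>x. c * inverse x ^ n)" by auto
  show "continuous_on (- {0}) f" unfolding f by (intro continuous_intros) auto
  fix b :: real assume "b \<in> Basis"
  then have [simp]: "b = 1" by simp
  show "\<exists>g\<in>range (\<lambda>(c, n). \<lambda>x::real. c * inverse x ^ n). \<forall>x\<in>- {0}. ((\<lambda>t. f (x + t *\<^sub>R b)) has_real_derivative g x) (at 0)"
    using DERIV_cmult[OF inverse_power_has_real_derivative, of _ c n]
    by (intro bexI[OF _ rangeI[of _ "(- c * n, Suc n)"]]) (auto simp: f mult.assoc)
qed auto

lemma smooth_on_sqrt: "smooth_on sqrt {0<..}"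
proof (rule smooth_on_closed_family[where S = "range (\<lambda>(c, n). \<lambda>x::real. c * sqrt x * inverse x ^ n)"])
  show "sqrt \<in> range (\<lambda>(c, n). \<lambda>x::real. c * sqrt x * inverse x ^ n)"
    by (rule image_eqI[of _ _ "(1, 0)"]) auto
  fix f :: "real \<Rightarrow> real" assume "f \<in> range (\<lambda>(c, n). \<lambda>x::real. c * sqrt x * inverse x ^ n)"
  then obtain c n where f: "f = (\<lambda>x. c * sqrt x * inverse x ^ n)" by auto
  show "continuous_on {0<..} f" unfolding f by (intro continuous_intros) auto
  fix b :: real assume "b \<in> Basis"
  then have [simp]: "b = 1" by simp
  have "((\<lambda>t. f (x + t *\<^sub>R b)) has_real_derivative (c * (1/2 - n)) * sqrt x * inverse x ^ Suc n) (at 0)" if "x > 0" for x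
  proof -
    have s: "inverse (sqrt x) = sqrt x * inverse x" using that by (simp add: real_div_sqrt field_simps)
    have "((\<lambda>t. sqrt (x + t)) has_real_derivative sqrt x * inverse x / 2) (at 0)"
      using that by (auto intro!: derivative_eq_intros simp: s)
    from DERIV_cmult[OF DERIV_mult[OF this inverse_power_has_real_derivative[of x n]], of c] that
    show ?thesis unfolding f by (simp add: algebra_simps)
  qed
  then show "\<exists>g\<in>range (\<lambda>(c, n). \<lambda>x::real. c * sqrt x * inverse x ^ n). \<forall>x\<in>{0<..}. ((\<lambda>t. f (x + t *\<^sub>R b)) has_real_derivative g x) (at 0)"
    by (intro bexI[OF _ rangeI[of _ "(c * (1/2 - n), Suc n)"]]) auto
qed auto

section \<open>Germs at the origin: representatives on balls and closure properties\<close>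

lemma smooth_germE:
  assumes "smooth_germ f"
  obtains r where "r > 0" "smooth_on f (ball 0 r)"
  using assms unfolding smooth_germ_def by (meson open_contains_ball smooth_on_subset)

lemma smooth_germI: "r > 0 \<Longrightarrow> smooth_on f (ball 0 r) \<Longrightarrow> smooth_germ f"
  unfolding smooth_germ_def by (meson centre_in_ball open_ball)

lemma smooth_germE2:
  assumes "smooth_germ f" "smooth_germ g"
  obtains r where "r > 0" "smooth_on f (ball 0 r)" "smooth_on g (ball 0 r)"
proof -
  obtain r1 r2 where r: "r1 > 0" "r2 > 0" and s: "smooth_on f (ball 0 r1)" "smooth_on g (ball 0 r2)"
    using assms smooth_germE by metis
  show thesis
    using that[OF _ smooth_on_subset[OF s(1)] smooth_on_subset[OF s(2)], of "min r1 r2"] r by (auto simp: subset_ball)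
qed

lemma smooth_germ_cong:
  assumes "smooth_germ f" "\<forall>\<^sub>F x in nhds 0. f x = g x"
  shows "smooth_germ g"
proof -
  obtain r1 where 1: "r1 > 0" "smooth_on f (ball 0 r1)" using assms smooth_germE by metis
  obtain r2 where 2: "r2 > 0" "\<And>x. x \<in> ball 0 r2 \<Longrightarrow> f x = g x"
    using assms(2) unfolding eventually_nhds_metric by (auto simp: dist_commute)
  show ?thesis
    by (rule smooth_germI[of "min r1 r2"], use 1 2 in simp, rule smooth_on_cong[of _ f])
      (use 1 2 in \<open>auto elim!: smooth_on_subset\<close>)
qed

lemma smooth_germ_has_derivative:
  assumes "smooth_germ f"
  shows "\<forall>\<^sub>F x in nhds 0. (f has_derivative frechet_derivative f (at x)) (at x)"
proof -
  obtain r where r: "r > 0" "smooth_on f (ball 0 r)" using assms smooth_germE by metis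
  then have "\<forall>x\<in>ball 0 r. (f has_derivative frechet_derivative f (at x)) (at x)"
    using smooth_on_has_derivative by blast
  with r(1) show ?thesis by (auto simp: eventually_nhds intro!: exI[of _ "ball 0 r"])
qed

lemma smooth_germ_has_derivative_0: "smooth_germ f \<Longrightarrow> (f has_derivative frechet_derivative f (at 0)) (at 0)"
  using smooth_germ_has_derivative eventually_nhds_x_imp_x by blast

lemma smooth_germ_isCont: "smooth_germ f \<Longrightarrow> isCont f 0"
  using smooth_germ_has_derivative_0 has_derivative_continuous by blast

lemma smooth_germ_tendsto: "smooth_germ f \<Longrightarrow> (f \<longlongrightarrow> f 0) (nhds 0)"
  using smooth_germ_isCont[of f] unfolding isCont_def tendsto_at_iff_tendsto_nhds .

lemma smooth_germ_frechet_derivative: "smooth_germ f \<Longrightarrow> smooth_germ (\<lambda>x. frechet_derivative f (at x) v)"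
  by (erule smooth_germE) (erule smooth_germI, rule smooth_on_frechet_derivative)

lemma smooth_germ_const: "smooth_germ (\<lambda>x. c)"
  by (rule smooth_germI[of 1]) (auto intro: smooth_on_const)

lemma smooth_germ_linear: "bounded_linear L \<Longrightarrow> smooth_germ L"
  by (rule smooth_germI[of 1]) (auto intro: smooth_on_linear)

lemma smooth_germ_ident: "smooth_germ (\<lambda>x. x)"
  by (rule smooth_germ_linear) (rule bounded_linear_ident)

lemma smooth_germ_inner: "smooth_germ (\<lambda>x. x \<bullet> b)"
  by (rule smooth_germ_linear) (rule bounded_linear_inner_left)

lemma smooth_germ_bilinear: "bounded_bilinear B \<Longrightarrow> smooth_germ f \<Longrightarrow> smooth_germ g \<Longrightarrow> smooth_germ (\<lambda>x. B (f x) (g x))"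
  by (erule (1) smooth_germE2, erule smooth_germI, rule smooth_on_bilinear) auto

lemma smooth_germ_mult:
  "smooth_germ f \<Longrightarrow> smooth_germ g \<Longrightarrow> smooth_germ (\<lambda>x. f x * g x :: real)"
  by (rule smooth_germ_bilinear[OF bounded_bilinear_mult])

lemma smooth_germ_scaleR:
  "smooth_germ f \<Longrightarrow> smooth_germ g \<Longrightarrow> smooth_germ (\<lambda>x. f x *\<^sub>R g x)"
  by (rule smooth_germ_bilinear[OF bounded_bilinear_scaleR])

lemma smooth_germ_add: "smooth_germ f \<Longrightarrow> smooth_germ g \<Longrightarrow> smooth_germ (\<lambda>x. f x + g x)"
  by (erule (1) smooth_germE2, erule smooth_germI, rule smooth_on_add) auto

lemma smooth_germ_minus:
  assumes "smooth_germ f" shows "smooth_germ (\<lambda>x. - f x)"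
  using smooth_germ_scaleR[OF smooth_germ_const[of "-1"] assms] by simp

lemma smooth_germ_diff: "smooth_germ f \<Longrightarrow> smooth_germ g \<Longrightarrow> smooth_germ (\<lambda>x. f x - g x)"
  using smooth_germ_add[OF _ smooth_germ_minus, of f g] by simp

lemma smooth_germ_sum: "(\<And>i. i \<in> I \<Longrightarrow> smooth_germ (f i)) \<Longrightarrow> smooth_germ (\<lambda>x. \<Sum>i\<in>I. f i x)"
  by (induction I rule: infinite_finite_induct) (auto intro: smooth_germ_const smooth_germ_add)

lemma smooth_germ_prod:
  "(\<And>i. i \<in> I \<Longrightarrow> smooth_germ (f i)) \<Longrightarrow> smooth_germ (\<lambda>x. \<Prod>i\<in>I. f i x :: real)"
  by (induction I rule: infinite_finite_induct) (auto intro: smooth_germ_const smooth_germ_mult)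

lemma smooth_germ_power: "smooth_germ f \<Longrightarrow> smooth_germ (\<lambda>x. f x ^ n :: real)"
  by (induction n) (auto intro: smooth_germ_const smooth_germ_mult)

lemma smooth_germ_compose_on:
  fixes f :: "'a::euclidean_space \<Rightarrow> 'b::euclidean_space"
  assumes "open V" "smooth_on g V" "smooth_germ f" "f 0 \<in> V"
  shows "smooth_germ (\<lambda>x. g (f x))"
proof -
  obtain r where r: "r > 0" "smooth_on f (ball 0 r)" using assms smooth_germE by metis
  define W where "W = ball 0 r \<inter> f -` V"
  have "open W" unfolding W_def
    using continuous_open_preimage[OF smooth_on_imp_continuous_on[OF r(2)] open_ball assms(1)] .
  moreover have "0 \<in> W" using r assms by (auto simp: W_def)
  moreover have "smooth_on (\<lambda>x. g (f x)) W"
    by (rule smooth_on_compose[OF \<open>open W\<close> assms(1) smooth_on_subset[OF r(2)] assms(2)]) (auto simp: W_def)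
  ultimately show ?thesis unfolding smooth_germ_def by blast
qed

lemma smooth_germ_compose:
  fixes f :: "'a::euclidean_space \<Rightarrow> 'b::euclidean_space"
  assumes "smooth_germ g" "smooth_germ f" "f 0 = 0"
  shows "smooth_germ (\<lambda>x. g (f x))"
proof -
  obtain r where "r > 0" "smooth_on g (ball 0 r)" using assms smooth_germE by metis
  then show ?thesis by (intro smooth_germ_compose_on[OF open_ball _ assms(2)]) (auto simp: assms)
qed

lemma smooth_germ_inverse: "smooth_germ f \<Longrightarrow> f 0 \<noteq> (0::real) \<Longrightarrow> smooth_germ (\<lambda>x. inverse (f x))"
  by (rule smooth_germ_compose_on[OF _ smooth_on_inverse]) auto

lemma smooth_germ_divide: "smooth_germ f \<Longrightarrow> smooth_germ g \<Longrightarrow> g 0 \<noteq> (0::real) \<Longrightarrow> smooth_germ (\<lambda>x. f x / g x)"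
  unfolding divide_inverse by (intro smooth_germ_mult smooth_germ_inverse)

lemma smooth_germ_sqrt: "smooth_germ f \<Longrightarrow> f 0 > 0 \<Longrightarrow> smooth_germ (\<lambda>x. sqrt (f x))"
  by (rule smooth_germ_compose_on[OF _ smooth_on_sqrt]) auto

lemma smooth_germ_componentwise:
  fixes f :: "'a::euclidean_space \<Rightarrow> 'b::euclidean_space"
  assumes "\<And>i. i \<in> Basis \<Longrightarrow> smooth_germ (\<lambda>x. f x \<bullet> i)"
  shows "smooth_germ f"
proof -
  have "smooth_germ (\<lambda>x. \<Sum>i\<in>Basis. (f x \<bullet> i) *\<^sub>R i)"
    by (intro smooth_germ_sum smooth_germ_scaleR smooth_germ_const assms)
  then show ?thesis by (simp add: euclidean_representation)
qed

lemma smooth_germ_bounded_linear: "bounded_linear L \<Longrightarrow> smooth_germ f \<Longrightarrow> smooth_germ (\<lambda>x. L (f x))"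
  for f :: "'a::euclidean_space \<Rightarrow> 'b::euclidean_space"
  by (rule smooth_germ_compose_on[of UNIV]) (auto intro: smooth_on_linear)

lemma smooth_germ_inner_right:
  fixes f :: "'a::euclidean_space \<Rightarrow> 'b::euclidean_space"
  shows "smooth_germ f \<Longrightarrow> smooth_germ (\<lambda>x. f x \<bullet> c)"
  by (rule smooth_germ_bounded_linear) (rule bounded_linear_inner_left)

lemma smooth_germ_Pair:
  fixes f :: "'a::euclidean_space \<Rightarrow> 'b::euclidean_space" and g :: "'a \<Rightarrow> 'c::euclidean_space"
  assumes "smooth_germ f" "smooth_germ g"
  shows "smooth_germ (\<lambda>x. (f x, g x))"
  by (rule smooth_germ_componentwise)
     (auto simp: Basis_prod_def intro: smooth_germ_inner_right[OF assms(1)] smooth_germ_inner_right[OF assms(2)])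

lemmas smooth_germ_intros = smooth_germ_const smooth_germ_ident smooth_germ_inner smooth_germ_mult smooth_germ_scaleR
  smooth_germ_add smooth_germ_minus smooth_germ_diff smooth_germ_power smooth_germ_inner_right smooth_germ_Pair

subsection \<open>Parameter integrals and Hadamard's lemma\<close>

lemma has_real_derivative_along_line:
  assumes "(f has_derivative f') (at (x + t *\<^sub>R v))"
  shows "((\<lambda>t. f (x + t *\<^sub>R v)) has_real_derivative f' v) (at t)"
proof -
  have "((\<lambda>t. f (x + t *\<^sub>R v)) has_derivative (\<lambda>s. f' (s *\<^sub>R v))) (at t)"
    by (rule has_derivative_compose[where g = f and f = "\<lambda>t. x + t *\<^sub>R v", OF _ assms]) (auto intro!: derivative_eq_intros)
  moreover have "(\<lambda>s. f' (s *\<^sub>R v)) = (*) (f' v)"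
    using assms has_derivative_linear linear_cmul by (fastforce simp: mult.commute)
  ultimately show ?thesis by (simp add: has_field_derivative_def)
qed

text \<open>Leibniz' rule in one direction, which is all that the closed-family criterion asks for.
  \<open>W\<close> may be any open neighbourhood of \<open>{0..1} \<times> V\<close>, as the
  integrands used later are smooth only on such a set.\<close>

lemma param_integral_line_derivative:
  fixes F :: "real \<times> 'a::euclidean_space \<Rightarrow> real"
  assumes "open W" "open V" "{0..1} \<times> V \<subseteq> W" "smooth_on F W" "x \<in> V"
  shows "((\<lambda>t. integral {0..1} (\<lambda>\<tau>. F (\<tau>, x + t *\<^sub>R v))) has_real_derivative
     integral {0..1} (\<lambda>\<tau>. frechet_derivative F (at (\<tau>, x)) (0, v))) (at 0)"
proof -
  have "open ((\<lambda>t::real. x + t *\<^sub>R v) -` V)"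
    by (rule open_vimage[OF assms(2)]) (auto intro!: continuous_intros)
  moreover have "0 \<in> (\<lambda>t::real. x + t *\<^sub>R v) -` V" using assms by simp
  ultimately obtain d where d: "d > 0" "ball 0 d \<subseteq> (\<lambda>t::real. x + t *\<^sub>R v) -` V"
    using open_contains_ball by blast
  have inW: "(\<tau>, x + t *\<^sub>R v) \<in> W" if "t \<in> ball 0 d" "\<tau> \<in> {0..1}" for t \<tau>
    using that d assms(3) by (auto simp: subset_iff)
  have c: "continuous_on (ball 0 d \<times> cbox 0 1) (\<lambda>(t, \<tau>). frechet_derivative F (at (\<tau>, x + t *\<^sub>R v)) (0, v))"
    unfolding case_prod_unfold
    by (rule continuous_on_compose2[OF smooth_on_imp_continuous_on[OF smooth_on_frechet_derivative[OF assms(4)]]])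
       (auto intro!: continuous_intros inW)
  have "((\<lambda>t. integral (cbox 0 1) (\<lambda>\<tau>. F (\<tau>, x + t *\<^sub>R v))) has_real_derivative
     integral (cbox 0 1) (\<lambda>\<tau>. frechet_derivative F (at (\<tau>, x + 0 *\<^sub>R v)) (0, v))) (at 0 within ball 0 d)"
  proof (rule leibniz_rule_field_derivative[OF _ _ c])
    show "((\<lambda>t. F (\<tau>, x + t *\<^sub>R v)) has_real_derivative frechet_derivative F (at (\<tau>, x + t *\<^sub>R v)) (0, v)) (at t within ball 0 d)"
      if "t \<in> ball 0 d" "\<tau> \<in> cbox 0 1" for t \<tau>
      using has_real_derivative_along_line[of F _ "(\<tau>, x)" t "(0, v)"]
        smooth_on_has_derivative[OF assms(1,4) inW[of t \<tau>]] that
      by (auto intro: has_field_derivative_at_within)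
    show "(\<lambda>\<tau>. F (\<tau>, x + t *\<^sub>R v)) integrable_on cbox 0 1" if "t \<in> ball 0 d" for t
      by (rule integrable_continuous, rule continuous_on_compose2[OF smooth_on_imp_continuous_on[OF assms(4)]])
         (use that in \<open>auto intro!: continuous_intros inW\<close>)
  qed (use d in auto)
  then show ?thesis using d by (simp add: at_within_open[of 0 "ball 0 d"])
qed

lemma smooth_on_param_integral:
  fixes F :: "real \<times> 'a::euclidean_space \<Rightarrow> real"
  assumes "open W" "open V" "{0..1} \<times> V \<subseteq> W" "smooth_on F W"
  shows "smooth_on (\<lambda>z. integral {0..1} (\<lambda>\<tau>. F (\<tau>, z))) V"
proof (rule smooth_on_closed_family[OF assms(2), where S = "(\<lambda>F z. integral {0..1} (\<lambda>\<tau>. F (\<tau>, z))) ` {F. smooth_on F W}"])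
  fix f :: "'a \<Rightarrow> real" assume "f \<in> (\<lambda>F z. integral {0..1} (\<lambda>\<tau>. F (\<tau>, z))) ` {F. smooth_on F W}"
  then obtain F where f: "f = (\<lambda>z. integral {0..1} (\<lambda>\<tau>. F (\<tau>, z)))" and F: "smooth_on F W" by auto
  show "continuous_on V f"
    unfolding f cbox_interval[symmetric]
    by (rule integral_continuous_on_param)
       (auto simp: case_prod_unfold intro!: continuous_intros continuous_on_compose2[OF smooth_on_imp_continuous_on[OF F]] subsetD[OF assms(3)])
  show "\<exists>g\<in>(\<lambda>F z. integral {0..1} (\<lambda>\<tau>. F (\<tau>, z))) ` {F. smooth_on F W}. \<forall>x\<in>V. ((\<lambda>t. f (x + t *\<^sub>R b)) has_real_derivative g x) (at 0)" for b
    using param_integral_line_derivative[OF assms(1,2,3) F] smooth_on_frechet_derivative[OF F]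
    by (intro bexI[where x = "\<lambda>z. integral {0..1} (\<lambda>\<tau>. frechet_derivative F (at (\<tau>, z)) (0, b))"])
       (auto simp: f)
qed (use assms in auto)

lemma Ck_on_Un:
  assumes "open U" "open V"
  shows "Ck_on k f U \<Longrightarrow> Ck_on k f V \<Longrightarrow> Ck_on k f (U \<union> V)"
proof (induction k arbitrary: f)
  case 0
  then show ?case using continuous_on_open_Un[OF assms] by simp
next
  case (Suc k)
  have "f differentiable_on (U \<union> V)"
    using Suc.prems assms by (auto simp: differentiable_on_eq_differentiable_at open_Un)
  with Suc show ?case by simp
qed

lemma smooth_on_Un: "open U \<Longrightarrow> open V \<Longrightarrow> smooth_on f U \<Longrightarrow> smooth_on f V \<Longrightarrow> smooth_on f (U \<union> V)"
  unfolding smooth_on_def using Ck_on_Un by blast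

subsection \<open>Cutoff functions\<close>

text \<open>The flat function \<open>exp (-1/x)\<close> with a polynomial in \<open>1/x\<close> as
  an extra factor: the derivative of \<open>exp (-1/x) * p (1/x)\<close> is
  \<open>exp (-1/x) * (1/x)^2 * (p - p') (1/x)\<close>, so these functions form a family closed
  under differentiation.\<close>

definition flat_poly :: "real poly \<Rightarrow> real \<Rightarrow> real" where
  "flat_poly p x = (if x \<le> 0 then 0 else exp (- inverse x) * poly p (inverse x))"

lemma flat_poly_tendsto_0: "(flat_poly p \<longlongrightarrow> 0) (at 0)"
proof -
  have "((\<lambda>y::real. \<Sum>i\<le>degree p. coeff p i * (y ^ i / exp y)) \<longlongrightarrow> (\<Sum>i\<le>degree p. coeff p i * 0)) at_top"
    by (intro tendsto_sum tendsto_mult tendsto_const tendsto_power_div_exp_0)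
  then have "((\<lambda>y. exp (- y) * poly p y) \<longlongrightarrow> 0) at_top"
    by (simp add: poly_altdef sum_distrib_left sum_divide_distrib exp_minus field_simps)
  then have "((\<lambda>x. exp (- inverse x) * poly p (inverse x)) \<longlongrightarrow> 0) (at_right 0)"
    using filterlim_inverse_at_top_right by (rule filterlim_compose)
  then have "(flat_poly p \<longlongrightarrow> 0) (at_right 0)"
    by (rule Lim_transform_eventually) (auto simp: eventually_at_filter flat_poly_def)
  moreover have "(flat_poly p \<longlongrightarrow> 0) (at_left 0)"
    by (rule Lim_transform_eventually[OF tendsto_const]) (auto simp: eventually_at_filter flat_poly_def)
  ultimately show ?thesis by (simp add: filterlim_split_at)
qed

lemma flat_poly_has_real_derivative:
  "(flat_poly p has_real_derivative flat_poly ([:0, 0, 1:] * (p - pderiv p)) x) (at x)"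
proof -
  consider "x < 0" | "x = 0" | "x > 0" by linarith
  then show ?thesis
  proof cases
    case 1
    have "((\<lambda>x. 0) has_real_derivative 0) (at x)" by simp
    then have "(flat_poly p has_real_derivative 0) (at x)"
      by (rule has_field_derivative_transform_within_open[of _ _ _ "{..<0}"]) (use 1 in \<open>auto simp: flat_poly_def\<close>)
    then show ?thesis using 1 by (simp add: flat_poly_def)
  next
    case 2
    \<comment> \<open>The difference quotient at 0 is again of this form, with \<open>p\<close>
      multiplied by the variable, so the limit at 0 is already known.\<close>
    have "(\<lambda>h. (flat_poly p (0 + h) - flat_poly p 0) / h) = flat_poly ([:0, 1:] * p)"
      by (auto simp: flat_poly_def fun_eq_iff field_simps)
    then have "(flat_poly p has_real_derivative 0) (at 0)"
      using flat_poly_tendsto_0[of "[:0, 1:] * p"] by (simp add: DERIV_def)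
    then show ?thesis using 2 by (simp add: flat_poly_def)
  next
    case 3
    have i: "((\<lambda>t. inverse t) has_real_derivative - (inverse x ^ 2)) (at x)"
      using 3 by (auto intro!: derivative_eq_intros simp: power2_eq_square)
    have p: "((\<lambda>t. poly p (inverse t)) has_real_derivative poly (pderiv p) (inverse x) * - (inverse x ^ 2)) (at x)"
      by (rule DERIV_chain2[OF poly_DERIV i])
    have "((\<lambda>t. exp (- inverse t)) has_real_derivative exp (- inverse x) * inverse x ^ 2) (at x)"
      by (rule DERIV_cong[OF DERIV_fun_exp[OF DERIV_minus[OF i]]]) simp
    from DERIV_mult[OF this p]
    have "((\<lambda>t. exp (- inverse t) * poly p (inverse t)) has_real_derivative flat_poly ([:0, 0, 1:] * (p - pderiv p)) x) (at x)"
      by (rule DERIV_cong) (use 3 in \<open>simp add: flat_poly_def algebra_simps power2_eq_square\<close>)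
    then show ?thesis
      by (rule has_field_derivative_transform_within_open[of _ _ _ "{0<..}"]) (use 3 in \<open>auto simp: flat_poly_def\<close>)
  qed
qed

lemma smooth_on_flat_poly: "smooth_on (flat_poly p) UNIV"
proof (rule smooth_on_closed_family[where S = "range flat_poly"])
  fix f assume "f \<in> range flat_poly"
  then obtain p where f: "f = flat_poly p" by blast
  show "continuous_on UNIV f" unfolding f
    using flat_poly_has_real_derivative DERIV_isCont by (blast intro: continuous_at_imp_continuous_on)
  show "\<exists>g\<in>range flat_poly. \<forall>x\<in>UNIV. ((\<lambda>t. f (x + t *\<^sub>R b)) has_real_derivative g x) (at 0)"
    if "b \<in> Basis" for b :: real
    using that DERIV_shift[of "flat_poly p" _ 0] flat_poly_has_real_derivative[of p]
    by (intro bexI[OF _ rangeI[of _ "[:0, 0, 1:] * (p - pderiv p)"]]) (simp add: f add.commute)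
qed auto

definition cutoff :: "real \<Rightarrow> real" where
  "cutoff t = flat_poly 1 (2 - t) / (flat_poly 1 (2 - t) + flat_poly 1 (t - 1))"

lemma cutoff_eq_1: "t \<le> 1 \<Longrightarrow> cutoff t = 1"
  by (simp add: cutoff_def flat_poly_def)

lemma cutoff_eq_0: "t \<ge> 2 \<Longrightarrow> cutoff t = 0"
  by (simp add: cutoff_def flat_poly_def)

lemma smooth_on_cutoff: "smooth_on cutoff UNIV"
proof -
  have lin: "smooth_on (\<lambda>t. c + d * t :: real) UNIV" for c d :: real
    by (intro smooth_on_add smooth_on_const smooth_on_linear bounded_linear_mult_right) auto
  have c: "smooth_on (\<lambda>t. flat_poly 1 (c + d * t)) UNIV" for c d :: real
    by (rule smooth_on_compose[OF _ _ lin smooth_on_flat_poly]) auto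
  have "flat_poly 1 (2 - t) + flat_poly 1 (t - 1) > 0" for t
    by (cases "t < 2") (auto simp: flat_poly_def add_pos_nonneg)
  then have nz: "(\<lambda>t. flat_poly 1 (2 + (-1) * t) + flat_poly 1 (-1 + 1 * t)) ` UNIV \<subseteq> - {0}"
    by (auto simp: less_le algebra_simps) 
  have "smooth_on (\<lambda>t. inverse (flat_poly 1 (2 + (-1) * t) + flat_poly 1 (-1 + 1 * t))) UNIV"
    by (rule smooth_on_compose[OF _ _ smooth_on_add[OF _ c c] smooth_on_inverse nz]) auto
  from smooth_on_mult[OF _ c[of 2 "-1"] this]
  have "smooth_on (\<lambda>t. flat_poly 1 (2 + (-1) * t) * inverse (flat_poly 1 (2 + (-1) * t) + flat_poly 1 (-1 + 1 * t))) UNIV"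
    by simp
  then show ?thesis by (simp add: cutoff_def[abs_def] divide_inverse)
qed

subsection \<open>Changing one coordinate\<close>

text \<open>For a basis vector \<open>b\<close>, the point of the fibre through \<open>z\<close> in
  direction \<open>b\<close> at which the coordinate along \<open>b\<close> is \<open>t\<close>.
  Fibre and parameters thus stay inside one space, and no splitting into a line and a complement is
  needed.\<close>

definition upd :: "'a::euclidean_space \<Rightarrow> 'a \<Rightarrow> real \<Rightarrow> 'a" where
  "upd b z t = z + (t - z \<bullet> b) *\<^sub>R b"

lemma upd_inner: "b \<in> Basis \<Longrightarrow> i \<in> Basis \<Longrightarrow> upd b z t \<bullet> i = (if i = b then t else z \<bullet> i)"
  by (auto simp: upd_def inner_add_left inner_Basis)

lemma upd_inner_same [simp]: "b \<in> Basis \<Longrightarrow> upd b z t \<bullet> b = t"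
  by (simp add: upd_inner)

lemma upd_same [simp]: "upd b z (z \<bullet> b) = z"
  by (simp add: upd_def)

lemma upd_upd [simp]: "b \<in> Basis \<Longrightarrow> upd b (upd b z s) t = upd b z t"
  by (rule euclidean_eqI) (simp add: upd_inner)

lemma upd_0 [simp]: "upd b 0 0 = 0"
  by (simp add: upd_def)

lemma norm_upd_le:
  assumes "b \<in> Basis" "\<bar>t\<bar> \<le> \<bar>z \<bullet> b\<bar>"
  shows "norm (upd b z t) \<le> norm z"
  by (rule norm_le_componentwise) (use assms in \<open>auto simp: upd_inner\<close>)

lemma upd_scaled_in_ball:
  assumes "b \<in> Basis" "z \<in> ball 0 r" "\<tau> \<in> {0..1}"
  shows "upd b z (\<tau> * (z \<bullet> b)) \<in> ball 0 r"
proof -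
  have "\<bar>\<tau> * (z \<bullet> b)\<bar> \<le> \<bar>z \<bullet> b\<bar>" using assms(3) by (simp add: abs_mult mult_left_le_one_le)
  from norm_upd_le[OF assms(1) this] assms(2) show ?thesis by simp
qed

lemma smooth_germ_upd [intro]:
  fixes f :: "'a::euclidean_space \<Rightarrow> 'b::euclidean_space"
  shows "smooth_germ f \<Longrightarrow> smooth_germ g \<Longrightarrow> smooth_germ (\<lambda>z. upd b (f z) (g z))"
  unfolding upd_def by (intro smooth_germ_intros)

abbreviation pd :: "'a::euclidean_space \<Rightarrow> ('a \<Rightarrow> real) \<Rightarrow> 'a \<Rightarrow> real" where
  "pd b f z \<equiv> frechet_derivative f (at z) b"

lemma pd_eqI: "(f has_derivative f') (at z) \<Longrightarrow> pd b f z = f' b"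
  using frechet_derivative_at by metis

lemma upd_has_real_derivative:
  assumes "b \<in> Basis" "(f has_derivative f') (at (upd b z t))"
  shows "((\<lambda>t. f (upd b z t)) has_real_derivative f' b) (at t)"
proof -
  have u: "upd b z s = (z - (z \<bullet> b) *\<^sub>R b) + s *\<^sub>R b" for s by (simp add: upd_def algebra_simps)
  show ?thesis
    using has_real_derivative_along_line[of f f' "z - (z \<bullet> b) *\<^sub>R b" t b] assms(2) by (simp only: u)
qed

text \<open>The set contains with each point the segment along \<open>b\<close> to the hyperplane
  \<open>z \<bullet> b = 0\<close>, so integration along the fibre from that hyperplane makes sense.
  Balls around 0 and the whole space are the instances.\<close>

locale coord_starlike =
  fixes b :: "'a::euclidean_space" and V :: "'a set"
  assumes basis: "b \<in> Basis" and open_V: "open V"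
    and star: "\<And>z \<tau>. z \<in> V \<Longrightarrow> \<tau> \<in> {0..1} \<Longrightarrow> upd b z (\<tau> * (z \<bullet> b)) \<in> V"
begin

text \<open>Supplies the open set that differentiation under the integral requires: the preimage of
  \<open>V\<close> under the scaling map.\<close>

lemma scaled_smooth:
  fixes k :: "'a \<Rightarrow> real"
  assumes "smooth_on k V" "smooth_on p UNIV"
  obtains W where "open W" "{0..1} \<times> V \<subseteq> W"
    "smooth_on (\<lambda>x. p (fst x) * k (upd b (snd x) (fst x * (snd x \<bullet> b))) :: real) W"
    "\<And>x. x \<in> W \<Longrightarrow> upd b (snd x) (fst x * (snd x \<bullet> b)) \<in> V"
proof
  let ?m = "\<lambda>x. upd b (snd x) (fst x * (snd x \<bullet> b))"
  have m: "smooth_on ?m UNIV"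
    unfolding upd_def diff_conv_add_uminus
    by (intro smooth_on_add smooth_on_scaleR smooth_on_mult smooth_on_const smooth_on_linear
        bounded_linear_snd bounded_linear_fst bounded_linear_minus bounded_linear_inner_left[THEN bounded_linear_compose] open_UNIV)
  show oW: "open (?m -` V)"
    by (rule open_vimage[OF open_V]) (rule smooth_on_imp_continuous_on[OF m])
  show "{0..1} \<times> V \<subseteq> ?m -` V" using star by auto
  have "smooth_on (\<lambda>x. p (fst x)) (?m -` V)"
    by (rule smooth_on_compose[OF oW open_UNIV _ assms(2)]) (auto intro: smooth_on_linear bounded_linear_fst oW)
  moreover have "smooth_on (\<lambda>x. k (?m x)) (?m -` V)"
    by (rule smooth_on_compose[OF oW open_V smooth_on_subset[OF m] assms(1)]) auto
  ultimately show "smooth_on (\<lambda>x. p (fst x) * k (?m x)) (?m -` V)"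
    by (intro smooth_on_mult oW)
qed auto

lemma smooth_on_scale_integral:
  fixes k :: "'a \<Rightarrow> real"
  assumes "smooth_on k V" "smooth_on p UNIV"
  shows "smooth_on (\<lambda>z. integral {0..1} (\<lambda>\<tau>. p \<tau> * k (upd b z (\<tau> * (z \<bullet> b))))) V"
proof -
  obtain W where W: "open W" "{0..1} \<times> V \<subseteq> W"
    "smooth_on (\<lambda>x. p (fst x) * k (upd b (snd x) (fst x * (snd x \<bullet> b)))) W"
    by (rule scaled_smooth[OF assms]) blast
  from smooth_on_param_integral[OF W(1) open_V W(2,3)] show ?thesis by simp
qed

lemma scaled_has_real_derivative:
  assumes "smooth_on k V" "z \<in> V" "\<tau> \<in> {0..1}"
  shows "((\<lambda>\<tau>. k (upd b z (\<tau> * (z \<bullet> b)))) has_real_derivative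
     (z \<bullet> b) * pd b k (upd b z (\<tau> * (z \<bullet> b)))) (at \<tau>)"
proof -
  have "((\<lambda>t. k (upd b z t)) has_real_derivative pd b k (upd b z (\<tau> * (z \<bullet> b)))) (at (\<tau> * (z \<bullet> b)))"
    by (rule upd_has_real_derivative[OF basis smooth_on_has_derivative[OF open_V assms(1) star[OF assms(2,3)]]])
  then have "((\<lambda>\<tau>. k (upd b z (\<tau> * (z \<bullet> b)))) has_real_derivative
      pd b k (upd b z (\<tau> * (z \<bullet> b))) * (z \<bullet> b)) (at \<tau>)"
    by (rule DERIV_chain2[where f = "\<lambda>t. k (upd b z t)"]) (auto intro!: derivative_eq_intros)
  then show ?thesis by (simp add: mult.commute)
qed

lemma scaled_continuous:
  assumes "smooth_on k V" "z \<in> V"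
  shows "continuous_on {0..1} (\<lambda>\<tau>. k (upd b z (\<tau> * (z \<bullet> b))))"
  by (rule continuous_on_compose2[OF smooth_on_imp_continuous_on[OF assms(1)]])
     (use assms(2) in \<open>auto simp: upd_def intro!: continuous_intros star[unfolded upd_def]\<close>)

text \<open>The fundamental theorem of calculus on the segment from the hyperplane
  \<open>z \<bullet> b = 0\<close> to \<open>z\<close>. The quotient is an integral of the kind
  treated above, hence smooth.\<close>

lemma hadamard:
  assumes "smooth_on g V" "z \<in> V"
  shows "g z = g (upd b z 0) + (z \<bullet> b) * integral {0..1} (\<lambda>\<tau>. pd b g (upd b z (\<tau> * (z \<bullet> b))))"
proof -
  have "((\<lambda>\<tau>. (z \<bullet> b) * pd b g (upd b z (\<tau> * (z \<bullet> b)))) has_integral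
      g (upd b z (1 * (z \<bullet> b))) - g (upd b z (0 * (z \<bullet> b)))) {0..1}"
  proof (rule fundamental_theorem_of_calculus)
    show "((\<lambda>\<tau>. g (upd b z (\<tau> * (z \<bullet> b)))) has_vector_derivative
        (z \<bullet> b) * pd b g (upd b z (\<tau> * (z \<bullet> b)))) (at \<tau> within {0..1})" if "\<tau> \<in> {0..1}" for \<tau>
      using scaled_has_real_derivative[OF assms that]
      unfolding has_real_derivative_iff_has_vector_derivative by (rule has_vector_derivative_at_within)
  qed simp
  from integral_unique[OF this] show ?thesis by simp
qed

text \<open>The derivative under the integral sign is \<open>d/d\<tau> (\<tau> * k (upd b z (\<tau> * (z \<bullet> b))))\<close>.\<close>
lemma pd_primitive:
  assumes "smooth_on k V" "z \<in> V"
  shows "pd b (\<lambda>z. (z \<bullet> b) * integral {0..1} (\<lambda>\<tau>. k (upd b z (\<tau> * (z \<bullet> b))))) z = k z"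
proof -
  let ?m = "\<lambda>x. upd b (snd x) (fst x * (snd x \<bullet> b))"
  obtain W where W: "open W" "{0..1} \<times> V \<subseteq> W" "smooth_on (\<lambda>x. 1 * k (?m x)) W"
    "\<And>x. x \<in> W \<Longrightarrow> ?m x \<in> V"
    by (rule scaled_smooth[OF assms(1) smooth_on_const[OF open_UNIV, of 1]]) blast
  let ?F = "\<lambda>x. 1 * k (?m x)"
  let ?I = "\<lambda>z. integral {0..1} (\<lambda>\<tau>. k (upd b z (\<tau> * (z \<bullet> b))))"
  have F': "frechet_derivative ?F (at (\<tau>, z)) (0, b) = \<tau> * pd b k (upd b z (\<tau> * (z \<bullet> b)))" if "\<tau> \<in> {0..1}" for \<tau>
  proof -
    have "(\<tau>, z) \<in> W" using W(2) that assms(2) by auto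
    have "((\<lambda>x. k (?m x)) has_derivative
       (\<lambda>h. frechet_derivative k (at (?m (\<tau>, z))) (snd h + (fst h * (z \<bullet> b) + \<tau> * (snd h \<bullet> b) - snd h \<bullet> b) *\<^sub>R b))) (at (\<tau>, z))"
      by (rule has_derivative_compose[where f = ?m and g = k, OF _ smooth_on_has_derivative[OF open_V assms(1) W(4)[OF \<open>(\<tau>, z) \<in> W\<close>]]])
        (auto simp: upd_def intro!: derivative_eq_intros)
    from pd_eqI[OF this, of "(0, b)"] basis
    have "frechet_derivative ?F (at (\<tau>, z)) (0, b) = frechet_derivative k (at (?m (\<tau>, z))) (b + (\<tau> - 1) *\<^sub>R b)" by simp
    also have "b + (\<tau> - 1) *\<^sub>R b = \<tau> *\<^sub>R b" by (simp add: algebra_simps)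
    also have "frechet_derivative k (at (?m (\<tau>, z))) (\<tau> *\<^sub>R b) = \<tau> * pd b k (?m (\<tau>, z))"
      using has_derivative_linear[OF smooth_on_has_derivative[OF open_V assms(1) W(4)[OF \<open>(\<tau>, z) \<in> W\<close>]]]
      by (simp add: linear_cmul)
    finally show ?thesis by simp
  qed
  have "((\<lambda>t. ?I (z + t *\<^sub>R b)) has_real_derivative integral {0..1} (\<lambda>\<tau>. frechet_derivative ?F (at (\<tau>, z)) (0, b))) (at 0)"
    using param_integral_line_derivative[OF W(1) open_V W(2,3) assms(2), of b] by simp
  also have "integral {0..1} (\<lambda>\<tau>. frechet_derivative ?F (at (\<tau>, z)) (0, b)) = integral {0..1} (\<lambda>\<tau>. \<tau> * pd b k (upd b z (\<tau> * (z \<bullet> b))))"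
    by (rule integral_cong) (rule F')
  finally have dI: "((\<lambda>t. ?I (z + t *\<^sub>R b)) has_real_derivative integral {0..1} (\<lambda>\<tau>. \<tau> * pd b k (upd b z (\<tau> * (z \<bullet> b))))) (at 0)" .
  have "smooth_on ?I V"
    using smooth_on_scale_integral[OF assms(1) smooth_on_const[OF open_UNIV, of 1]] by simp
  then have "smooth_on (\<lambda>z. (z \<bullet> b) * ?I z) V"
    by (rule smooth_on_mult[OF open_V smooth_on_linear[OF open_V bounded_linear_inner_left]])
  \<comment> \<open>The same derivative along a line is computed twice, here from the total
    derivative and below from the product rule with \<open>dI\<close>; uniqueness identifies the
    results.\<close>
  from smooth_on_has_derivative[OF open_V this assms(2)]
  have "((\<lambda>t. ((z + t *\<^sub>R b) \<bullet> b) * ?I (z + t *\<^sub>R b)) has_real_derivative pd b (\<lambda>z. (z \<bullet> b) * ?I z) z) (at 0)"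
    using has_real_derivative_along_line[of "\<lambda>z. (z \<bullet> b) * ?I z" _ z 0 b] by simp
  moreover have "((\<lambda>t. ((z + t *\<^sub>R b) \<bullet> b) * ?I (z + t *\<^sub>R b)) has_real_derivative
      ?I z + (z \<bullet> b) * integral {0..1} (\<lambda>\<tau>. \<tau> * pd b k (upd b z (\<tau> * (z \<bullet> b))))) (at 0)"
  proof -
    have "((\<lambda>t. (z + t *\<^sub>R b) \<bullet> b) has_real_derivative 1) (at 0)"
      using basis by (auto intro!: derivative_eq_intros simp: inner_add_left)
    from DERIV_mult[OF this dI] show ?thesis by (rule DERIV_cong) simp
  qed
  ultimately have "pd b (\<lambda>z. (z \<bullet> b) * ?I z) z = ?I z + (z \<bullet> b) * integral {0..1} (\<lambda>\<tau>. \<tau> * pd b k (upd b z (\<tau> * (z \<bullet> b))))"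
    by (rule DERIV_unique)
  also have "\<dots> = k z"
  proof -
    have c1: "continuous_on {0..1} (\<lambda>\<tau>. k (upd b z (\<tau> * (z \<bullet> b))))" by (rule scaled_continuous[OF assms])
    have c2: "continuous_on {0..1} (\<lambda>\<tau>. \<tau> * pd b k (upd b z (\<tau> * (z \<bullet> b))))"
      by (intro continuous_intros scaled_continuous smooth_on_frechet_derivative assms)
    have "((\<lambda>\<tau>. k (upd b z (\<tau> * (z \<bullet> b))) + (z \<bullet> b) * (\<tau> * pd b k (upd b z (\<tau> * (z \<bullet> b))))) has_integral
       1 * k (upd b z (1 * (z \<bullet> b))) - 0 * k (upd b z (0 * (z \<bullet> b)))) {0..1}"
    proof (rule fundamental_theorem_of_calculus)
      fix \<tau> :: real assume t: "\<tau> \<in> {0..1}"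
      have "((\<lambda>\<tau>. \<tau> * k (upd b z (\<tau> * (z \<bullet> b)))) has_real_derivative
         1 * k (upd b z (\<tau> * (z \<bullet> b))) + ((z \<bullet> b) * pd b k (upd b z (\<tau> * (z \<bullet> b)))) * \<tau>) (at \<tau>)"
        by (rule DERIV_mult[OF DERIV_ident scaled_has_real_derivative[OF assms t]])
      then show "((\<lambda>\<tau>. \<tau> * k (upd b z (\<tau> * (z \<bullet> b)))) has_vector_derivative
         k (upd b z (\<tau> * (z \<bullet> b))) + (z \<bullet> b) * (\<tau> * pd b k (upd b z (\<tau> * (z \<bullet> b))))) (at \<tau> within {0..1})"
        by (simp add: has_real_derivative_iff_has_vector_derivative[symmetric] has_field_derivative_at_within algebra_simps)
    qed simp
    from integral_unique[OF this]
    have "integral {0..1} (\<lambda>\<tau>. k (upd b z (\<tau> * (z \<bullet> b))) + (z \<bullet> b) * (\<tau> * pd b k (upd b z (\<tau> * (z \<bullet> b))))) = k z"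
      by simp
    then show ?thesis
      by (subst (asm) integral_add)
        (auto intro!: integrable_continuous_interval continuous_on_mult_left c1 c2)
  qed
  finally show ?thesis .
qed

end

lemma coord_starlike_ball: "b \<in> Basis \<Longrightarrow> coord_starlike b (ball 0 r)"
  by unfold_locales (simp_all only: open_ball upd_scaled_in_ball)

lemma coord_starlike_UNIV: "b \<in> Basis \<Longrightarrow> coord_starlike b UNIV"
  by unfold_locales auto

lemma smooth_germ_scale_integral:
  fixes k :: "'a::euclidean_space \<Rightarrow> real"
  assumes "b \<in> Basis" "smooth_germ k" "smooth_on p UNIV"
  shows "smooth_germ (\<lambda>z. integral {0..1} (\<lambda>\<tau>. p \<tau> * k (upd b z (\<tau> * (z \<bullet> b)))))"
proof -
  obtain r where "r > 0" "smooth_on k (ball 0 r)" using assms smooth_germE by metis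
  then show ?thesis
    using coord_starlike.smooth_on_scale_integral[OF coord_starlike_ball[OF assms(1)] _ assms(3)]
    by (blast intro: smooth_germI)
qed

section \<open>Determinants and the inverse function theorem for smooth germs\<close>

lemma Ck_on_mult: "open U \<Longrightarrow> Ck_on k f U \<Longrightarrow> Ck_on k g U \<Longrightarrow> Ck_on k (\<lambda>x. f x * g x :: real) U"
  by (rule Ck_on_bilinear[OF _ bounded_bilinear_mult])

lemma Ck_on_prod:
  assumes "open U" "\<And>i. i \<in> I \<Longrightarrow> Ck_on k (f i) U"
  shows "Ck_on k (\<lambda>x. \<Prod>i\<in>I. f i x :: real) U"
  using assms(2)
  by (induction I rule: infinite_finite_induct) (auto intro: Ck_on_const Ck_on_mult assms(1))

lemma Ck_on_det:
  fixes A :: "'a::euclidean_space \<Rightarrow> real^'n^'n"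
  assumes "open U" "\<And>i j. Ck_on k (\<lambda>x. A x $ i $ j) U"
  shows "Ck_on k (\<lambda>x. det (A x)) U"
  unfolding det_def by (intro Ck_on_sum Ck_on_mult Ck_on_prod Ck_on_const assms)

lemma smooth_germ_det:
  fixes A :: "'a::euclidean_space \<Rightarrow> real^'n^'n"
  assumes "\<And>i j. smooth_germ (\<lambda>x. A x $ i $ j)"
  shows "smooth_germ (\<lambda>x. det (A x))"
  unfolding det_def by (intro smooth_germ_sum smooth_germ_mult smooth_germ_prod smooth_germ_const assms)

lemma smooth_germ_vec_nth: "smooth_germ f \<Longrightarrow> smooth_germ (\<lambda>x. f x $ i)"
  for f :: "'a::euclidean_space \<Rightarrow> real^'n"
  using smooth_germ_inner_right[of f "axis i 1"] by (simp add: inner_axis)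

lemma smooth_germ_jac:
  fixes f :: "real^'n \<Rightarrow> real^'n"
  assumes "smooth_germ f"
  shows "smooth_germ (jac f)"
  unfolding jac_def[abs_def] matrix_def
  by (intro smooth_germ_det) (simp add: smooth_germ_vec_nth smooth_germ_frechet_derivative assms)

text \<open>The inverse function theorem for \<open>C^1\<close> maps gives a differentiable inverse
  \<open>\<Psi>\<close>. By Cramer's rule its derivative is a rational expression in the entries of
  the derivative of \<open>\<Phi>\<close> at \<open>\<Psi> y\<close>, so if \<open>\<Psi>\<close> is
  of class \<open>C^k\<close>, so is its derivative, and the class rises by one.\<close>

lemma smooth_inverse_germ:
  fixes \<Phi> :: "real^'n \<Rightarrow> real^'n"
  assumes "smooth_germ \<Phi>" "\<Phi> 0 = 0" "jac \<Phi> 0 \<noteq> 0"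
  obtains \<Psi> where "smooth_germ \<Psi>" "\<Psi> 0 = 0"
    "\<forall>\<^sub>F x in nhds 0. \<Psi> (\<Phi> x) = x" "\<forall>\<^sub>F y in nhds 0. \<Phi> (\<Psi> y) = y"
proof -
  obtain r where r: "r > 0" "smooth_on \<Phi> (ball 0 r)" using assms smooth_germE by metis
  let ?U = "ball (0::real^'n) r"
  define D where "D x = frechet_derivative \<Phi> (at x)" for x
  have D: "(\<Phi> has_derivative D x) (at x)" if "x \<in> ?U" for x
    unfolding D_def by (rule smooth_on_has_derivative[OF open_ball r(2) that])
  have DA: "D x v = matrix (D x) *v v" if "x \<in> ?U" for x v
    using matrix_vector_mul(2)[OF has_derivative_linear[OF D[OF that]]] by metis
  have bl: "blinfun_apply (Blinfun (D x)) = D x" if "x \<in> ?U" for x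
    using D[OF that] has_derivative_bounded_linear bounded_linear_Blinfun_apply by blast
  have "continuous_on ?U (\<lambda>x. Blinfun (D x))"
  proof (rule continuous_on_blinfun_componentwise)
    fix i :: "real^'n" assume "i \<in> Basis"
    have "continuous_on ?U (\<lambda>x. D x i)" unfolding D_def
      by (rule smooth_on_imp_continuous_on[OF smooth_on_frechet_derivative[OF r(2)]])
    then show "continuous_on ?U (\<lambda>x. blinfun_apply (Blinfun (D x)) i)"
      by (rule continuous_on_eq) (simp add: bl)
  qed
  moreover obtain B where "B ** matrix (D 0) = mat 1"
    using assms(3) by (metis jac_def D_def invertible_det_nz invertible_def)
  then have B: "Blinfun ((*v) B) o\<^sub>L Blinfun (D 0) = id_blinfun"
    using r(1) by (intro blinfun_eqI) (simp add: bl bounded_linear_Blinfun_apply matrix_vector_mul_bounded_linear DA matrix_vector_mul_assoc)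
  ultimately obtain U' V \<Psi> \<Psi>' where U': "open U'" "U' \<subseteq> ?U" "0 \<in> U'" and V: "open V" "\<Phi> 0 \<in> V"
    and hom: "homeomorphism U' V \<Phi> \<Psi>"
    and d\<Psi>: "\<And>y. y \<in> V \<Longrightarrow> (\<Psi> has_derivative (\<Psi>' y)) (at y)"
    and \<Psi>': "\<And>y. y \<in> V \<Longrightarrow> \<Psi>' y = inv (blinfun_apply (Blinfun (D (\<Psi> y))))"
    and bij: "\<And>y. y \<in> V \<Longrightarrow> bij (blinfun_apply (Blinfun (D (\<Psi> y))))"
    using inverse_function_theorem[OF open_ball, of 0 r \<Phi> "\<lambda>x. Blinfun (D x)" 0, OF _ _ _ B] r(1) D bl
    by (metis (no_types, lifting) centre_in_ball)
  have inU: "\<Psi> y \<in> ?U" if "y \<in> V" for y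
    using hom U'(2) that unfolding homeomorphism_def by blast
  let ?A = "\<lambda>y. matrix (D (\<Psi> y))"
  have det: "det (?A y) \<noteq> 0" if "y \<in> V" for y
  proof -
    have "D (\<Psi> y) = (*v) (?A y)" using DA[OF inU[OF that]] by blast
    with bij[OF that] bl[OF inU[OF that]] have "inj ((*v) (?A y))" by (simp add: bij_def)
    then show ?thesis
      by (simp add: invertible_det_nz[symmetric] invertible_left_inverse matrix_left_invertible_injective)
  qed
  \<comment> \<open>Solving \<open>?A y *v \<Psi>' y v = v\<close> by determinants turns the inverse
    linear map into a formula whose smoothness can be read off.\<close>
  have cr: "\<Psi>' y v = (\<chi> k. det (\<chi> i j. if j = k then v $ i else ?A y $ i $ j) / det (?A y))" if "y \<in> V" for y v
  proof -
    have "?A y *v \<Psi>' y v = v"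
      using DA[OF inU[OF that]] \<Psi>'[OF that] bij[OF that] bl[OF inU[OF that]]
      by (metis bij_inv_eq_iff)
    then show ?thesis using cramer[OF det[OF that]] by blast
  qed
  have "Ck_on k \<Psi> V" for k
  proof (induction k)
    case 0
    then show ?case using hom by (simp add: homeomorphism_def)
  next
    case (Suc k)
    have e: "Ck_on k (\<lambda>y. ?A y $ i $ j) V" for i j
    proof -
      have "Ck_on k (\<lambda>x. D x (axis j 1)) ?U"
        using smooth_on_frechet_derivative[OF r(2)] unfolding D_def smooth_on_def by blast
      then have "Ck_on k (\<lambda>y. D (\<Psi> y) (axis j 1)) V"
        by (rule Ck_on_compose[OF V(1) open_ball Suc]) (use inU in auto)
      then have "Ck_on k (\<lambda>y. D (\<Psi> y) (axis j 1) $ i) V"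
        by (rule Ck_on_bounded_linear[OF V(1) bounded_linear_vec_nth])
      then show ?thesis by (simp add: matrix_def)
    qed
    have "Ck_on k (\<lambda>y. inverse (det (?A y))) V"
      by (rule Ck_on_compose[OF V(1) _ Ck_on_det[OF V(1) e], of "- {0}" inverse])
        (use smooth_on_inverse det in \<open>auto simp: smooth_on_def\<close>)
    moreover have "Ck_on k (\<lambda>y. if j = m then v $ i else ?A y $ i $ j) V" for i j m v
      by (cases "j = m") (auto intro: Ck_on_const V(1) e)
    ultimately have c: "Ck_on k (\<lambda>y. det (\<chi> i j. if j = m then v $ i else ?A y $ i $ j) / det (?A y)) V" for m v
      unfolding divide_inverse
      by (intro Ck_on_mult Ck_on_det V(1)) auto
    have c': "Ck_on k (\<lambda>y. \<chi> m. det (\<chi> i j. if j = m then v $ i else ?A y $ i $ j) / det (?A y)) V" for v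
      by (rule Ck_on_componentwise[OF V(1)]) (use c in \<open>auto simp: Basis_vec_def inner_axis\<close>)
    show ?case
      by (rule Ck_on_SucI[OF V(1) d\<Psi>], assumption, rule Ck_on_cong[OF V(1) cr[symmetric] c'])
  qed
  then have "smooth_germ \<Psi>" using V assms(2) unfolding smooth_germ_def smooth_on_def by metis
  moreover have "\<Psi> 0 = 0" using hom U'(3) assms(2) unfolding homeomorphism_def by force
  moreover have "\<forall>\<^sub>F x in nhds 0. \<Psi> (\<Phi> x) = x"
    using hom U' unfolding homeomorphism_def eventually_nhds by blast
  moreover have "\<forall>\<^sub>F y in nhds 0. \<Phi> (\<Psi> y) = y"
    using hom V assms(2) unfolding homeomorphism_def eventually_nhds by metis
  ultimately show thesis using that by blast
qed

subsection \<open>Weights for reflecting across a hyperplane\<close>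

text \<open>For such weights \<open>\<Sum>j. a j * h (- (4 ^ j) * s)\<close> has the same derivatives at \<open>s = 0\<close> as \<open>h s\<close>,
  so it continues a function \<open>h\<close> known on one side of 0 smoothly to the other side (Seeley's extension).\<close>
definition reflection_weights :: "(nat \<Rightarrow> real) \<Rightarrow> bool" where
  "reflection_weights a \<longleftrightarrow> (\<forall>n. summable (\<lambda>j. \<bar>a j\<bar> * (4 ^ n) ^ j) \<and> (\<Sum>j. a j * (4 ^ n) ^ j) = (-1) ^ n)"

text \<open>The coefficients of Euler's product \<open>F z = (\<Prod>k. 1 - z / 4 ^ k)\<close>, which vanishes at every power of 4.\<close>
fun euler_coeff :: "nat \<Rightarrow> real" where
  "euler_coeff 0 = 1"
| "euler_coeff (Suc k) = - ((1/4) ^ k * euler_coeff k / (1 - (1/4) ^ Suc k))"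

lemma abs_euler_coeff_Suc_le: "\<bar>euler_coeff (Suc k)\<bar> \<le> 4/3 * (1/4) ^ k * \<bar>euler_coeff k\<bar>"
proof -
  define D where "D = 1 - (1/4::real) ^ Suc k"
  have "(1/4::real) ^ k \<le> 1" by (rule power_le_one) auto
  then have D: "3/4 \<le> D" by (simp add: D_def)
  have "\<bar>euler_coeff (Suc k)\<bar> = (1/4) ^ k * \<bar>euler_coeff k\<bar> / D"
    unfolding euler_coeff.simps D_def[symmetric] using D by (simp add: abs_mult)
  also have "\<dots> \<le> (1/4) ^ k * \<bar>euler_coeff k\<bar> / (3/4)"
    using D by (intro divide_left_mono) auto
  finally show ?thesis by (simp add: mult_ac del: euler_coeff.simps)
qed

text \<open>The ratio of consecutive terms is at most
  \<open>4/3 * \<bar>R\<bar> * (1/4) ^ k\<close>, which eventually stays below \<open>1/2\<close>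
  for every \<open>R\<close>.\<close>

lemma summable_euler_coeff: "summable (\<lambda>k. \<bar>euler_coeff k\<bar> * R ^ k)"
proof -
  have "(\<lambda>k. (4/3 * \<bar>R\<bar>) * (1/4) ^ k) \<longlonglongrightarrow> 4/3 * \<bar>R\<bar> * 0"
    by (intro tendsto_mult tendsto_const LIMSEQ_power_zero) auto
  then have "\<forall>\<^sub>F k in sequentially. (4/3 * \<bar>R\<bar>) * (1/4) ^ k < 1/2"
    by (rule order_tendstoD) auto
  then obtain N where N: "\<And>k. k \<ge> N \<Longrightarrow> (4/3 * \<bar>R\<bar>) * (1/4) ^ k \<le> 1/2"
    unfolding eventually_sequentially by (meson less_imp_le)
  show ?thesis
  proof (rule summable_ratio_test[of "1/2" N])
    fix k assume "k \<ge> N"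
    have "norm (\<bar>euler_coeff (Suc k)\<bar> * R ^ Suc k) = \<bar>euler_coeff (Suc k)\<bar> * \<bar>R\<bar> ^ Suc k"
      by (simp add: abs_mult power_abs)
    also have "\<dots> \<le> (4/3 * (1/4) ^ k * \<bar>euler_coeff k\<bar>) * \<bar>R\<bar> ^ Suc k"
      by (intro mult_right_mono abs_euler_coeff_Suc_le) auto
    also have "\<dots> = ((4/3 * \<bar>R\<bar>) * (1/4) ^ k) * (\<bar>euler_coeff k\<bar> * \<bar>R\<bar> ^ k)" by simp
    also have "\<dots> \<le> 1/2 * (\<bar>euler_coeff k\<bar> * \<bar>R\<bar> ^ k)"
      by (intro mult_right_mono N \<open>k \<ge> N\<close>) auto
    finally show "norm (\<bar>euler_coeff (Suc k)\<bar> * R ^ Suc k) \<le> 1/2 * norm (\<bar>euler_coeff k\<bar> * R ^ k)"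
      by (simp add: abs_mult power_abs)
  qed simp
qed

lemma summable_euler_coeff': "summable (\<lambda>k. euler_coeff k * R ^ k)"
proof (rule summable_norm_cancel)
  show "summable (\<lambda>k. norm (euler_coeff k * R ^ k))"
    using summable_euler_coeff[of "\<bar>R\<bar>"] by (simp add: abs_mult power_abs)
qed

text \<open>Comparing coefficients of \<open>z ^ Suc k\<close> in
  \<open>F z = (1 - z) * F (z/4)\<close> gives exactly the recursion that defines
  \<open>euler_coeff\<close>.\<close>

lemma euler_functional_equation:
  "(\<Sum>k. euler_coeff k * z ^ k) = (1 - z) * (\<Sum>k. euler_coeff k * (z/4) ^ k)"
proof -
  let ?d = "\<lambda>k. euler_coeff k * z ^ k - euler_coeff k * (z/4) ^ k"
  have s: "summable ?d" by (intro summable_diff summable_euler_coeff')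
  have "(\<Sum>k. euler_coeff k * z ^ k) - (\<Sum>k. euler_coeff k * (z/4) ^ k) = (\<Sum>k. ?d k)"
    by (rule suminf_diff[OF summable_euler_coeff' summable_euler_coeff'])
  also have "\<dots> = (\<Sum>k. ?d (Suc k))" using suminf_split_head[OF s] by simp
  also have "(\<lambda>k. ?d (Suc k)) = (\<lambda>k. - z * (euler_coeff k * (z/4) ^ k))"
  proof
    fix k
    have "(1/4::real) ^ Suc k < 1" by (rule power_Suc_less_one) auto
    then have nz: "1 - (1/4::real) ^ Suc k \<noteq> 0" by simp
    have e: "euler_coeff (Suc k) * (1 - (1/4) ^ Suc k) = - ((1/4) ^ k * euler_coeff k)"
      unfolding euler_coeff.simps using nz by (simp del: power_Suc)
    have "?d (Suc k) = (euler_coeff (Suc k) * (1 - (1/4) ^ Suc k)) * z ^ Suc k"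
      by (simp only: power_divide power_one) (simp add: algebra_simps del: euler_coeff.simps power_Suc)
    then show "?d (Suc k) = - z * (euler_coeff k * (z/4) ^ k)"
      unfolding e by (simp add: power_divide)
  qed
  also have "(\<Sum>k. - z * (euler_coeff k * (z/4) ^ k)) = - z * (\<Sum>k. euler_coeff k * (z/4) ^ k)"
    by (rule suminf_mult[OF summable_euler_coeff'])
  finally show ?thesis by (simp add: algebra_simps)
qed

text \<open>The factor \<open>1 - z\<close> of the functional equation gives the zero at 1, and
  every later power of 4 inherits it from the preceding one.\<close>

lemma euler_sum_power_4: "(\<Sum>k. euler_coeff k * (4 ^ n) ^ k) = 0"
proof (induction n)
  case 0
  then show ?case using euler_functional_equation[of 1] by simp
next
  case (Suc n)
  then show ?case using euler_functional_equation[of "4 ^ Suc n"] by simp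
qed

text \<open>Dividing \<open>euler_coeff j\<close> by \<open>1 + 4 ^ j\<close> makes the sum of two
  consecutive moments \<open>M n + M (Suc n)\<close> equal to the value of Euler's product at
  \<open>4 ^ n\<close>, which is 0. The moments therefore alternate in sign, and division by
  \<open>M 0\<close> normalises them.\<close>

lemma reflection_weights_exist: "\<exists>a. reflection_weights a"
proof -
  define c where "c j = euler_coeff j / (1 + 4 ^ j)" for j
  have le: "\<bar>c j\<bar> \<le> \<bar>euler_coeff j\<bar>" for j
  proof -
    have "\<bar>euler_coeff j\<bar> / (1 + 4 ^ j) \<le> \<bar>euler_coeff j\<bar> / 1"
      by (intro divide_left_mono) (auto simp: add_pos_pos)
    then show ?thesis by (simp add: c_def abs_divide)
  qed
  have s: "summable (\<lambda>j. \<bar>c j\<bar> * (4 ^ n) ^ j)" for n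
    by (rule summable_comparison_test'[OF summable_euler_coeff[of "4 ^ n"], of 0])
      (auto intro: mult_right_mono le simp: abs_mult)
  have s': "summable (\<lambda>j. c j * (4 ^ n) ^ j)" for n
    by (rule summable_norm_cancel) (use s[of n] in \<open>simp add: abs_mult\<close>)
  define M where "M n = (\<Sum>j. c j * (4 ^ n) ^ j)" for n
  have MS: "M (Suc n) = - M n" for n
  proof -
    have "M n + M (Suc n) = (\<Sum>j. c j * (4 ^ n) ^ j + c j * (4 ^ Suc n) ^ j)"
      unfolding M_def by (rule suminf_add[OF s' s'])
    also have "(\<lambda>j. c j * (4 ^ n) ^ j + c j * (4 ^ Suc n) ^ j) = (\<lambda>j. euler_coeff j * (4 ^ n) ^ j)"
    proof
      fix j
      have "(1::real) + 4 ^ j > 0" by (simp add: add_pos_pos)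
      then have c1: "c j * (1 + 4 ^ j) = euler_coeff j" by (simp add: c_def)
      have "c j * (4 ^ n) ^ j + c j * (4 ^ Suc n) ^ j = c j * (1 + 4 ^ j) * (4 ^ n) ^ j"
        by (simp add: power_mult_distrib algebra_simps)
      then show "c j * (4 ^ n) ^ j + c j * (4 ^ Suc n) ^ j = euler_coeff j * (4 ^ n) ^ j"
        unfolding c1 .
    qed
    also have "(\<Sum>j. euler_coeff j * (4 ^ n) ^ j) = 0" by (rule euler_sum_power_4)
    finally show ?thesis by simp
  qed
  \<comment> \<open>The first two terms are \<open>1/2\<close> and \<open>-4/15\<close>, with sum
    \<open>7/30\<close>. From index 2 on the numerators are bounded by \<open>(1/2) ^ j\<close> and
    the denominators by \<open>1 + 4^2 = 17\<close> from below, so the tail is at most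
    \<open>2/17\<close>, which is smaller.\<close>
  have M0: "M 0 \<noteq> 0"
  proof -
    have b: "\<bar>euler_coeff (Suc (Suc k))\<bar> \<le> (1/2) ^ k" for k
    proof (induction k)
      case (Suc k)
      have "4/3 * (1/4::real) ^ Suc (Suc k) \<le> 1/2"
      proof -
        have "(1/4::real) ^ k \<le> 1" by (rule power_le_one) auto
        then show ?thesis by simp
      qed
      then have "\<bar>euler_coeff (Suc (Suc (Suc k)))\<bar> \<le> 1/2 * \<bar>euler_coeff (Suc (Suc k))\<bar>"
        using abs_euler_coeff_Suc_le[of "Suc (Suc k)"] mult_right_mono abs_ge_zero order_trans by metis
      with Suc show ?case by (simp del: euler_coeff.simps)
    qed (simp add: power2_eq_square)
    have "\<bar>c (j + 2)\<bar> \<le> 1/17 * (1/2) ^ j" for j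
    proof -
      have "(4::real) ^ 2 \<le> 4 ^ (j + 2)" by (rule power_increasing) auto
      then have "17 \<le> 1 + (4::real) ^ (j + 2)" by simp
      then have "\<bar>euler_coeff (j + 2)\<bar> / (1 + 4 ^ (j + 2)) \<le> (1/2) ^ j / 17"
        using b[of j] by (intro frac_le) (auto simp del: euler_coeff.simps)
      then show ?thesis by (simp add: c_def abs_divide add_pos_pos del: euler_coeff.simps)
    qed
    then have "norm (\<Sum>j. c (j + 2)) \<le> (\<Sum>j. 1/17 * (1/2) ^ j)"
      by (intro norm_suminf_le summable_mult summable_geometric) auto
    also have "(\<Sum>j. 1/17 * (1/2::real) ^ j) = 1/17 * (\<Sum>j. (1/2) ^ j)"
      by (intro suminf_mult summable_geometric) auto
    also have "\<dots> = 2/17" using suminf_geometric[of "1/2::real"] by simp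
    finally have "\<bar>\<Sum>j. c (j + 2)\<bar> \<le> 2/17" by simp
    moreover have "M 0 = (\<Sum>j. c (j + 2)) + (\<Sum>j<2. c j)"
      using suminf_split_initial_segment[of c 2] s'[of 0] by (simp add: M_def)
    moreover have "(\<Sum>j<2. c j) = 7/30" by (simp add: c_def numeral_2_eq_2)
    ultimately show ?thesis by auto
  qed
  have Mn: "M n = (-1) ^ n * M 0" for n by (induction n) (auto simp: MS)
  have "reflection_weights (\<lambda>j. c j / M 0)"
    unfolding reflection_weights_def
  proof (intro allI conjI)
    fix n
    show "summable (\<lambda>j. \<bar>c j / M 0\<bar> * (4 ^ n) ^ j)"
      using summable_divide[OF s[of n], of "\<bar>M 0\<bar>"] by (simp add: abs_divide)
    show "(\<Sum>j. c j / M 0 * (4 ^ n) ^ j) = (- 1) ^ n"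
      using suminf_divide[OF s'[of n], of "M 0"] M0 Mn[of n] by (simp add: M_def[symmetric])
  qed
  then show ?thesis by blast
qed

text \<open>Differentiating \<open>h (- (4 ^ j) * s)\<close> brings out the factor
  \<open>- (4 ^ j)\<close>; these are the weights of the derivative of a reflected series. The
  moments move up by one index and change sign, so the condition is preserved.\<close>

lemma reflection_weights_shift:
  assumes "reflection_weights a"
  shows "reflection_weights (\<lambda>j. - (4 ^ j) * a j)"
  unfolding reflection_weights_def
proof (intro allI conjI)
  fix n
  have s: "summable (\<lambda>j. \<bar>a j\<bar> * (4 ^ Suc n) ^ j)" and sum: "(\<Sum>j. a j * (4 ^ Suc n) ^ j) = (-1) ^ Suc n"
    using assms unfolding reflection_weights_def by blast+
  show "summable (\<lambda>j. \<bar>- (4 ^ j) * a j\<bar> * (4 ^ n) ^ j)"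
    using s by (simp add: abs_mult power_mult_distrib mult_ac)
  have "summable (\<lambda>j. a j * (4 ^ Suc n) ^ j)"
    by (rule summable_norm_cancel) (use s in \<open>simp add: abs_mult\<close>)
  from suminf_minus[OF this] sum show "(\<Sum>j. - (4 ^ j) * a j * (4 ^ n) ^ j) = (- 1) ^ n"
    by (simp add: power_mult_distrib mult_ac)
qed

lemma reflection_weights_summable: "reflection_weights a \<Longrightarrow> summable (\<lambda>j. \<bar>a j\<bar>)"
  unfolding reflection_weights_def by (drule spec[of _ 0]) simp

lemma reflection_weights_sum: "reflection_weights a \<Longrightarrow> (\<Sum>j. a j) = 1"
  unfolding reflection_weights_def by (drule spec[of _ 0]) simp

subsection \<open>Smooth even functions\<close>

lemma DERIV_suminf_bounded:
  fixes f :: "nat \<Rightarrow> real \<Rightarrow> real"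
  assumes "open S" "convex S" "x \<in> S"
    and "\<And>n x. x \<in> S \<Longrightarrow> (f n has_real_derivative f' n x) (at x)"
    and "\<And>n x. x \<in> S \<Longrightarrow> \<bar>f' n x\<bar> \<le> M n" "summable M" "summable (\<lambda>n. f n x)"
  shows "((\<lambda>x. \<Sum>n. f n x) has_real_derivative (\<Sum>n. f' n x)) (at x)"
proof (rule has_field_derivative_series'(2)[of S f f' x x])
  show "uniformly_convergent_on S (\<lambda>n x. \<Sum>i<n. f' i x)"
    by (rule Weierstrass_m_test'[of S f' M]) (use assms in auto)
  show "(f n has_real_derivative f' n x) (at x within S)" if "x \<in> S" for n x
    using assms(4)[OF that] has_field_derivative_at_within by blast
qed (use assms interior_open[OF assms(1)] in auto)

text \<open>By l'Hopital's rule a continuous function whose derivative off 0 has a limit at 0 is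
  differentiable there. This handles the hyperplane on which the two branches of the extension
  meet.\<close>

lemma DERIV_at_0_from_limit:
  fixes p q :: "real \<Rightarrow> real"
  assumes "isCont p 0" "isCont q 0" "\<And>s. s \<noteq> 0 \<Longrightarrow> (p has_real_derivative q s) (at s)"
  shows "(p has_real_derivative q 0) (at 0)"
proof -
  have "((\<lambda>h. (p h - p 0) / h) \<longlongrightarrow> q 0) (at 0)"
  proof (rule lhopital[where f' = q and g' = "\<lambda>_. 1"])
    show "((\<lambda>h. p h - p 0) \<longlongrightarrow> 0) (at 0)"
      using assms(1) by (simp add: isCont_def LIM_zero)
    show "\<forall>\<^sub>F x in at 0. ((\<lambda>h. p h - p 0) has_real_derivative q x) (at x)"
      using assms(3) by (auto simp: eventually_at_filter intro!: derivative_eq_intros always_eventually)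
    show "((\<lambda>x. q x / 1) \<longlongrightarrow> q 0) (at 0)" using assms(2) by (simp add: isCont_def)
  qed (auto simp: eventually_at_filter)
  then show ?thesis by (simp add: DERIV_def)
qed

text \<open>Vanishing outside a ball bounds \<open>\<gamma>\<close>, so that series with absolutely
  summable weights converge uniformly. All hypotheses pass, with the same \<open>R\<close>, to
  \<open>radial\<close> and to the partial derivatives in directions other than
  \<open>b\<close>.\<close>

locale even_function = 
  fixes b :: "'a::euclidean_space" and R :: real and \<gamma> :: "'a \<Rightarrow> real"
  assumes basis: "b \<in> Basis" and smooth: "smooth_on \<gamma> UNIV"
    and even: "\<And>z. \<gamma> (upd b z (- (z \<bullet> b))) = \<gamma> z"
    and supp: "\<And>z. norm z > R \<Longrightarrow> \<gamma> z = 0"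
begin

sublocale coord_starlike b UNIV
  by (rule coord_starlike_UNIV[OF basis])

lemma has_deriv: "(\<gamma> has_derivative frechet_derivative \<gamma> (at z)) (at z)"
  by (rule smooth_on_has_derivative[OF open_UNIV smooth UNIV_I])

lemma cont: "continuous_on S \<gamma>"
  using smooth_on_imp_continuous_on[OF smooth] continuous_on_subset by blast

lemma bounded: obtains C where "\<And>z. \<bar>\<gamma> z\<bar> \<le> C"
proof -
  have "bounded (\<gamma> ` cball 0 R)"
    by (intro compact_imp_bounded compact_continuous_image cont) auto
  then obtain C where C: "\<forall>y\<in>\<gamma> ` cball 0 R. norm y \<le> C" unfolding bounded_iff by blast
  have "\<bar>\<gamma> z\<bar> \<le> max C 0" for z using C supp[of z] by (cases "norm z \<le> R") (auto intro: max.coboundedI1)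
  then show thesis by (rule that)
qed

lemma derivative_reflect:
  "frechet_derivative \<gamma> (at (upd b z (- (z \<bullet> b)))) (v - (2 * (v \<bullet> b)) *\<^sub>R b) = frechet_derivative \<gamma> (at z) v"
proof -
  have "((\<lambda>z. \<gamma> (upd b z (- (z \<bullet> b)))) has_derivative
      (\<lambda>v. frechet_derivative \<gamma> (at (upd b z (- (z \<bullet> b)))) (v + (- (v \<bullet> b) - v \<bullet> b) *\<^sub>R b))) (at z)"
    by (rule has_derivative_compose[where f = "\<lambda>z. upd b z (- (z \<bullet> b))" and g = \<gamma>, OF _ has_deriv])
      (auto simp: upd_def intro!: derivative_eq_intros)
  then have "(\<gamma> has_derivative
      (\<lambda>v. frechet_derivative \<gamma> (at (upd b z (- (z \<bullet> b)))) (v + (- (v \<bullet> b) - v \<bullet> b) *\<^sub>R b))) (at z)"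
    by (simp add: even)
  from frechet_derivative_at[OF this] show ?thesis
    by (metis (no_types, lifting) diff_conv_add_uminus scaleR_minus_left minus_add_distrib mult_2 add_uminus_conv_diff)
qed

lemma derivative_zero:
  assumes "norm z > R" shows "frechet_derivative \<gamma> (at z) = (\<lambda>v. 0)"
proof -
  have "(\<gamma> has_derivative (\<lambda>v. 0)) (at z)"
  proof (rule has_derivative_transform_within_open[where f = "\<lambda>z. 0" and s = "- cball 0 R"])
    show "((\<lambda>z. 0::real) has_derivative (\<lambda>v. 0)) (at z)" by simp
  qed (use assms supp in \<open>auto simp: dist_norm\<close>)
  then show ?thesis using frechet_derivative_at by metis
qed

lemma even_function_pd:
  assumes "i \<in> Basis" "i \<noteq> b"
  shows "even_function b R (pd i \<gamma>)"
proof
  show "pd i \<gamma> (upd b z (- (z \<bullet> b))) = pd i \<gamma> z" for z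
    using derivative_reflect[of z i] assms basis by (simp add: inner_Basis)
qed (use basis smooth in \<open>auto intro: smooth_on_frechet_derivative simp: derivative_zero\<close>)

lemma pd_odd: "pd b \<gamma> (upd b z (- (z \<bullet> b))) = - pd b \<gamma> z"
  using derivative_reflect[of z b] basis has_derivative_linear[OF has_deriv, of "upd b z (- (z \<bullet> b))"]
  by (simp add: linear_neg scaleR_2)

text \<open>The quotient of \<open>pd b \<gamma>\<close> by \<open>2 * (z \<bullet> b)\<close>, that
  is, the derivative of \<open>\<gamma>\<close> with respect to the square of the coordinate. The
  Hadamard form makes it smooth on the hyperplane, where \<open>pd b \<gamma>\<close> vanishes
  because it is odd.\<close>

definition radial :: "'a \<Rightarrow> real" where
  "radial z = integral {0..1} (\<lambda>\<tau>. 1/2 * pd b (pd b \<gamma>) (upd b z (\<tau> * (z \<bullet> b))))"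

lemma pd_eq_radial: "pd b \<gamma> z = 2 * (z \<bullet> b) * radial z"
proof -
  have "pd b \<gamma> (upd b z 0) = 0" using pd_odd[of "upd b z 0"] basis by simp
  with hadamard[OF smooth_on_frechet_derivative[OF smooth, of b] UNIV_I, of z]
  show ?thesis by (simp add: radial_def)
qed

text \<open>Off the hyperplane \<open>z \<bullet> b = 0\<close> the claims follow on dividing the
  odd function \<open>pd b \<gamma>\<close> by its odd factor. On it the reflection is the identity
  and \<open>radial\<close> is half the second derivative along \<open>b\<close>, which vanishes
  where \<open>norm z > R\<close>.\<close>

lemma even_function_radial: "even_function b R radial"
proof
  show "smooth_on radial UNIV"
    unfolding radial_def[abs_def]
    by (intro smooth_on_scale_integral smooth_on_frechet_derivative smooth smooth_on_const open_UNIV)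
  show "radial (upd b z (- (z \<bullet> b))) = radial z" for z
  proof (cases "z \<bullet> b = 0")
    case True
    then show ?thesis using upd_same[of b z] by simp
  next
    case False
    have "2 * - (z \<bullet> b) * radial (upd b z (- (z \<bullet> b))) = - (2 * (z \<bullet> b) * radial z)"
      using pd_odd[of z] basis unfolding pd_eq_radial by simp
    with False show ?thesis by simp
  qed
  show "radial z = 0" if "norm z > R" for z
  proof (cases "z \<bullet> b = 0")
    case True
    have "(pd b \<gamma> has_derivative (\<lambda>v. 0)) (at z)"
    proof (rule has_derivative_transform_within_open[where f = "\<lambda>z. 0" and s = "- cball 0 R"])
      show "((\<lambda>z. 0::real) has_derivative (\<lambda>v. 0)) (at z)" by simp
    qed (use that derivative_zero in \<open>auto simp: dist_norm\<close>)
    then have "pd b (pd b \<gamma>) z = 0" by (rule pd_eqI)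
    with True show ?thesis using upd_same[of b z] by (simp add: radial_def)
  next
    case False
    then show ?thesis using pd_eq_radial[of z] derivative_zero[OF that] by simp
  qed
qed (rule basis)

text \<open>With \<open>h s = \<gamma> (upd b z (sqrt s))\<close>, the factor \<open>2 ^ j\<close> is the square root of the node \<open>4 ^ j\<close>.
  No square root of a negative number occurs in either branch.\<close>
definition half_space_ext :: "(nat \<Rightarrow> real) \<Rightarrow> 'a \<Rightarrow> real" where
  "half_space_ext a z = (if z \<bullet> b \<ge> 0 then \<gamma> (upd b z (sqrt (z \<bullet> b)))
     else (\<Sum>j. a j * \<gamma> (upd b z (2 ^ j * sqrt (- (z \<bullet> b))))))"

lemma summable_terms:
  assumes "reflection_weights a" shows "summable (\<lambda>j. a j * \<gamma> (w j))"
proof -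
  obtain C where C: "\<And>z. \<bar>\<gamma> z\<bar> \<le> C" by (rule bounded) blast
  show ?thesis
    by (rule summable_comparison_test'[OF summable_mult2[OF reflection_weights_summable[OF assms], of C], of 0])
      (auto simp: abs_mult intro: mult_left_mono C)
qed

lemma continuous_ext:
  assumes "reflection_weights a"
  shows "continuous_on UNIV (half_space_ext a)"
proof -
  obtain C where C: "\<And>z. \<bar>\<gamma> z\<bar> \<le> C" by (rule bounded) blast
  let ?N = "{z::'a. z \<bullet> b \<le> 0}" and ?P = "{z::'a. z \<bullet> b \<ge> 0}"
  let ?h = "\<lambda>z. \<Sum>j. a j * \<gamma> (upd b z (2 ^ j * sqrt (- (z \<bullet> b))))"
  have ul: "uniform_limit ?N (\<lambda>n z. \<Sum>j<n. a j * \<gamma> (upd b z (2 ^ j * sqrt (- (z \<bullet> b))))) ?h sequentially"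
    by (rule Weierstrass_m_test[OF _ summable_mult2[OF reflection_weights_summable[OF assms], of C]])
      (auto simp: abs_mult intro: mult_left_mono C)
  have cN: "continuous_on ?N ?h"
    by (rule uniform_limit_theorem[OF _ ul])
      (auto intro!: always_eventually continuous_intros continuous_on_compose2[OF cont[of UNIV]] simp: upd_def)
  have cP: "continuous_on ?P (\<lambda>z. \<gamma> (upd b z (sqrt (z \<bullet> b))))"
    by (rule continuous_on_compose2[OF cont[of UNIV]]) (auto intro!: continuous_intros simp: upd_def)
  have "continuous_on (?P \<union> ?N) (\<lambda>z. if z \<bullet> b \<ge> 0 then \<gamma> (upd b z (sqrt (z \<bullet> b))) else ?h z)"
  proof (rule continuous_on_cases[OF _ _ cP cN])
    have cl: "closed ?P" "closed ?N"
      by (auto intro!: closed_Collect_le continuous_intros)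
    show "closed ?P" "closed ?N" by (fact cl)+
    \<comment> \<open>On the hyperplane all nodes collapse to the one point
      \<open>upd b z 0\<close>, so both branches agree because the weights sum to 1.\<close>
    have eq: "\<gamma> (upd b z (sqrt (z \<bullet> b))) = ?h z" if "z \<bullet> b = 0" for z
      using that suminf_mult2[OF summable_rabs_cancel[OF reflection_weights_summable[OF assms]], of "\<gamma> (upd b z 0)"] reflection_weights_sum[OF assms] by simp
    show "\<forall>z. z \<in> ?P \<and> \<not> 0 \<le> z \<bullet> b \<or> z \<in> ?N \<and> 0 \<le> z \<bullet> b \<longrightarrow> \<gamma> (upd b z (sqrt (z \<bullet> b))) = ?h z"
      using eq by force
  qed
  moreover have "?P \<union> ?N = UNIV" by auto
  ultimately show ?thesis by (simp add: half_space_ext_def[abs_def])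
qed

end

text \<open>A translation along \<open>i\<close> commutes with every substitution in the coordinate
  along \<open>b\<close>, so the derivative is the extension of \<open>pd i \<gamma>\<close> with
  unchanged weights.\<close>

lemma (in even_function) ext_derivative_other:
  assumes "reflection_weights a" "i \<in> Basis" "i \<noteq> b"
  shows "((\<lambda>t. half_space_ext a (z + t *\<^sub>R i)) has_real_derivative
     even_function.half_space_ext b (pd i \<gamma>) a z) (at 0)"
proof -
  interpret di: even_function b R "pd i \<gamma>" by (rule even_function_pd[OF assms(2,3)])
  obtain C where C: "\<And>z. \<bar>pd i \<gamma> z\<bar> \<le> C" by (rule di.bounded) blast
  have ib: "i \<bullet> b = 0" using assms basis by (simp add: inner_Basis)
  have [simp]: "(z + t *\<^sub>R i) \<bullet> b = z \<bullet> b" for t by (simp add: inner_add_left ib)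
  have u: "upd b (z + t *\<^sub>R i) s = upd b z s + t *\<^sub>R i" for t s by (simp add: upd_def algebra_simps ib)
  have line: "((\<lambda>t. \<gamma> (w + t *\<^sub>R i)) has_real_derivative pd i \<gamma> (w + t *\<^sub>R i)) (at t)" for w t
    by (rule has_real_derivative_along_line[OF has_deriv])
  show ?thesis
  proof (cases "z \<bullet> b \<ge> 0")
    case True
    then show ?thesis using line[of "upd b z (sqrt (z \<bullet> b))" 0]
      by (simp add: half_space_ext_def di.half_space_ext_def u)
  next
    case False
    let ?w = "\<lambda>j. upd b z (2 ^ j * sqrt (- (z \<bullet> b)))"
    have "((\<lambda>t. \<Sum>j. a j * \<gamma> (?w j + t *\<^sub>R i)) has_real_derivative (\<Sum>j. a j * pd i \<gamma> (?w j + 0 *\<^sub>R i))) (at 0)"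
    proof (rule DERIV_suminf_bounded[of UNIV 0 _ _ "\<lambda>j. \<bar>a j\<bar> * C"])
      show "\<bar>a n * pd i \<gamma> (?w n + x *\<^sub>R i)\<bar> \<le> \<bar>a n\<bar> * C" for n x
        by (auto simp: abs_mult intro: mult_left_mono C)
      show "summable (\<lambda>n. a n * \<gamma> (?w n + 0 *\<^sub>R i))" by (rule summable_terms[OF assms(1)])
      show "((\<lambda>t. a n * \<gamma> (?w n + t *\<^sub>R i)) has_real_derivative a n * pd i \<gamma> (?w n + x *\<^sub>R i)) (at x)" for n x
        by (rule DERIV_cmult[OF line])
    qed (auto intro: summable_mult2[OF reflection_weights_summable[OF assms(1)]])
    then show ?thesis using False by (simp add: half_space_ext_def di.half_space_ext_def u)
  qed
qed

text \<open>The derivative of \<open>\<gamma> (sqrt s)\<close> is \<open>radial (sqrt s)\<close> for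
  positive \<open>s\<close>, and on the negative side the factors \<open>- (4 ^ j)\<close> enter the
  weights. Both branches are those of the extension of \<open>radial\<close>; its continuity settles
  the point 0.\<close>

lemma (in even_function) ext_derivative_normal:
  assumes "reflection_weights a"
  shows "((\<lambda>t. half_space_ext a (z + t *\<^sub>R b)) has_real_derivative
     even_function.half_space_ext b radial (\<lambda>j. - (4 ^ j) * a j) z) (at 0)"
proof -
  interpret rad: even_function b R radial by (rule even_function_radial)
  obtain C where C: "\<And>z. \<bar>radial z\<bar> \<le> C" by (rule rad.bounded) blast
  let ?a = "\<lambda>j. - (4 ^ j) * a j"
  have wt: "reflection_weights ?a" by (rule reflection_weights_shift[OF assms])
  define p where "p s = half_space_ext a (upd b z s)" for s
  define q where "q s = rad.half_space_ext ?a (upd b z s)" for s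
  have cu: "continuous_on UNIV (upd b z)" unfolding upd_def[abs_def] by (intro continuous_intros)
  have "continuous_on UNIV p" "continuous_on UNIV q" unfolding p_def q_def
    by (rule continuous_on_compose2[OF _ cu], rule continuous_ext rad.continuous_ext, fact, simp)+
  then have cont_pq: "isCont p 0" "isCont q 0" by (auto simp: continuous_on_eq_continuous_at)
  have along: "((\<lambda>s. \<gamma> (upd b z s)) has_real_derivative 2 * s * radial (upd b z s)) (at s)" for s
    using upd_has_real_derivative[OF basis has_deriv, of z s] basis by (simp add: pd_eq_radial)
  have ne: "(p has_real_derivative q s) (at s)" if "s \<noteq> 0" for s
  proof (cases "s > 0")
    case True
    have "((\<lambda>s. \<gamma> (upd b z (sqrt s))) has_real_derivative 2 * sqrt s * radial (upd b z (sqrt s)) * (inverse (sqrt s) / 2)) (at s)"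
      by (rule DERIV_chain2[where f = "\<lambda>s. \<gamma> (upd b z s)", OF along DERIV_real_sqrt[OF True]])
    then have "((\<lambda>s. \<gamma> (upd b z (sqrt s))) has_real_derivative q s) (at s)"
      by (rule DERIV_cong) (use True in \<open>simp add: q_def rad.half_space_ext_def basis field_simps\<close>)
    then show ?thesis
      by (rule has_field_derivative_transform_within_open[of _ _ _ "{0<..}"])
        (use True in \<open>auto simp: p_def half_space_ext_def basis\<close>)
  next
    case False
    then have s: "s < 0" using that by simp
    \<comment> \<open>The derivative of \<open>\<gamma>\<close> along \<open>b\<close> contributes
      \<open>2 * 2 ^ j * sqrt (- x)\<close>, the inner derivative
      \<open>- (2 ^ j) / (2 * sqrt (- x))\<close>; the roots cancel and leave
      \<open>- (4 ^ j)\<close>.\<close>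
    have deriv_j: "((\<lambda>s. a j * \<gamma> (upd b z (2 ^ j * sqrt (- s)))) has_real_derivative
        ?a j * radial (upd b z (2 ^ j * sqrt (- x)))) (at x)" if "x < 0" for j x
    proof -
      have "((\<lambda>s. 2 ^ j * sqrt (- s)) has_real_derivative 2 ^ j * (inverse (sqrt (- x)) / 2 * - 1)) (at x)"
        by (intro DERIV_cmult DERIV_chain2[where f = sqrt, OF DERIV_real_sqrt])
          (use that in \<open>auto intro!: derivative_eq_intros\<close>)
      from DERIV_cmult[OF DERIV_chain2[where f = "\<lambda>s. \<gamma> (upd b z s)", OF along this], of "a j"]
      show ?thesis
        by (rule DERIV_cong) (use that in \<open>simp add: power_mult_distrib[symmetric] field_simps\<close>)
    qed
    have "((\<lambda>s. \<Sum>j. a j * \<gamma> (upd b z (2 ^ j * sqrt (- s)))) has_real_derivative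
        (\<Sum>j. ?a j * radial (upd b z (2 ^ j * sqrt (- s))))) (at s)"
    proof (rule DERIV_suminf_bounded[of "{..<0}" s _ _ "\<lambda>j. \<bar>?a j\<bar> * C"])
      show "\<bar>?a n * radial (upd b z (2 ^ n * sqrt (- x)))\<bar> \<le> \<bar>?a n\<bar> * C" for n x
        by (subst abs_mult) (intro mult_left_mono C abs_ge_zero)
      show "summable (\<lambda>j. \<bar>?a j\<bar> * C)" by (rule summable_mult2[OF reflection_weights_summable[OF wt]])
      show "summable (\<lambda>n. a n * \<gamma> (upd b z (2 ^ n * sqrt (- s))))" by (rule summable_terms[OF assms])
      show "((\<lambda>s. a n * \<gamma> (upd b z (2 ^ n * sqrt (- s)))) has_real_derivative
          ?a n * radial (upd b z (2 ^ n * sqrt (- x)))) (at x)" if "x \<in> {..<0}" for n x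
        using deriv_j that by simp
    qed (use s in auto)
    also have "(\<Sum>j. ?a j * radial (upd b z (2 ^ j * sqrt (- s)))) = q s"
      using s by (simp add: q_def rad.half_space_ext_def basis)
    finally show ?thesis
      by (rule has_field_derivative_transform_within_open[of _ _ _ "{..<0}"])
        (use s in \<open>auto simp: p_def half_space_ext_def basis\<close>)
  qed
  have "(p has_real_derivative q (z \<bullet> b)) (at (z \<bullet> b))"
    using ne DERIV_at_0_from_limit[OF cont_pq ne] by (cases "z \<bullet> b = 0") auto
  then have "((\<lambda>t. p (t + z \<bullet> b)) has_real_derivative q (z \<bullet> b)) (at 0)"
    using DERIV_shift[of p _ 0 "z \<bullet> b"] by simp
  moreover have "p (t + z \<bullet> b) = half_space_ext a (z + t *\<^sub>R b)" for t
    by (simp add: p_def upd_def)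
  ultimately show ?thesis by (simp add: q_def)
qed

text \<open>The closed family ranges over all even functions supported in the ball and over all
  weights, because a derivative along \<open>b\<close> changes both.\<close>

lemma (in even_function) smooth_ext:
  assumes "reflection_weights a"
  shows "smooth_on (half_space_ext a) UNIV"
proof (rule smooth_on_closed_family[OF open_UNIV,
    where S = "{even_function.half_space_ext b \<gamma> a | \<gamma> a. even_function b R \<gamma> \<and> reflection_weights a}"])
  show "half_space_ext a \<in> {even_function.half_space_ext b \<gamma> a | \<gamma> a. even_function b R \<gamma> \<and> reflection_weights a}"
    using assms even_function_axioms by blast
next
  fix f assume "f \<in> {even_function.half_space_ext b \<gamma> a | \<gamma> a. even_function b R \<gamma> \<and> reflection_weights a}"
  then obtain \<delta> w where f: "f = even_function.half_space_ext b \<delta> w" "even_function b R \<delta>" "reflection_weights w" by blast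
  interpret \<delta>: even_function b R \<delta> by fact
  show "continuous_on UNIV f" unfolding f(1) by (rule \<delta>.continuous_ext[OF f(3)])
  fix i :: 'a assume i: "i \<in> Basis"
  show "\<exists>g\<in>{even_function.half_space_ext b \<gamma> a | \<gamma> a. even_function b R \<gamma> \<and> reflection_weights a}.
      \<forall>x\<in>UNIV. ((\<lambda>t. f (x + t *\<^sub>R i)) has_real_derivative g x) (at 0)"
  proof (cases "i = b")
    case True
    then show ?thesis unfolding f(1)
      using \<delta>.ext_derivative_normal[OF f(3)] \<delta>.even_function_radial reflection_weights_shift[OF f(3)] by blast
  next
    case False
    then show ?thesis unfolding f(1)
      using \<delta>.ext_derivative_other[OF f(3) i False] \<delta>.even_function_pd[OF i False] f(3) by blast
  qed
qed

text \<open>Whitney's theorem with parameters. A cutoff that depends only on the norm keeps the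
  function even and gives it bounded support; its half-space extension is then a smooth choice of
  \<open>A\<close>.\<close>

lemma even_germ_function_of_square:
  fixes \<gamma> :: "'a::euclidean_space \<Rightarrow> real"
  assumes "b \<in> Basis" "smooth_germ \<gamma>" "\<forall>\<^sub>F z in nhds 0. \<gamma> (upd b z (- (z \<bullet> b))) = \<gamma> z"
  obtains A where "smooth_germ A" "\<forall>\<^sub>F z in nhds 0. \<gamma> z = A (upd b z ((z \<bullet> b)\<^sup>2))"
proof -
  obtain r1 where r1: "r1 > 0" "smooth_on \<gamma> (ball 0 r1)" using assms smooth_germE by metis
  obtain r2 where r2: "r2 > 0" "\<And>z. norm z < r2 \<Longrightarrow> \<gamma> (upd b z (- (z \<bullet> b))) = \<gamma> z"
    using assms(3) unfolding eventually_nhds_metric by (auto simp: dist_norm)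
  define r where "r = min r1 r2"
  have r: "r > 0" "smooth_on \<gamma> (ball 0 r)" "\<And>z. norm z < r \<Longrightarrow> \<gamma> (upd b z (- (z \<bullet> b))) = \<gamma> z"
    using r1 r2 smooth_on_subset[OF r1(2)] by (auto simp: r_def subset_ball)
  \<comment> \<open>The argument \<open>c * (z \<bullet> z)\<close> of the cutoff is at least 2 for
    \<open>norm z \<ge> r / 2\<close> and at most \<open>1/2\<close> for
    \<open>norm z \<le> r / 4\<close>.\<close>
  define c where "c = 8 / r\<^sup>2"
  have c: "c > 0" using r(1) by (simp add: c_def)
  have norm_reflect: "norm (upd b z (- (z \<bullet> b))) = norm z" for z
  proof (rule antisym)
    show "norm (upd b z (- (z \<bullet> b))) \<le> norm z" by (rule norm_upd_le[OF assms(1)]) simp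
    show "norm z \<le> norm (upd b z (- (z \<bullet> b)))"
      using norm_upd_le[OF assms(1), of "z \<bullet> b" "upd b z (- (z \<bullet> b))"] assms(1) by simp
  qed
  define \<delta> where "\<delta> z = (if norm z < r then cutoff (c * (z \<bullet> z)) * \<gamma> z else 0)" for z
  have far: "cutoff (c * (z \<bullet> z)) = 0" if "norm z > r / 2" for z :: 'a
  proof (rule cutoff_eq_0)
    have "(r/2)\<^sup>2 \<le> (norm z)\<^sup>2" using that r(1) by (intro power_mono) auto
    then have "c * (r/2)\<^sup>2 \<le> c * (z \<bullet> z)" using c by (simp add: dot_square_norm)
    moreover have "c * (r/2)\<^sup>2 = 2" using r(1) by (simp add: c_def power_divide)
    ultimately show "c * (z \<bullet> z) \<ge> 2" by simp
  qed
  interpret \<delta>: even_function b "r / 2" \<delta>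
  proof
    have "smooth_on \<delta> (ball 0 r)"
    proof (rule smooth_on_cong[of _ "\<lambda>z. cutoff (c * (z \<bullet> z)) * \<gamma> z"])
      have "smooth_on (\<lambda>z. z \<bullet> z) (ball (0::'a) r)"
        by (rule smooth_on_bilinear[OF _ bounded_bilinear_inner]) (auto intro: smooth_on_linear)
      then have "smooth_on (\<lambda>z. c * (z \<bullet> z)) (ball (0::'a) r)"
        by (intro smooth_on_mult smooth_on_const) auto
      then have "smooth_on (\<lambda>z. cutoff (c * (z \<bullet> z))) (ball (0::'a) r)"
        by (intro smooth_on_compose[OF _ open_UNIV _ smooth_on_cutoff]) auto
      then show "smooth_on (\<lambda>z. cutoff (c * (z \<bullet> z)) * \<gamma> z) (ball 0 r)"
        by (intro smooth_on_mult r(2)) auto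
    qed (auto simp: \<delta>_def)
    moreover have "smooth_on \<delta> (- cball 0 (r/2))"
      by (rule smooth_on_cong[of _ "\<lambda>z. 0"]) (auto simp: \<delta>_def far intro: smooth_on_const)
    ultimately have "smooth_on \<delta> (ball 0 r \<union> - cball 0 (r/2))"
      by (intro smooth_on_Un) auto
    then show "smooth_on \<delta> UNIV" by (rule smooth_on_subset) (use r(1) in auto)
    show "\<delta> (upd b z (- (z \<bullet> b))) = \<delta> z" for z
      using norm_reflect[of z] r(3)[of z] by (simp add: \<delta>_def dot_square_norm)
    show "\<delta> z = 0" if "norm z > r / 2" for z using far[OF that] by (simp add: \<delta>_def)
  qed (rule assms(1))
  obtain a where a: "reflection_weights a" using reflection_weights_exist by blast
  have "smooth_germ (\<delta>.half_space_ext a)"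
    by (rule smooth_germI[of 1]) (use \<delta>.smooth_ext[OF a] smooth_on_subset in auto)
  moreover have "\<forall>\<^sub>F z in nhds 0. \<gamma> z = \<delta>.half_space_ext a (upd b z ((z \<bullet> b)\<^sup>2))"
    unfolding eventually_nhds_metric
  proof (intro exI[of _ "r / 4"] conjI allI impI)
    fix z :: 'a assume "dist z 0 < r / 4"
    then have z: "norm z < r / 4" by simp
    then have "(norm z)\<^sup>2 \<le> (r/4)\<^sup>2" by (intro power_mono) auto
    then have "c * (z \<bullet> z) \<le> c * (r/4)\<^sup>2" using c by (simp add: dot_square_norm)
    also have "c * (r/4)\<^sup>2 \<le> 1" using r(1) by (simp add: c_def power_divide)
    finally have "\<delta> z = \<gamma> z" using z r(1) by (simp add: \<delta>_def cutoff_eq_1)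
    \<comment> \<open>Squares only meet the non-negative branch, where \<open>sqrt\<close> returns
      the absolute value of the coordinate; evenness then removes it.\<close>
    moreover have "\<delta>.half_space_ext a (upd b z ((z \<bullet> b)\<^sup>2)) = \<delta> (upd b z \<bar>z \<bullet> b\<bar>)"
      using assms(1) by (simp add: \<delta>.half_space_ext_def)
    moreover have "\<delta> (upd b z \<bar>z \<bullet> b\<bar>) = \<delta> z"
      using \<delta>.even[of z] by (simp add: abs_if)
    ultimately show "\<gamma> z = \<delta>.half_space_ext a (upd b z ((z \<bullet> b)\<^sup>2))" by simp
  qed (use r in auto)
  ultimately show thesis by (rule that)
qed

subsection \<open>The module generated by the differentials\<close>

text \<open>Entries of the adjugate matrix, written as determinants so that smoothness is immediate.\<close>
definition cofactor_entry :: "real^'n^'n \<Rightarrow> 'n \<Rightarrow> 'n \<Rightarrow> real" where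
  "cofactor_entry A m i = det (\<chi> c. if c = m then axis i 1 else column c A)"

lemma axis_component: "axis k x $ i = (if i = k then x else 0)"
  by (simp add: axis_def)

text \<open>The matrix in \<open>cofactor_entry\<close> is the transpose of \<open>A\<close> with
  row \<open>m\<close> replaced. By linearity in that row the sum puts column \<open>j\<close> of
  \<open>A\<close> there, which yields either \<open>transpose A\<close> or a matrix with two equal
  rows.\<close>

lemma sum_cofactor_entry: "(\<Sum>i\<in>UNIV. A $ i $ j * cofactor_entry A m i) = (if m = j then det A else 0)"
proof -
  have "(\<Sum>i\<in>UNIV. A $ i $ j * cofactor_entry A m i) = det (\<chi> c. if c = m then (\<Sum>i\<in>UNIV. A $ i $ j *s axis i 1) else column c A)"
    unfolding cofactor_entry_def det_linear_row_sum[OF finite] det_row_mul ..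
  also have "(\<Sum>i\<in>UNIV. A $ i $ j *s axis i 1) = column j A"
    by (simp add: vec_eq_iff column_def axis_def if_distrib[where f = "\<lambda>x. _ * x"] cong: if_cong)
  also have "det (\<chi> c. if c = m then column j A else column c A) = (if m = j then det A else 0)"
  proof (cases "m = j")
    case True
    then have "(\<chi> c. if c = m then column j A else column c A) = transpose A"
      by (simp add: vec_eq_iff transpose_def column_def)
    then show ?thesis using True by simp
  next
    case False
    then show ?thesis by (subst det_identical_rows[of m j]) (auto simp: row_def)
  qed
  finally show ?thesis .
qed

text \<open>Cramer's rule for covectors: \<open>det A\<close> times any \<open>\<omega>\<close> is a
  combination of the rows of \<open>A\<close>, with coefficients polynomial in the data. With the
  Jacobian matrix for \<open>A\<close> the rows are the differentials of the components.\<close>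

lemma det_times_in_row_span:
  "det A * (\<omega> \<bullet> v) = (\<Sum>i\<in>UNIV. (\<Sum>m\<in>UNIV. \<omega> $ m * cofactor_entry A m i) * (A *v v) $ i)"
proof -
  have "(\<Sum>i\<in>UNIV. (\<Sum>m\<in>UNIV. \<omega> $ m * cofactor_entry A m i) * (A *v v) $ i)
      = (\<Sum>i\<in>UNIV. \<Sum>m\<in>UNIV. \<Sum>j\<in>UNIV. \<omega> $ m * v $ j * (A $ i $ j * cofactor_entry A m i))"
    unfolding matrix_vector_mult_def vec_lambda_beta sum_product by (simp add: mult_ac)
  also have "\<dots> = (\<Sum>m\<in>UNIV. \<Sum>j\<in>UNIV. \<Sum>i\<in>UNIV. \<omega> $ m * v $ j * (A $ i $ j * cofactor_entry A m i))"
    by (subst sum.swap, rule sum.cong[OF refl], rule sum.swap)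
  also have "\<dots> = (\<Sum>m\<in>UNIV. \<Sum>j\<in>UNIV. \<omega> $ m * v $ j * (if m = j then det A else 0))"
    by (simp only: sum_distrib_left[symmetric] sum_cofactor_entry)
  also have "\<dots> = det A * (\<omega> \<bullet> v)"
    by (simp add: inner_vec_def sum_distrib_left mult_ac if_distrib[where f = "\<lambda>x. _ * x"] cong: if_cong)
  finally show ?thesis by simp
qed

lemma smooth_germ_cofactor_entry:
  fixes A :: "'a::euclidean_space \<Rightarrow> real^'n^'n"
  assumes "\<And>i j. smooth_germ (\<lambda>x. A x $ i $ j)"
  shows "smooth_germ (\<lambda>x. cofactor_entry (A x) m i)"
  unfolding cofactor_entry_def
proof (rule smooth_germ_det)
  show "smooth_germ (\<lambda>x. (\<chi> c. if c = m then axis i 1 else column c (A x)) $ r $ j)" for r j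
    by (cases "r = m") (auto simp: column_def intro: smooth_germ_const assms)
qed

lemma frechet_derivative_vec_nth:
  assumes "(f has_derivative f') (at x)"
  shows "frechet_derivative (\<lambda>y. f y $ i) (at x) v = f' v $ i"
proof -
  have "((\<lambda>y. f y $ i) has_derivative (\<lambda>v. f' v $ i)) (at x)"
    by (rule bounded_linear.has_derivative[OF bounded_linear_vec_nth assms])
  then show ?thesis using frechet_derivative_at by metis
qed

lemma matrix_frechet_mult:
  fixes f :: "real^'n \<Rightarrow> real^'n"
  assumes "(f has_derivative f') (at x)"
  shows "matrix f' *v v = f' v"
  using fun_cong[OF matrix_vector_mul(2)[OF has_derivative_linear[OF assms]], of v] .

lemma matrix_entry_smooth:
  fixes f :: "real^'n \<Rightarrow> real^'n"
  assumes "smooth_germ f"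
  shows "smooth_germ (\<lambda>x. matrix (frechet_derivative f (at x)) $ i $ j)"
  by (simp add: matrix_def smooth_germ_vec_nth smooth_germ_frechet_derivative assms)

lemma smooth_germ_filterlim: "smooth_germ f \<Longrightarrow> f 0 = 0 \<Longrightarrow> filterlim f (nhds 0) (nhds 0)"
  using smooth_germ_tendsto[of f] by simp

lemma eventually_germ_compose:
  "smooth_germ f \<Longrightarrow> f 0 = 0 \<Longrightarrow> \<forall>\<^sub>F y in nhds 0. P y \<Longrightarrow> \<forall>\<^sub>F x in nhds 0. P (f x)"
  using smooth_germ_filterlim[of f] unfolding filterlim_iff by simp

lemma eventually_nhds_eventually: "\<forall>\<^sub>F x in nhds a. P x \<Longrightarrow> \<forall>\<^sub>F x in nhds a. \<forall>\<^sub>F y in nhds x. P y"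
  by (simp add: eventually_eventually)

lemma has_derivative_transform_nhds:
  assumes "(f has_derivative f') (at x)" "\<forall>\<^sub>F y in nhds x. f y = g y"
  shows "(g has_derivative f') (at x)"
proof (rule has_derivative_transform_eventually[OF assms(1)])
  show "\<forall>\<^sub>F y in at x. f y = g y"
    using assms(2) by (auto simp: eventually_at_filter elim: eventually_mono)
  show "f x = g x" by (rule eventually_nhds_x_imp_x[OF assms(2)])
qed simp

lemma linear_eq_inner_vec:
  assumes "linear (h :: real^'n \<Rightarrow> real)"
  shows "h v = (\<chi> m. h (axis m 1)) \<bullet> v"
proof -
  have "(\<Sum>m\<in>UNIV. v $ m *\<^sub>R axis m 1) = v"
    by (simp add: vec_eq_iff axis_component if_distrib[where f = "\<lambda>x. _ * x"] cong: if_cong)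
  then have "h v = h (\<Sum>m\<in>UNIV. v $ m *\<^sub>R axis m 1)" by simp
  also have "\<dots> = (\<Sum>m\<in>UNIV. v $ m * h (axis m 1))"
    by (simp add: linear_sum[OF assms] linear_cmul[OF assms])
  finally have "h v = (\<Sum>m\<in>UNIV. v $ m * h (axis m 1))" .
  then show ?thesis by (simp add: inner_vec_def mult.commute)
qed

text \<open>The differential of \<open>a * J^2\<close> still contains one factor \<open>J\<close>,
  and this factor is what Cramer's rule needs. The summand \<open>\<eta> \<circ> f\<close> is
  covered by the chain rule.\<close>

lemma germ_sum_subset_ramification:
  fixes f :: "real^'n \<Rightarrow> real^'n"
  assumes f: "smooth_germ f" "f 0 = 0"
  shows "germ_sum (germ_ideal1 (\<lambda>x. (jac f x)\<^sup>2)) (pullback f) \<subseteq> ramification f"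
proof
  fix \<phi> assume "\<phi> \<in> germ_sum (germ_ideal1 (\<lambda>x. (jac f x)\<^sup>2)) (pullback f)"
  then obtain u v a \<eta> where a: "smooth_germ a" "\<forall>\<^sub>F x in nhds 0. u x = a x * (jac f x)\<^sup>2"
    and \<eta>: "smooth_germ \<eta>" "\<forall>\<^sub>F x in nhds 0. v x = \<eta> (f x)" and uv: "\<forall>\<^sub>F x in nhds 0. \<phi> x = u x + v x"
    unfolding germ_sum_def germ_ideal1_def pullback_def by blast
  have \<phi>: "\<forall>\<^sub>F x in nhds 0. \<phi> x = a x * (jac f x)\<^sup>2 + \<eta> (f x)"
    using uv a(2) \<eta>(2) by eventually_elim simp
  let ?\<psi> = "\<lambda>x. a x * (jac f x)\<^sup>2 + \<eta> (f x)"
  have J: "smooth_germ (jac f)" by (rule smooth_germ_jac[OF f(1)])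
  have \<psi>: "smooth_germ ?\<psi>"
    by (intro smooth_germ_intros a(1) J smooth_germ_compose[OF \<eta>(1) f])
  have "\<forall>\<^sub>F x in nhds 0. ?\<psi> x = \<phi> x" using \<phi> by (auto elim: eventually_mono)
  then have sm: "smooth_germ \<phi>" by (rule smooth_germ_cong[OF \<psi>])
  define D where "D x = frechet_derivative f (at x)" for x
  \<comment> \<open>The 1-form \<open>J da + 2 a dJ\<close>, for which
    \<open>d (a * J^2) = J * \<omega>\<close>.\<close>
  define \<omega> where "\<omega> x = (\<chi> m. jac f x * pd (axis m 1) a x + 2 * a x * pd (axis m 1) (jac f) x)" for x
  define \<alpha> where "\<alpha> i x = (\<Sum>m\<in>UNIV. \<omega> x $ m * cofactor_entry (matrix (D x)) m i) + pd (axis i 1) \<eta> (f x)" for i x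
  have "smooth_germ (\<alpha> i)" for i
    unfolding \<alpha>_def \<omega>_def D_def vec_lambda_beta
    by (intro smooth_germ_intros smooth_germ_sum smooth_germ_cofactor_entry matrix_entry_smooth f a(1) J
        smooth_germ_frechet_derivative smooth_germ_compose[OF smooth_germ_frechet_derivative[OF \<eta>(1)]])
  moreover have "\<forall>\<^sub>F x in nhds 0. (\<phi> has_derivative (\<lambda>v. \<Sum>i\<in>UNIV. \<alpha> i x * frechet_derivative (\<lambda>y. f y $ i) (at x) v)) (at x)"
    using smooth_germ_has_derivative[OF f(1)] smooth_germ_has_derivative[OF a(1)] smooth_germ_has_derivative[OF J]
      eventually_germ_compose[OF f smooth_germ_has_derivative[OF \<eta>(1)]] eventually_nhds_eventually[OF \<phi>]
  proof eventually_elim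
    fix x
    assume df: "(f has_derivative frechet_derivative f (at x)) (at x)"
      and da: "(a has_derivative frechet_derivative a (at x)) (at x)"
      and dJ: "(jac f has_derivative frechet_derivative (jac f) (at x)) (at x)"
      and d\<eta>: "(\<eta> has_derivative frechet_derivative \<eta> (at (f x))) (at (f x))"
      and eq: "\<forall>\<^sub>F y in nhds x. \<phi> y = a y * (jac f y)\<^sup>2 + \<eta> (f y)"
    have la: "frechet_derivative a (at x) v = (\<chi> m. pd (axis m 1) a x) \<bullet> v" for v
      by (rule linear_eq_inner_vec[OF has_derivative_linear[OF da]])
    have lJ: "frechet_derivative (jac f) (at x) v = (\<chi> m. pd (axis m 1) (jac f) x) \<bullet> v" for v
      by (rule linear_eq_inner_vec[OF has_derivative_linear[OF dJ]])
    have l\<eta>: "frechet_derivative \<eta> (at (f x)) w = (\<chi> m. pd (axis m 1) \<eta> (f x)) \<bullet> w" for w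
      by (rule linear_eq_inner_vec[OF has_derivative_linear[OF d\<eta>]])
    have "(?\<psi> has_derivative (\<lambda>v. frechet_derivative a (at x) v * (jac f x)\<^sup>2
        + a x * (2 * jac f x * frechet_derivative (jac f) (at x) v)
        + frechet_derivative \<eta> (at (f x)) (D x v))) (at x)"
      unfolding D_def power2_eq_square
      by (rule has_derivative_eq_rhs[OF has_derivative_add[OF has_derivative_mult[OF da has_derivative_mult[OF dJ dJ]] has_derivative_compose[OF df d\<eta>]]])
        (simp add: fun_eq_iff algebra_simps)
    moreover have "frechet_derivative a (at x) v * (jac f x)\<^sup>2
        + a x * (2 * jac f x * frechet_derivative (jac f) (at x) v)
        + frechet_derivative \<eta> (at (f x)) (D x v) = (\<Sum>i\<in>UNIV. \<alpha> i x * frechet_derivative (\<lambda>y. f y $ i) (at x) v)" for v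
    proof -
      have "frechet_derivative a (at x) v * (jac f x)\<^sup>2 + a x * (2 * jac f x * frechet_derivative (jac f) (at x) v)
          = det (matrix (D x)) * (\<omega> x \<bullet> v)"
      proof -
        have "\<omega> x = jac f x *\<^sub>R (\<chi> m. pd (axis m 1) a x) + (2 * a x) *\<^sub>R (\<chi> m. pd (axis m 1) (jac f) x)"
          by (simp add: \<omega>_def vec_eq_iff)
        then have "\<omega> x \<bullet> v = jac f x * frechet_derivative a (at x) v + (2 * a x) * frechet_derivative (jac f) (at x) v"
          unfolding la[of v] lJ[of v] by (simp only: inner_add_left inner_scaleR_left)
        moreover have "det (matrix (D x)) = jac f x" by (simp add: jac_def D_def)
        ultimately show ?thesis by (simp add: power2_eq_square algebra_simps)
      qed
      also have "\<dots> = (\<Sum>i\<in>UNIV. (\<Sum>m\<in>UNIV. \<omega> x $ m * cofactor_entry (matrix (D x)) m i) * D x v $ i)"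
        unfolding det_times_in_row_span D_def matrix_frechet_mult[OF df] ..
      finally have "frechet_derivative a (at x) v * (jac f x)\<^sup>2 + a x * (2 * jac f x * frechet_derivative (jac f) (at x) v)
          = (\<Sum>i\<in>UNIV. (\<Sum>m\<in>UNIV. \<omega> x $ m * cofactor_entry (matrix (D x)) m i) * D x v $ i)" .
      moreover have "frechet_derivative \<eta> (at (f x)) (D x v) = (\<Sum>i\<in>UNIV. pd (axis i 1) \<eta> (f x) * D x v $ i)"
        unfolding l\<eta>[of "D x v"] inner_vec_def by simp
      ultimately show ?thesis
        unfolding \<alpha>_def frechet_derivative_vec_nth[OF df] D_def[symmetric]
        by (simp only: distrib_right sum.distrib)
    qed
    ultimately have "(?\<psi> has_derivative (\<lambda>v. \<Sum>i\<in>UNIV. \<alpha> i x * frechet_derivative (\<lambda>y. f y $ i) (at x) v)) (at x)"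
      by simp
    then show "(\<phi> has_derivative (\<lambda>v. \<Sum>i\<in>UNIV. \<alpha> i x * frechet_derivative (\<lambda>y. f y $ i) (at x) v)) (at x)"
      by (rule has_derivative_transform_nhds) (use eq in \<open>auto elim: eventually_mono\<close>)
  qed
  ultimately show "\<phi> \<in> ramification f"
    unfolding ramification_def using sm by blast
qed

subsection \<open>Coordinate changes\<close>

text \<open>The harder inclusion with explicit \<open>a\<close> and \<open>\<eta>\<close>, in a form
  that can be carried through coordinate changes of source and target.\<close>

definition ramification_decomposes :: "(real^'n \<Rightarrow> real^'n) \<Rightarrow> bool" where
  "ramification_decomposes f \<longleftrightarrow> (\<forall>\<phi>\<in>ramification f. \<exists>a \<eta>. smooth_germ a \<and> smooth_germ \<eta> \<and>
     (\<forall>\<^sub>F x in nhds 0. \<phi> x = a x * (jac f x)\<^sup>2 + \<eta> (f x)))"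

lemma ramification_decomposes_imp_subset:
  assumes "ramification_decomposes f"
  shows "ramification f \<subseteq> germ_sum (germ_ideal1 (\<lambda>x. (jac f x)\<^sup>2)) (pullback f)"
proof
  fix \<phi> assume "\<phi> \<in> ramification f"
  then obtain a \<eta> where "smooth_germ a" "smooth_germ \<eta>" "\<forall>\<^sub>F x in nhds 0. \<phi> x = a x * (jac f x)\<^sup>2 + \<eta> (f x)"
    using assms unfolding ramification_decomposes_def by blast
  then show "\<phi> \<in> germ_sum (germ_ideal1 (\<lambda>x. (jac f x)\<^sup>2)) (pullback f)"
    unfolding germ_sum_def
  proof (intro CollectI bexI)
    show "(\<lambda>x. a x * (jac f x)\<^sup>2) \<in> germ_ideal1 (\<lambda>x. (jac f x)\<^sup>2)"
      unfolding germ_ideal1_def using \<open>smooth_germ a\<close> by (intro CollectI exI[of _ a]) simp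
    show "(\<lambda>x. \<eta> (f x)) \<in> pullback f"
      unfolding pullback_def using \<open>smooth_germ \<eta>\<close> by (intro CollectI exI[of _ \<eta>]) simp
  qed
qed

lemma jac_compose:
  fixes f g :: "real^'n \<Rightarrow> real^'n"
  assumes "(g has_derivative frechet_derivative g (at x)) (at x)"
    "(f has_derivative frechet_derivative f (at (g x))) (at (g x))"
  shows "jac (\<lambda>x. f (g x)) x = jac f (g x) * jac g x"
proof -
  have "frechet_derivative (\<lambda>x. f (g x)) (at x) = frechet_derivative f (at (g x)) \<circ> frechet_derivative g (at x)"
    using frechet_derivative_at[OF has_derivative_compose[OF assms]] by (simp add: o_def)
  then show ?thesis
    using matrix_compose[OF has_derivative_linear[OF assms(1)] has_derivative_linear[OF assms(2)]]
    by (simp add: jac_def det_mul)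
qed

text \<open>Ramification pulls back along \<open>\<Psi>\<close>, and
  \<open>jac (f \<circ> \<Psi>)\<close> is \<open>jac f \<circ> \<Psi>\<close> times
  \<open>jac \<Psi>\<close>. Transported back by \<open>\<Phi>\<close>, the square of the last
  factor is absorbed into the coefficient, while \<open>\<eta>\<close> stays the same.\<close>

lemma ramification_decomposes_source_change:
  fixes f \<Phi> \<Psi> :: "real^'n \<Rightarrow> real^'n"
  assumes f: "smooth_germ f" "f 0 = 0"
    and \<Phi>: "smooth_germ \<Phi>" "\<Phi> 0 = 0" and \<Psi>: "smooth_germ \<Psi>" "\<Psi> 0 = 0"
    and inv: "\<forall>\<^sub>F x in nhds 0. \<Psi> (\<Phi> x) = x"
    and dec: "ramification_decomposes (\<lambda>x. f (\<Psi> x))"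
  shows "ramification_decomposes f"
  unfolding ramification_decomposes_def
proof
  fix \<phi> assume "\<phi> \<in> ramification f"
  then obtain a where \<phi>: "smooth_germ \<phi>" and a: "\<And>i. smooth_germ (a i)"
    and d: "\<forall>\<^sub>F x in nhds 0. (\<phi> has_derivative (\<lambda>v. \<Sum>i\<in>UNIV. a i x * frechet_derivative (\<lambda>y. f y $ i) (at x) v)) (at x)"
    unfolding ramification_def by blast
  have "(\<lambda>x. \<phi> (\<Psi> x)) \<in> ramification (\<lambda>x. f (\<Psi> x))"
    unfolding ramification_def
  proof (intro CollectI conjI exI[of _ "\<lambda>i x. a i (\<Psi> x)"] allI)
    show "smooth_germ (\<lambda>x. \<phi> (\<Psi> x))" "smooth_germ (\<lambda>x. a i (\<Psi> x))" for i
      by (rule smooth_germ_compose[OF \<phi> \<Psi>], rule smooth_germ_compose[OF a \<Psi>])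
    show "\<forall>\<^sub>F x in nhds 0. ((\<lambda>x. \<phi> (\<Psi> x)) has_derivative
        (\<lambda>v. \<Sum>i\<in>UNIV. a i (\<Psi> x) * frechet_derivative (\<lambda>y. f (\<Psi> y) $ i) (at x) v)) (at x)"
      using eventually_germ_compose[OF \<Psi> d] smooth_germ_has_derivative[OF \<Psi>(1)]
        eventually_germ_compose[OF \<Psi> smooth_germ_has_derivative[OF f(1)]]
    proof eventually_elim
      case (elim x)
      from has_derivative_compose[OF elim(2) elim(1)] show ?case
        by (simp add: frechet_derivative_vec_nth[OF elim(3)] frechet_derivative_vec_nth[OF has_derivative_compose[OF elim(2,3)]])
    qed
  qed
  then obtain c \<eta> where c: "smooth_germ c" and \<eta>: "smooth_germ \<eta>"
    and eq: "\<forall>\<^sub>F x in nhds 0. \<phi> (\<Psi> x) = c x * (jac (\<lambda>x. f (\<Psi> x)) x)\<^sup>2 + \<eta> (f (\<Psi> x))"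
    using dec unfolding ramification_decomposes_def by meson
  have "\<forall>\<^sub>F x in nhds 0. \<phi> x = (c (\<Phi> x) * (jac \<Psi> (\<Phi> x))\<^sup>2) * (jac f x)\<^sup>2 + \<eta> (f x)"
    using inv eventually_germ_compose[OF \<Phi> eq] smooth_germ_has_derivative[OF f(1)]
      eventually_germ_compose[OF \<Phi> smooth_germ_has_derivative[OF \<Psi>(1)]]
  proof eventually_elim
    case (elim x)
    then have "jac (\<lambda>x. f (\<Psi> x)) (\<Phi> x) = jac f x * jac \<Psi> (\<Phi> x)"
      using jac_compose[of \<Psi> "\<Phi> x" f] by simp
    with elim show ?case by (simp add: power_mult_distrib)
  qed
  moreover have "smooth_germ (\<lambda>x. c (\<Phi> x) * (jac \<Psi> (\<Phi> x))\<^sup>2)"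
    by (intro smooth_germ_intros smooth_germ_compose[OF c \<Phi>] smooth_germ_compose[OF smooth_germ_jac[OF \<Psi>(1)] \<Phi>])
  ultimately show "\<exists>a \<eta>. smooth_germ a \<and> smooth_germ \<eta> \<and> (\<forall>\<^sub>F x in nhds 0. \<phi> x = a x * (jac f x)\<^sup>2 + \<eta> (f x))"
    using \<eta> by (intro exI conjI)
qed

text \<open>Because of \<open>M ** R = mat 1\<close> the differentials of \<open>f\<close> are
  combinations, through \<open>M\<close>, of those of \<open>R *v f x\<close>. The Jacobian changes
  by the constant \<open>det R\<close>, and \<open>\<eta>\<close> is composed with
  \<open>R\<close>.\<close>

lemma ramification_decomposes_target_change:
  fixes f :: "real^'n \<Rightarrow> real^'n" and M R :: "real^'n^'n"
  assumes f: "smooth_germ f" and MR: "M ** R = mat 1"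
    and dec: "ramification_decomposes (\<lambda>x. R *v f x)"
  shows "ramification_decomposes f"
  unfolding ramification_decomposes_def
proof
  fix \<phi> assume "\<phi> \<in> ramification f"
  then obtain a where \<phi>: "smooth_germ \<phi>" and a: "\<And>i. smooth_germ (a i)"
    and d: "\<forall>\<^sub>F x in nhds 0. (\<phi> has_derivative (\<lambda>v. \<Sum>i\<in>UNIV. a i x * frechet_derivative (\<lambda>y. f y $ i) (at x) v)) (at x)"
    unfolding ramification_def by blast
  have dR: "((\<lambda>x. R *v f x) has_derivative (\<lambda>v. R *v frechet_derivative f (at x) v)) (at x)"
    if "(f has_derivative frechet_derivative f (at x)) (at x)" for x
    by (rule bounded_linear.has_derivative[OF matrix_vector_mul_bounded_linear that])
  have "\<phi> \<in> ramification (\<lambda>x. R *v f x)"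
    unfolding ramification_def
  proof (intro CollectI conjI exI[of _ "\<lambda>j x. \<Sum>i\<in>UNIV. a i x * M $ i $ j"] allI)
    show "smooth_germ (\<lambda>x. \<Sum>i\<in>UNIV. a i x * M $ i $ j)" for j
      by (intro smooth_germ_sum smooth_germ_mult a smooth_germ_const)
    show "\<forall>\<^sub>F x in nhds 0. (\<phi> has_derivative
        (\<lambda>v. \<Sum>j\<in>UNIV. (\<Sum>i\<in>UNIV. a i x * M $ i $ j) * frechet_derivative (\<lambda>y. (R *v f y) $ j) (at x) v)) (at x)"
      using d smooth_germ_has_derivative[OF f]
    proof eventually_elim
      case (elim x)
      have "(\<Sum>j\<in>UNIV. (\<Sum>i\<in>UNIV. a i x * M $ i $ j) * (R *v w) $ j) = (\<Sum>i\<in>UNIV. a i x * w $ i)" for w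
      proof -
        have "(\<Sum>j\<in>UNIV. (\<Sum>i\<in>UNIV. a i x * M $ i $ j) * (R *v w) $ j) = (\<Sum>i\<in>UNIV. a i x * (M *v (R *v w)) $ i)"
          unfolding matrix_vector_mult_def[of M] by (simp add: sum_distrib_left sum_distrib_right mult_ac) (rule sum.swap)
        then show ?thesis by (simp add: matrix_vector_mul_assoc MR)
      qed
      then show ?case
        using elim(1) by (simp add: frechet_derivative_vec_nth[OF elim(2)] frechet_derivative_vec_nth[OF dR[OF elim(2)]])
    qed
  qed (rule \<phi>)
  then obtain c \<eta> where c: "smooth_germ c" and \<eta>: "smooth_germ \<eta>"
    and eq: "\<forall>\<^sub>F x in nhds 0. \<phi> x = c x * (jac (\<lambda>x. R *v f x) x)\<^sup>2 + \<eta> (R *v f x)"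
    using dec unfolding ramification_decomposes_def by meson
  have "\<forall>\<^sub>F x in nhds 0. \<phi> x = (c x * (det R)\<^sup>2) * (jac f x)\<^sup>2 + \<eta> (R *v f x)"
    using eq smooth_germ_has_derivative[OF f]
  proof eventually_elim
    case (elim x)
    have "frechet_derivative (\<lambda>x. R *v f x) (at x) = (*v) R \<circ> frechet_derivative f (at x)"
      using frechet_derivative_at[OF dR[OF elim(2)]] by (simp add: o_def)
    then have "jac (\<lambda>x. R *v f x) x = det R * jac f x"
      using matrix_compose[OF has_derivative_linear[OF elim(2)] matrix_vector_mul_linear[of R]]
      by (simp add: jac_def det_mul)
    with elim show ?case by (simp add: power_mult_distrib)
  qed
  moreover have "smooth_germ (\<lambda>x. c x * (det R)\<^sup>2)" by (intro smooth_germ_intros c)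
  moreover have "smooth_germ (\<lambda>y. \<eta> (R *v y))"
    by (rule smooth_germ_compose[OF \<eta>]) (auto intro: smooth_germ_linear)
  ultimately show "\<exists>a \<eta>. smooth_germ a \<and> smooth_germ \<eta> \<and> (\<forall>\<^sub>F x in nhds 0. \<phi> x = a x * (jac f x)\<^sup>2 + \<eta> (f x))"
    by (intro exI[of _ "\<lambda>x. c x * (det R)\<^sup>2"] exI[of _ "\<lambda>y. \<eta> (R *v y)"]) auto
qed

text \<open>The Jacobian is a unit here, so the ideal generated by its square already contains every
  germ.\<close>

lemma ramification_decomposes_regular:
  fixes f :: "real^'n \<Rightarrow> real^'n"
  assumes f: "smooth_germ f" and "jac f 0 \<noteq> 0"
  shows "ramification_decomposes f"
  unfolding ramification_decomposes_def
proof
  fix \<phi> assume "\<phi> \<in> ramification f"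
  then have \<phi>: "smooth_germ \<phi>" by (simp add: ramification_def)
  have J: "smooth_germ (jac f)" by (rule smooth_germ_jac[OF f])
  have "\<forall>\<^sub>F x in nhds 0. jac f x \<noteq> 0"
    using tendsto_imp_eventually_ne[OF smooth_germ_tendsto[OF J] assms(2)] .
  then have "\<forall>\<^sub>F x in nhds 0. \<phi> x = (\<phi> x / (jac f x)\<^sup>2) * (jac f x)\<^sup>2 + 0"
    by (rule eventually_mono) simp
  moreover have "smooth_germ (\<lambda>x. \<phi> x / (jac f x)\<^sup>2)"
    by (intro smooth_germ_divide smooth_germ_power \<phi> J) (simp add: assms)
  ultimately show "\<exists>a \<eta>. smooth_germ a \<and> smooth_germ \<eta> \<and> (\<forall>\<^sub>F x in nhds 0. \<phi> x = a x * (jac f x)\<^sup>2 + \<eta> (f x))"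
    using smooth_germ_const[of 0] by (intro exI[of _ "\<lambda>x. \<phi> x / (jac f x)\<^sup>2"] exI[of _ "\<lambda>x. 0"]) auto
qed

subsection \<open>Maps of corank one\<close>

text \<open>The normal form \<open>(g, y)\<close> of a map of corank at most one. Component
  \<open>k\<close> is overwritten in place, so source and target keep one index type and
  \<open>jac\<close> applies directly.\<close>

definition graph_map :: "'n \<Rightarrow> (real^'n \<Rightarrow> real) \<Rightarrow> real^'n \<Rightarrow> real^'n" where
  "graph_map k g z = upd (axis k 1) z (g z)"

lemma axis_1_in_Basis [simp]: "axis k (1::real) \<in> Basis"
  by (auto simp: Basis_vec_def)

lemma inner_axis_1 [simp]: "z \<bullet> axis k (1::real) = z $ k"
  by (simp add: inner_axis)

lemma upd_axis_nth: "upd (axis k 1) z t $ i = (if i = k then t else z $ i)"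
  by (simp add: upd_def axis_component)

lemma graph_map_nth: "graph_map k g z $ i = (if i = k then g z else z $ i)"
  by (simp add: graph_map_def upd_axis_nth)

lemma graph_map_0: "g 0 = 0 \<Longrightarrow> graph_map k g 0 = 0"
  by (simp add: graph_map_def)

lemma smooth_germ_graph_map: "smooth_germ g \<Longrightarrow> smooth_germ (graph_map k g)"
  unfolding graph_map_def[abs_def] by (intro smooth_germ_upd smooth_germ_ident)

lemma graph_map_has_derivative:
  assumes "(g has_derivative g') (at z)"
  shows "(graph_map k g has_derivative (\<lambda>v. upd (axis k 1) v (g' v))) (at z)"
  unfolding graph_map_def[abs_def] upd_def
  using assms by (auto intro!: derivative_eq_intros simp del: inner_axis_1)

text \<open>The Jacobian matrix is the identity with row \<open>k\<close> replaced by the gradient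
  of \<open>g\<close>; Cramer's lemma evaluates its determinant as the entry \<open>k\<close> of
  that row.\<close>

lemma jac_graph_map:
  assumes "(g has_derivative g') (at z)"
  shows "jac (graph_map k g) z = g' (axis k 1)"
proof -
  have "matrix (\<lambda>v. upd (axis k 1) v (g' v))
      = (\<chi> i. if i = k then (\<Sum>i\<in>UNIV. (\<chi> j. g' (axis j 1)) $ i *s row i (mat 1)) else row i (mat 1))"
    by (simp add: vec_eq_iff matrix_def upd_axis_nth row_def mat_def axis_component if_distrib[where f = "\<lambda>x. _ * x"] cong: if_cong)
  then show ?thesis
    unfolding jac_def frechet_derivative_at[OF graph_map_has_derivative[OF assms], symmetric]
    by (simp only: cramer_lemma_transpose) simp
qed

lemma jac_graph_map_eventually:
  assumes "smooth_germ g"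
  shows "\<forall>\<^sub>F z in nhds 0. jac (graph_map k g) z = pd (axis k 1) g z"
  using smooth_germ_has_derivative[OF assms] by (rule eventually_mono) (rule jac_graph_map)

lemma jac_graph_map_0:
  assumes "smooth_germ g"
  shows "jac (graph_map k g) 0 = pd (axis k 1) g 0"
  using jac_graph_map[OF smooth_germ_has_derivative_0[OF assms]] .

text \<open>Applied to the fibre direction \<open>axis k 1\<close>, the differentials of all
  components other than \<open>k\<close> vanish, since these components are coordinates. Membership
  in the ramification module thus becomes one equation between fibre derivatives.\<close>

lemma ramification_decomposes_graph_mapI:
  assumes g: "smooth_germ g"
    and main: "\<And>\<phi> a. smooth_germ \<phi> \<Longrightarrow> smooth_germ a \<Longrightarrow>
      \<forall>\<^sub>F z in nhds 0. pd (axis k 1) \<phi> z = a z * pd (axis k 1) g z \<Longrightarrow>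
      \<exists>c \<eta>. smooth_germ c \<and> smooth_germ \<eta> \<and>
        (\<forall>\<^sub>F z in nhds 0. \<phi> z = c z * (pd (axis k 1) g z)\<^sup>2 + \<eta> (graph_map k g z))"
  shows "ramification_decomposes (graph_map k g)"
  unfolding ramification_decomposes_def
proof
  fix \<phi> assume "\<phi> \<in> ramification (graph_map k g)"
  then obtain a where \<phi>: "smooth_germ \<phi>" and a: "\<And>i. smooth_germ (a i)"
    and d: "\<forall>\<^sub>F x in nhds 0. (\<phi> has_derivative
      (\<lambda>v. \<Sum>i\<in>UNIV. a i x * frechet_derivative (\<lambda>y. graph_map k g y $ i) (at x) v)) (at x)"
    unfolding ramification_def by blast
  have "\<forall>\<^sub>F z in nhds 0. pd (axis k 1) \<phi> z = a k z * pd (axis k 1) g z"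
    using d smooth_germ_has_derivative[OF g]
  proof eventually_elim
    case (elim z)
    have "pd (axis k 1) \<phi> z = (\<Sum>i\<in>UNIV. a i z * upd (axis k 1) (axis k 1) (pd (axis k 1) g z) $ i)"
      using pd_eqI[OF elim(1)] by (simp add: frechet_derivative_vec_nth[OF graph_map_has_derivative[OF elim(2)]])
    also have "\<dots> = (\<Sum>i\<in>UNIV. if i = k then a k z * pd (axis k 1) g z else 0)"
      by (rule sum.cong) (auto simp: upd_axis_nth axis_component)
    finally show ?case by simp
  qed
  from main[OF \<phi> a this] obtain c \<eta> where c: "smooth_germ c" and \<eta>: "smooth_germ \<eta>"
    and eq: "\<forall>\<^sub>F z in nhds 0. \<phi> z = c z * (pd (axis k 1) g z)\<^sup>2 + \<eta> (graph_map k g z)" by blast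
  have "\<forall>\<^sub>F z in nhds 0. \<phi> z = c z * (jac (graph_map k g) z)\<^sup>2 + \<eta> (graph_map k g z)"
    using eq jac_graph_map_eventually[OF g, of k] by eventually_elim simp
  then show "\<exists>a \<eta>. smooth_germ a \<and> smooth_germ \<eta> \<and>
      (\<forall>\<^sub>F z in nhds 0. \<phi> z = a z * (jac (graph_map k g) z)\<^sup>2 + \<eta> (graph_map k g z))"
    using c \<eta> by blast
qed

lemma frechet_derivative_cong_nhds:
  assumes "\<forall>\<^sub>F y in nhds x. f y = g y"
  shows "frechet_derivative f (at x) = frechet_derivative g (at x)"
proof -
  have "\<forall>\<^sub>F y in nhds x. g y = f y" using assms by (rule eventually_mono) simp
  then have "(f has_derivative h) (at x) \<longleftrightarrow> (g has_derivative h) (at x)" for h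
    using has_derivative_transform_nhds assms by blast
  then show ?thesis by (simp add: frechet_derivative_def)
qed

lemma jac_cong_nhds: "\<forall>\<^sub>F y in nhds x. f y = g y \<Longrightarrow> jac f x = jac g x"
  by (simp add: jac_def frechet_derivative_cong_nhds)

lemma ramification_decomposes_cong:
  assumes "\<forall>\<^sub>F x in nhds 0. f x = g x" "ramification_decomposes f"
  shows "ramification_decomposes g"
  unfolding ramification_decomposes_def
proof
  note ev = eventually_nhds_eventually[OF assms(1)]
  fix \<phi> assume "\<phi> \<in> ramification g"
  then obtain a where \<phi>: "smooth_germ \<phi>" and a: "\<And>i. smooth_germ (a i)"
    and d: "\<forall>\<^sub>F x in nhds 0. (\<phi> has_derivative (\<lambda>v. \<Sum>i\<in>UNIV. a i x * frechet_derivative (\<lambda>y. g y $ i) (at x) v)) (at x)"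
    unfolding ramification_def by blast
  have "\<forall>\<^sub>F x in nhds 0. (\<phi> has_derivative (\<lambda>v. \<Sum>i\<in>UNIV. a i x * frechet_derivative (\<lambda>y. f y $ i) (at x) v)) (at x)"
    using d ev
  proof eventually_elim
    case (elim x)
    have "frechet_derivative (\<lambda>y. f y $ i) (at x) = frechet_derivative (\<lambda>y. g y $ i) (at x)" for i
      by (rule frechet_derivative_cong_nhds) (use elim(2) in \<open>auto elim: eventually_mono\<close>)
    with elim(1) show ?case by simp
  qed
  then have "\<phi> \<in> ramification f" unfolding ramification_def using \<phi> a by blast
  then obtain c \<eta> where c: "smooth_germ c" and \<eta>: "smooth_germ \<eta>"
    and eq: "\<forall>\<^sub>F x in nhds 0. \<phi> x = c x * (jac f x)\<^sup>2 + \<eta> (f x)"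
    using assms(2) unfolding ramification_decomposes_def by meson
  have "\<forall>\<^sub>F x in nhds 0. \<phi> x = c x * (jac g x)\<^sup>2 + \<eta> (g x)"
    using eq ev assms(1) by eventually_elim (simp add: jac_cong_nhds)
  then show "\<exists>a \<eta>. smooth_germ a \<and> smooth_germ \<eta> \<and> (\<forall>\<^sub>F x in nhds 0. \<phi> x = a x * (jac g x)\<^sup>2 + \<eta> (g x))"
    using c \<eta> by blast
qed

section \<open>Hadamard's lemma for germs and coordinate changes along the fibre\<close>

lemma eventually_nhds_0_ball:
  assumes "\<forall>\<^sub>F x in nhds (0::'a::real_normed_vector). P x"
  obtains r where "r > 0" "\<And>x. x \<in> ball 0 r \<Longrightarrow> P x"
  using assms unfolding eventually_nhds_metric by (auto simp: dist_commute)

lemma eventually_ball_nhds_0: "r > 0 \<Longrightarrow> (\<And>x. x \<in> ball 0 r \<Longrightarrow> P x) \<Longrightarrow> \<forall>\<^sub>F x in nhds (0::'a::real_normed_vector). P x"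
  unfolding eventually_nhds_metric by (auto simp: dist_commute)

text \<open>A formula \<open>q\<close> for the fibre derivative, known only as a germ, may be
  inserted under the integral, because on a small ball the whole segment of integration lies where
  it holds.\<close>

lemma hadamard_germ:
  fixes \<phi> q :: "'a::euclidean_space \<Rightarrow> real"
  assumes "b \<in> Basis" "smooth_germ \<phi>" "\<forall>\<^sub>F z in nhds 0. pd b \<phi> z = q z"
  shows "\<forall>\<^sub>F z in nhds 0. \<phi> z = \<phi> (upd b z 0) + (z \<bullet> b) * integral {0..1} (\<lambda>\<tau>. q (upd b z (\<tau> * (z \<bullet> b))))"
proof -
  obtain r1 where r1: "r1 > 0" "smooth_on \<phi> (ball 0 r1)" using assms(2) smooth_germE by metis
  obtain r2 where r2: "r2 > 0" "\<And>z. z \<in> ball 0 r2 \<Longrightarrow> pd b \<phi> z = q z"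
    by (rule eventually_nhds_0_ball[OF assms(3)]) blast
  define r where "r = min r1 r2"
  have r: "r > 0" "smooth_on \<phi> (ball 0 r)" "\<And>z. z \<in> ball 0 r \<Longrightarrow> pd b \<phi> z = q z"
    using r1 r2 smooth_on_subset[OF r1(2)] by (auto simp: r_def subset_ball)
  interpret coord_starlike b "ball 0 r" by (rule coord_starlike_ball[OF assms(1)])
  show ?thesis
  proof (rule eventually_ball_nhds_0[OF r(1)])
    fix z :: 'a assume z: "z \<in> ball 0 r"
    have "integral {0..1} (\<lambda>\<tau>. pd b \<phi> (upd b z (\<tau> * (z \<bullet> b)))) = integral {0..1} (\<lambda>\<tau>. q (upd b z (\<tau> * (z \<bullet> b))))"
      by (rule integral_cong) (rule r(3)[OF star[OF z]])
    with hadamard[OF r(2) z] show "\<phi> z = \<phi> (upd b z 0) + (z \<bullet> b) * integral {0..1} (\<lambda>\<tau>. q (upd b z (\<tau> * (z \<bullet> b))))"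
      by simp
  qed
qed

lemma smooth_on_real_poly: "smooth_on (\<lambda>t::real. t) UNIV" "smooth_on (\<lambda>t::real. c) UNIV"
  "smooth_on (\<lambda>t::real. t\<^sup>2 - 1) UNIV"
proof -
  show 1: "smooth_on (\<lambda>t::real. t) UNIV" by (rule smooth_on_linear) auto
  show 2: "smooth_on (\<lambda>t::real. c) UNIV" for c by (rule smooth_on_const) auto
  from smooth_on_add[OF open_UNIV smooth_on_mult[OF open_UNIV 1 1] 2[of "-1"]]
  show "smooth_on (\<lambda>t::real. t\<^sup>2 - 1) UNIV" by (simp add: power2_eq_square)
qed

lemma pd_mult_linear_at_0:
  assumes "b \<in> Basis" "smooth_germ h"
  shows "pd b (\<lambda>w. (w \<bullet> b) * h w) 0 = h 0"
proof -
  have "((\<lambda>w. (w \<bullet> b) * h w) has_derivative (\<lambda>v. (0 \<bullet> b) * frechet_derivative h (at 0) v + (v \<bullet> b) * h 0)) (at 0)"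
    by (rule has_derivative_mult[OF bounded_linear_imp_has_derivative[OF bounded_linear_inner_left] smooth_germ_has_derivative_0[OF assms(2)]])
  from pd_eqI[OF this] show ?thesis using assms(1) by simp
qed

text \<open>The map \<open>graph_map k u\<close> is a local diffeomorphism, and its inverse
  \<open>\<Lambda>\<close> makes \<open>u\<close> the fibre coordinate. Since
  \<open>\<Lambda>\<close> moves points only along fibres, the normal form \<open>graph_map\<close>
  survives and the chain rule for \<open>pd\<close> has a single factor.\<close>

lemma fibre_coordinate_change:
  fixes u :: "real^'n \<Rightarrow> real"
  assumes u: "smooth_germ u" "u 0 = 0" and nz: "pd (axis k 1) u 0 \<noteq> 0"
  obtains \<Lambda> where "smooth_germ \<Lambda>" "\<Lambda> 0 = 0"
    "\<forall>\<^sub>F w in nhds 0. \<Lambda> w = upd (axis k 1) w (\<Lambda> w $ k)"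
    "\<forall>\<^sub>F w in nhds 0. u (\<Lambda> w) = w $ k"
    "pd (axis k 1) (\<lambda>w. \<Lambda> w $ k) 0 \<noteq> 0"
    "\<And>h. smooth_germ h \<Longrightarrow> \<forall>\<^sub>F w in nhds 0.
       pd (axis k 1) (\<lambda>w. h (\<Lambda> w)) w = pd (axis k 1) h (\<Lambda> w) * pd (axis k 1) (\<lambda>w. \<Lambda> w $ k) w"
    "\<And>g. smooth_germ g \<Longrightarrow> g 0 = 0 \<Longrightarrow> ramification_decomposes (graph_map k (\<lambda>w. g (\<Lambda> w)))
       \<Longrightarrow> ramification_decomposes (graph_map k g)"
proof -
  let ?b = "axis k (1::real)" and ?\<Phi> = "graph_map k u"
  have \<Phi>: "smooth_germ ?\<Phi>" "?\<Phi> 0 = 0" by (simp_all add: smooth_germ_graph_map graph_map_0 u)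
  have "jac ?\<Phi> 0 \<noteq> 0" using nz by (simp add: jac_graph_map_0 u)
  then obtain \<Lambda> where \<Lambda>: "smooth_germ \<Lambda>" "\<Lambda> 0 = 0"
    and inv: "\<forall>\<^sub>F x in nhds 0. \<Lambda> (?\<Phi> x) = x" "\<forall>\<^sub>F y in nhds 0. ?\<Phi> (\<Lambda> y) = y"
    by (rule smooth_inverse_germ[OF \<Phi>])
  have nth: "\<forall>\<^sub>F w in nhds 0. \<forall>i. i \<noteq> k \<longrightarrow> \<Lambda> w $ i = w $ i"
    using inv(2) by (rule eventually_mono) (metis graph_map_nth)
  have uk: "\<forall>\<^sub>F w in nhds 0. u (\<Lambda> w) = w $ k"
    using inv(2) by (rule eventually_mono) (metis graph_map_nth)
  have fib: "\<forall>\<^sub>F w in nhds 0. \<Lambda> w = upd ?b w (\<Lambda> w $ k)"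
    using nth by (rule eventually_mono) (simp add: vec_eq_iff upd_axis_nth)
  have chain: "\<forall>\<^sub>F w in nhds 0. pd ?b (\<lambda>w. h (\<Lambda> w)) w = pd ?b h (\<Lambda> w) * pd ?b (\<lambda>w. \<Lambda> w $ k) w"
    if h: "smooth_germ h" for h :: "real^'n \<Rightarrow> real"
    using smooth_germ_has_derivative[OF \<Lambda>(1)] eventually_germ_compose[OF \<Lambda> smooth_germ_has_derivative[OF h]]
      eventually_nhds_eventually[OF nth]
  proof eventually_elim
    case (elim w)
    have "frechet_derivative \<Lambda> (at w) ?b $ i = 0" if "i \<noteq> k" for i
    proof -
      have "frechet_derivative (\<lambda>w. \<Lambda> w $ i) (at w) = frechet_derivative (\<lambda>w. w $ i) (at w)"
        by (rule frechet_derivative_cong_nhds) (use elim(3) that in \<open>auto elim: eventually_mono\<close>)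
      also have "\<dots> = (\<lambda>w. w $ i)"
        using frechet_derivative_at[OF bounded_linear_imp_has_derivative[OF bounded_linear_vec_nth]] by metis
      finally show ?thesis using that frechet_derivative_vec_nth[OF elim(1), of i ?b] by (simp add: axis_component)
    qed
    then have "frechet_derivative \<Lambda> (at w) ?b = pd ?b (\<lambda>w. \<Lambda> w $ k) w *\<^sub>R ?b"
      by (simp add: vec_eq_iff axis_component frechet_derivative_vec_nth[OF elim(1)])
    then show ?case
      using pd_eqI[OF has_derivative_compose[OF elim(1,2)], of ?b] linear_cmul[OF has_derivative_linear[OF elim(2)]]
      by simp
  qed
  \<comment> \<open>Differentiating \<open>u (\<Lambda> w) = w $ k\<close> along the fibre at 0
    shows that a product of two derivatives is 1, so neither of them vanishes.\<close>
  have "pd ?b (\<lambda>w. u (\<Lambda> w)) 0 = pd ?b (\<lambda>w. w $ k) 0"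
    using frechet_derivative_cong_nhds[OF uk] by simp
  also have "pd ?b (\<lambda>w. w $ k) 0 = 1"
  proof -
    have "((\<lambda>w::real^'n. w $ k) has_derivative (\<lambda>w. w $ k)) (at 0)"
      by (rule bounded_linear_imp_has_derivative[OF bounded_linear_vec_nth])
    from pd_eqI[OF this, of ?b] show ?thesis by (simp add: axis_component)
  qed
  finally have "pd ?b (\<lambda>w. \<Lambda> w $ k) 0 \<noteq> 0"
    using eventually_nhds_x_imp_x[OF chain[OF u(1)]] by auto
  moreover have "ramification_decomposes (graph_map k g)"
    if g: "smooth_germ g" "g 0 = 0" and dec: "ramification_decomposes (graph_map k (\<lambda>w. g (\<Lambda> w)))" for g
  proof -
    have "\<forall>\<^sub>F w in nhds 0. graph_map k (\<lambda>w. g (\<Lambda> w)) w = graph_map k g (\<Lambda> w)"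
      using nth by (rule eventually_mono) (simp add: vec_eq_iff graph_map_nth)
    from ramification_decomposes_cong[OF this dec]
    show ?thesis
      by (rule ramification_decomposes_source_change[OF smooth_germ_graph_map[OF g(1)] graph_map_0[of g, OF g(2)] \<Phi> \<Lambda> inv(1)])
  qed
  ultimately show thesis using \<Lambda> fib uk chain by (intro that)
qed

section \<open>The normal form of fibre order two\<close>

lemma upd_graph_map [simp]: "upd (axis k 1) (graph_map k g z) t = upd (axis k 1) z t"
  by (simp add: graph_map_def)

text \<open>The difference between \<open>\<phi>\<close> and its value at fibre coordinate 0 is the
  square of that coordinate times a smooth germ, while the squared Jacobian is the same square times
  the unit \<open>U^2\<close>. The value at coordinate 0 depends on the parameters alone, hence
  factors through \<open>graph_map k g\<close>.\<close>

lemma ramification_decomposes_fold: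
  assumes g: "smooth_germ g" and U: "smooth_germ U" "U 0 \<noteq> 0"
    and dg: "\<forall>\<^sub>F z in nhds 0. pd (axis k 1) g z = z $ k * U z"
  shows "ramification_decomposes (graph_map k g)"
proof (rule ramification_decomposes_graph_mapI[OF g])
  let ?b = "axis k (1::real)"
  fix \<phi> a assume \<phi>: "smooth_germ \<phi>" and a: "smooth_germ a"
    and d\<phi>: "\<forall>\<^sub>F z in nhds 0. pd ?b \<phi> z = a z * pd ?b g z"
  let ?m = "\<lambda>z. integral {0..1} (\<lambda>\<tau>. \<tau> * (a (upd ?b z (\<tau> * (z \<bullet> ?b))) * U (upd ?b z (\<tau> * (z \<bullet> ?b)))))"
  have m: "smooth_germ ?m"
    by (rule smooth_germ_scale_integral[of ?b "\<lambda>z. a z * U z" "\<lambda>t. t"]) (auto intro: smooth_on_real_poly smooth_germ_mult a U)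
  have "\<forall>\<^sub>F z in nhds 0. pd ?b \<phi> z = (z $ k) * (a z * U z)"
    using d\<phi> dg by eventually_elim simp
  from hadamard_germ[OF _ \<phi> this]
  \<comment> \<open>Besides the factor from Hadamard's lemma, the integrand carries
    \<open>\<tau> * z $ k\<close> from the Jacobian, so a second factor \<open>z $ k\<close> leaves
    the integral.\<close>
  have had: "\<forall>\<^sub>F z in nhds 0. \<phi> z = \<phi> (upd ?b z 0) + z $ k * integral {0..1} (\<lambda>\<tau>. z $ k * (\<tau> * (a (upd ?b z (\<tau> * (z \<bullet> ?b))) * U (upd ?b z (\<tau> * (z \<bullet> ?b))))))"
    by (simp add: upd_axis_nth mult_ac)
  have Unz: "\<forall>\<^sub>F z in nhds 0. U z \<noteq> 0"
    by (rule tendsto_imp_eventually_ne[OF smooth_germ_tendsto[OF U(1)] U(2)])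
  have "\<forall>\<^sub>F z in nhds 0. \<phi> z = (?m z / (U z)\<^sup>2) * (pd ?b g z)\<^sup>2 + \<phi> (upd ?b (graph_map k g z) 0)"
    using had Unz dg by eventually_elim (simp add: power2_eq_square)
  moreover have "smooth_germ (\<lambda>z. ?m z / (U z)\<^sup>2)"
    by (intro smooth_germ_divide m smooth_germ_power U) (simp add: U)
  moreover have "smooth_germ (\<lambda>w. \<phi> (upd ?b w 0))"
    by (rule smooth_germ_compose[OF \<phi>]) (auto intro: smooth_germ_ident smooth_germ_const)
  ultimately show "\<exists>c \<eta>. smooth_germ c \<and> smooth_germ \<eta> \<and>
      (\<forall>\<^sub>F z in nhds 0. \<phi> z = c z * (pd ?b g z)\<^sup>2 + \<eta> (graph_map k g z))"
    by (intro exI conjI)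
qed

section \<open>The normal form of fibre order three\<close>

lemma even_odd_split:
  fixes V :: "'a::euclidean_space \<Rightarrow> real"
  assumes b: "b \<in> Basis" and V: "smooth_germ V"
  obtains V0 V1 where "smooth_germ V0" "smooth_germ V1"
    "\<forall>\<^sub>F z in nhds 0. V z = V0 (upd b z ((z \<bullet> b)\<^sup>2)) + (z \<bullet> b) * V1 (upd b z ((z \<bullet> b)\<^sup>2))"
proof -
  let ?\<rho> = "\<lambda>z. upd b z (- (z \<bullet> b))"
  have \<rho>: "smooth_germ ?\<rho>" "?\<rho> 0 = 0" by (auto intro!: smooth_germ_intros)
  have V\<rho>: "smooth_germ (\<lambda>z. V (?\<rho> z))" by (rule smooth_germ_compose[OF V \<rho>])
  define Ve where "Ve z = 1/2 * (V z + V (?\<rho> z))" for z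
  define Vo where "Vo z = 1/2 * (V z - V (?\<rho> z))" for z
  \<comment> \<open>The quotient of the odd part by the coordinate. It is even, so Whitney's theorem
    applies to it as well as to the even part.\<close>
  define H where "H z = integral {0..1} (\<lambda>\<tau>. 1 * pd b Vo (upd b z (\<tau> * (z \<bullet> b))))" for z
  have Ve: "smooth_germ Ve" unfolding Ve_def by (intro smooth_germ_intros V V\<rho>)
  have Vo: "smooth_germ Vo" unfolding Vo_def by (intro smooth_germ_intros V V\<rho>)
  have H: "smooth_germ H" unfolding H_def
    by (rule smooth_germ_scale_integral[OF b smooth_germ_frechet_derivative[OF Vo] smooth_on_real_poly(2)])
  have "Vo (upd b z 0) = 0" for z by (simp add: Vo_def b)
  then have VoH: "\<forall>\<^sub>F z in nhds 0. Vo z = (z \<bullet> b) * H z"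
    using hadamard_germ[OF b Vo, of "pd b Vo"] by (simp add: H_def)
  have Hev: "\<forall>\<^sub>F z in nhds 0. H (?\<rho> z) = H z"
    using VoH eventually_germ_compose[OF \<rho> VoH]
  proof eventually_elim
    case (elim z)
    show ?case
    proof (cases "z \<bullet> b = 0")
      case True
      then show ?thesis using upd_same[of b z] by simp
    next
      case False
      have "Vo (?\<rho> z) = - Vo z" by (simp add: Vo_def b field_simps)
      then have "- (z \<bullet> b) * H (?\<rho> z) = - ((z \<bullet> b) * H z)" using elim b by simp
      then show ?thesis using False by simp
    qed
  qed
  have "\<forall>\<^sub>F z in nhds 0. Ve (?\<rho> z) = Ve z" by (simp add: Ve_def b add.commute)
  from even_germ_function_of_square[OF b Ve this]
  obtain V0 where V0: "smooth_germ V0" "\<forall>\<^sub>F z in nhds 0. Ve z = V0 (upd b z ((z \<bullet> b)\<^sup>2))" .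
  from even_germ_function_of_square[OF b H Hev]
  obtain V1 where V1: "smooth_germ V1" "\<forall>\<^sub>F z in nhds 0. H z = V1 (upd b z ((z \<bullet> b)\<^sup>2))" .
  have "\<forall>\<^sub>F z in nhds 0. V z = V0 (upd b z ((z \<bullet> b)\<^sup>2)) + (z \<bullet> b) * V1 (upd b z ((z \<bullet> b)\<^sup>2))"
    using V0(2) V1(2) VoH
  proof eventually_elim
    case (elim z)
    have "V z = Ve z + Vo z" by (simp add: Ve_def Vo_def field_simps)
    with elim show ?case by simp
  qed
  with V0(1) V1(1) show thesis by (rule that)
qed

text \<open>The primitive of \<open>k\<close> along the fibre that vanishes at coordinate 0, with
  the integral rescaled to the fixed interval \<open>{0..1}\<close> so that it depends smoothly on
  \<open>z\<close>.\<close>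

definition fibre_primitive :: "'a::euclidean_space \<Rightarrow> ('a \<Rightarrow> real) \<Rightarrow> 'a \<Rightarrow> real" where
  "fibre_primitive b k z = (z \<bullet> b) * integral {0..1} (\<lambda>\<tau>. k (upd b z (\<tau> * (z \<bullet> b))))"

lemma smooth_germ_fibre_primitive:
  assumes "b \<in> Basis" "smooth_germ k"
  shows "smooth_germ (fibre_primitive b k)"
  using smooth_germ_mult[OF smooth_germ_inner smooth_germ_scale_integral[OF assms smooth_on_real_poly(2)[of 1]]]
  by (simp add: fibre_primitive_def[abs_def])

lemma pd_fibre_primitive:
  assumes "b \<in> Basis" "smooth_germ k"
  shows "\<forall>\<^sub>F z in nhds 0. pd b (fibre_primitive b k) z = k z"
proof -
  obtain r where r: "r > 0" "smooth_on k (ball 0 r)" using assms smooth_germE by metis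
  show ?thesis
    by (rule eventually_ball_nhds_0[OF r(1)], unfold fibre_primitive_def[abs_def])
      (rule coord_starlike.pd_primitive[OF coord_starlike_ball[OF assms(1)] r(2)])
qed

text \<open>Off the hyperplane the coordinate cancels; on it, the derivative along \<open>b\<close>
  of the vanishing product is \<open>j z\<close>.\<close>

lemma germ_eq_0_if_mult_coordinate:
  fixes j :: "'a::euclidean_space \<Rightarrow> real"
  assumes "b \<in> Basis" "smooth_germ j" "\<forall>\<^sub>F z in nhds 0. (z \<bullet> b) * j z = 0"
  shows "\<forall>\<^sub>F z in nhds 0. j z = 0"
  using assms(3) eventually_nhds_eventually[OF assms(3)] smooth_germ_has_derivative[OF assms(2)]
proof eventually_elim
  case (elim z)
  show ?case
  proof (cases "z \<bullet> b = 0")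
    case True
    have "((\<lambda>z. (z \<bullet> b) * j z) has_derivative (\<lambda>v. (z \<bullet> b) * frechet_derivative j (at z) v + (v \<bullet> b) * j z)) (at z)"
      by (rule has_derivative_mult[OF bounded_linear_imp_has_derivative[OF bounded_linear_inner_left] elim(3)])
    then have "((\<lambda>z. 0) has_derivative (\<lambda>v. (z \<bullet> b) * frechet_derivative j (at z) v + (v \<bullet> b) * j z)) (at z)"
      by (rule has_derivative_transform_nhds) (rule elim(2))
    from pd_eqI[OF this, of b] show ?thesis
      using assms(1) True by (simp add: frechet_derivative_const)
  qed (use elim in simp)
qed

lemma fibre_basis:
  fixes b :: "'a::euclidean_space"
  assumes "b \<in> Basis"
  shows "(b, 0::real) \<in> Basis" "(0::'a, 1::real) \<in> Basis"
  using assms by (auto simp: Basis_prod_def)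

lemma inner_fibre: "x \<bullet> (b, 0::real) = fst x \<bullet> b" "x \<bullet> (0, 1::real) = snd x"
  by (simp_all add: inner_prod_def)

lemma upd_fibre: "upd (b, 0::real) x t = (upd b (fst x) t, snd x)" "upd (0, 1::real) x t = (fst x, t)"
  by (simp_all add: upd_def inner_fibre prod_eq_iff)

lemma smooth_germ_fst: "smooth_germ fst" and smooth_germ_snd: "smooth_germ snd"
  by (auto intro!: smooth_germ_linear bounded_linear_fst bounded_linear_snd)

text \<open>The first division uses vanishing on the parabola \<open>s = t\<^sup>2\<close>; differentiating the quotient
  along the fibre then shows that the quotient vanishes on the parabola as well.\<close>
lemma double_division:
  fixes E :: "'a::euclidean_space \<times> real \<Rightarrow> real"
  assumes b: "b \<in> Basis" and E: "smooth_germ E"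
    and E0: "\<forall>\<^sub>F z in nhds 0. E (z, (z \<bullet> b)\<^sup>2) = 0"
    and dE: "\<forall>\<^sub>F x in nhds 0. pd (b, 0) E x = ((fst x \<bullet> b)\<^sup>2 - snd x) * c x"
  obtains E2 where "smooth_germ E2" "\<forall>\<^sub>F x in nhds 0. E x = ((fst x \<bullet> b)\<^sup>2 - snd x)\<^sup>2 * E2 x"
proof -
  let ?S = "(0::'a, 1::real)" and ?B = "(b, 0::real)"
  \<comment> \<open>A shear that straightens the parabola to the hyperplane where the second
    coordinate is 0, so that division by \<open>s - t^2\<close> becomes Hadamard's lemma.\<close>
  define T where "T x = (fst x, (fst x \<bullet> b)\<^sup>2 + snd x)" for x :: "'a \<times> real"
  define T' where "T' x = (fst x, snd x - (fst x \<bullet> b)\<^sup>2)" for x :: "'a \<times> real"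
  have T: "smooth_germ T" "T 0 = 0" and T': "smooth_germ T'" "T' 0 = 0"
    unfolding T_def T'_def by (auto intro!: smooth_germ_intros smooth_germ_fst smooth_germ_snd simp: prod_eq_iff)
  have TT' [simp]: "T (T' x) = x" for x by (simp add: T_def T'_def)
  have S: "?S \<in> Basis" by (rule fibre_basis[OF b])
  define E' where "E' x = E (T x)" for x
  have E': "smooth_germ E'" unfolding E'_def by (rule smooth_germ_compose[OF E T])
  define H where "H x = integral {0..1} (\<lambda>\<tau>. 1 * pd ?S E' (upd ?S x (\<tau> * (x \<bullet> ?S))))" for x
  have H: "smooth_germ H" unfolding H_def
    by (rule smooth_germ_scale_integral[OF S smooth_germ_frechet_derivative[OF E'] smooth_on_real_poly(2)])
  have "\<forall>\<^sub>F x in nhds (0::'a \<times> real). E (fst x, (fst x \<bullet> b)\<^sup>2) = 0"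
    using eventually_germ_compose[OF smooth_germ_fst _ E0] by simp
  then have E'H: "\<forall>\<^sub>F x in nhds 0. E' x = snd x * H x"
    using hadamard_germ[OF S E', of "pd ?S E'", OF always_eventually[OF allI, OF refl]]
    by eventually_elim (simp add: H_def inner_fibre upd_fibre E'_def T_def)
  define h where "h x = H (T' x)" for x
  have h: "smooth_germ h" unfolding h_def by (rule smooth_germ_compose[OF H T'])
  have Eh: "\<forall>\<^sub>F x in nhds 0. E x = (snd x - (fst x \<bullet> b)\<^sup>2) * h x"
    using eventually_germ_compose[OF T' E'H] by (rule eventually_mono) (simp add: E'_def h_def, simp add: T'_def)
  define i where "i z = (z, (z \<bullet> b)\<^sup>2)" for z
  have i: "smooth_germ i" "i 0 = 0" unfolding i_def by (auto intro!: smooth_germ_intros simp: prod_eq_iff)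
  have "\<forall>\<^sub>F z in nhds 0. (z \<bullet> b) * h (i z) = 0"
    using eventually_germ_compose[OF i eventually_nhds_eventually[OF Eh]] eventually_germ_compose[OF i dE]
      eventually_germ_compose[OF i smooth_germ_has_derivative[OF h]]
  proof eventually_elim
    case (elim z)
    \<comment> \<open>On the parabola the fibre derivative of \<open>(s - t^2) * h\<close> reduces
      to \<open>- 2 * t * h\<close>, whereas \<open>dE\<close> gives the value 0 there.\<close>
    have "((\<lambda>x. (snd x - (fst x \<bullet> b)\<^sup>2) * h x) has_derivative
       (\<lambda>v. (snd (i z) - (fst (i z) \<bullet> b)\<^sup>2) * frechet_derivative h (at (i z)) v
          + (snd v - 2 * (fst (i z) \<bullet> b) * (fst v \<bullet> b)) * h (i z))) (at (i z))"
      by (rule has_derivative_mult[OF _ elim(3)]) (auto intro!: derivative_eq_intros)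
    then have "(E has_derivative
       (\<lambda>v. (snd (i z) - (fst (i z) \<bullet> b)\<^sup>2) * frechet_derivative h (at (i z)) v
          + (snd v - 2 * (fst (i z) \<bullet> b) * (fst v \<bullet> b)) * h (i z))) (at (i z))"
      by (rule has_derivative_transform_nhds) (use elim(1) in \<open>auto elim: eventually_mono\<close>)
    from pd_eqI[OF this, of ?B] elim(2) b show ?case by (simp add: i_def)
  qed
  then have "\<forall>\<^sub>F z in nhds 0. h (i z) = 0"
    by (rule germ_eq_0_if_mult_coordinate[OF b smooth_germ_compose[OF h i]])
  then have "\<forall>\<^sub>F x in nhds (0::'a \<times> real). h (i (fst x)) = 0"
    using eventually_germ_compose[OF smooth_germ_fst] by fastforce
  then have H0: "\<forall>\<^sub>F x in nhds 0. H (upd ?S x 0) = 0"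
    by (simp add: h_def i_def T'_def upd_fibre)
  define H2 where "H2 x = integral {0..1} (\<lambda>\<tau>. 1 * pd ?S H (upd ?S x (\<tau> * (x \<bullet> ?S))))" for x
  have H2: "smooth_germ H2" unfolding H2_def
    by (rule smooth_germ_scale_integral[OF S smooth_germ_frechet_derivative[OF H] smooth_on_real_poly(2)])
  have HH2: "\<forall>\<^sub>F x in nhds 0. H x = snd x * H2 x"
    using H0 hadamard_germ[OF S H, of "pd ?S H", OF always_eventually[OF allI, OF refl]]
    by eventually_elim (simp add: H2_def inner_fibre)
  have "\<forall>\<^sub>F x in nhds 0. E x = ((fst x \<bullet> b)\<^sup>2 - snd x)\<^sup>2 * H2 (T' x)"
    using Eh eventually_germ_compose[OF T' HH2]
  proof eventually_elim
    case (elim x)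
    then have "E x = (snd x - (fst x \<bullet> b)\<^sup>2) * ((snd x - (fst x \<bullet> b)\<^sup>2) * H2 (T' x))"
      by (simp add: h_def) (simp add: T'_def)
    then show ?case by (simp add: power2_eq_square algebra_simps)
  qed
  moreover have "smooth_germ (\<lambda>x. H2 (T' x))" by (rule smooth_germ_compose[OF H2 T'])
  ultimately show thesis using that by blast
qed

lemma integral_square_minus_1: "integral {0..1} (\<lambda>\<tau>::real. \<tau>\<^sup>2 - 1) = - 2/3"
proof -
  have "((\<lambda>\<tau>::real. \<tau>\<^sup>2 - 1) has_integral ((1 ^ 3 / 3 - 1) - (0 ^ 3 / 3 - 0))) {0..1}"
  proof (rule fundamental_theorem_of_calculus)
    fix \<tau> :: real
    have "((\<lambda>\<tau>. \<tau> ^ 3 / 3 - \<tau>) has_real_derivative \<tau>\<^sup>2 - 1) (at \<tau>)"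
      by (auto intro!: derivative_eq_intros)
    then show "((\<lambda>\<tau>. \<tau> ^ 3 / 3 - \<tau>) has_vector_derivative \<tau>\<^sup>2 - 1) (at \<tau> within {0..1})"
      unfolding has_real_derivative_iff_has_vector_derivative by (rule has_vector_derivative_at_within)
  qed simp
  then show ?thesis by (simp add: integral_unique)
qed

text \<open>The parameter \<open>s\<close> is first treated as an independent variable \<open>snd x\<close>; in this universal family
  the critical set is the parabola \<open>snd x = (fst x \<bullet> b)\<^sup>2\<close> and equality there suffices.\<close>
lemma universal_cusp_division:
  fixes U K :: "'a::euclidean_space \<Rightarrow> real"
  assumes b: "b \<in> Basis" and U: "smooth_germ U" "U 0 \<noteq> 0" and K: "smooth_germ K"
  obtains E2 q r where "smooth_germ E2" "smooth_germ q" "smooth_germ r"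
    "\<And>x t. q (upd (b, 0) x t) = q x" "\<And>x t. r (upd (b, 0) x t) = r x"
    "\<forall>\<^sub>F x in nhds 0. fibre_primitive (b, 0) (\<lambda>x. ((fst x \<bullet> b)\<^sup>2 - snd x) * K (fst x)) x
       = q x * fibre_primitive (b, 0) (\<lambda>x. ((fst x \<bullet> b)\<^sup>2 - snd x) * U (fst x)) x + r x
         + ((fst x \<bullet> b)\<^sup>2 - snd x)\<^sup>2 * E2 x"
proof -
  let ?B = "(b, 0::real)"
  let ?k = "\<lambda>\<kappa> x. ((fst x \<bullet> b)\<^sup>2 - snd x) * \<kappa> (fst x)"
  \<comment> \<open>At \<open>s = t^2\<close> the weight of the integrand at the point
    \<open>\<tau> * t\<close> is \<open>t^2 * (\<tau>^2 - 1)\<close>. Together with the outer factor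
    \<open>t\<close> of the primitive this leaves \<open>t^3 * V\<close>.\<close>
  define V where "V \<kappa> z = integral {0..1} (\<lambda>\<tau>. (\<tau>\<^sup>2 - 1) * \<kappa> (upd b z (\<tau> * (z \<bullet> b))))" for \<kappa> :: "'a \<Rightarrow> real" and z
  have V: "smooth_germ (V \<kappa>)" if "smooth_germ \<kappa>" for \<kappa>
    unfolding V_def by (rule smooth_germ_scale_integral[OF b that smooth_on_real_poly(3)])
  obtain U0 U1 where U01: "smooth_germ U0" "smooth_germ U1"
    "\<forall>\<^sub>F z in nhds 0. V U z = U0 (upd b z ((z \<bullet> b)\<^sup>2)) + (z \<bullet> b) * U1 (upd b z ((z \<bullet> b)\<^sup>2))"
    by (rule even_odd_split[OF b V[OF U(1)]])
  obtain W0 W1 where W01: "smooth_germ W0" "smooth_germ W1"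
    "\<forall>\<^sub>F z in nhds 0. V K z = W0 (upd b z ((z \<bullet> b)\<^sup>2)) + (z \<bullet> b) * W1 (upd b z ((z \<bullet> b)\<^sup>2))"
    by (rule even_odd_split[OF b V[OF K(1)]])
  \<comment> \<open>At 0 the integrand is \<open>(\<tau>^2 - 1) * U 0\<close>, whence the factor
    \<open>-2/3\<close>. It follows that the even part \<open>U0\<close> is a unit and may be
    divided by.\<close>
  have "V U 0 = - 2/3 * U 0" by (simp add: V_def integral_square_minus_1)
  then have U0: "U0 0 \<noteq> 0" using eventually_nhds_x_imp_x[OF U01(3)] U(2) by simp
  \<comment> \<open>Puts \<open>s\<close> in the place of the fibre coordinate: an expression in
    \<open>t^2\<close> and the parameters becomes one in \<open>s\<close> and the parameters,
    independent of \<open>t\<close>.\<close>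
  define p where "p x = upd b (fst x) (snd x)" for x :: "'a \<times> real"
  have p: "smooth_germ p" "p 0 = 0" unfolding p_def by (auto intro!: smooth_germ_upd smooth_germ_fst smooth_germ_snd)
  have pB: "p (upd ?B x t) = p x" for x t by (simp add: p_def upd_fibre b)
  \<comment> \<open>\<open>q\<close> matches the even parts on the parabola; the odd parts then
    leave \<open>t^4 * (W1 - U1 * q)\<close>, and \<open>t^4\<close> is rewritten as
    \<open>s^2\<close> in \<open>r\<close>.\<close>
  define q where "q x = W0 (p x) / U0 (p x)" for x
  define r where "r x = (snd x)\<^sup>2 * (W1 (p x) - U1 (p x) * q x)" for x
  have q: "smooth_germ q" unfolding q_def
    by (intro smooth_germ_divide smooth_germ_compose[OF W01(1) p] smooth_germ_compose[OF U01(1) p]) (simp add: U0 p)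
  have r: "smooth_germ r" unfolding r_def
    by (intro smooth_germ_intros q smooth_germ_snd smooth_germ_compose[OF W01(2) p] smooth_germ_compose[OF U01(2) p])
  have qB: "q (upd ?B x t) = q x" for x t by (simp add: q_def pB)
  have rB: "r (upd ?B x t) = r x" for x t by (simp add: r_def pB qB) (simp add: upd_fibre)
  have zero: "pd ?B h x = 0" if "(h has_derivative h') (at x)" and "\<And>t. h (upd ?B x t) = h x" for h h' x
  proof -
    have "(h has_derivative frechet_derivative h (at x)) (at (upd ?B x (x \<bullet> ?B)))"
      using that(1) frechet_derivative_at[OF that(1)] by (simp only: upd_same)
    then have "((\<lambda>t. h (upd ?B x t)) has_real_derivative pd ?B h x) (at (x \<bullet> ?B))"
      by (rule upd_has_real_derivative[OF fibre_basis(1)[OF b]])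
    then show ?thesis using that(2) DERIV_unique[OF _ DERIV_const] by simp
  qed
  let ?P = "\<lambda>\<kappa>. fibre_primitive ?B (?k \<kappa>)"
  have k: "smooth_germ (?k \<kappa>)" if "smooth_germ \<kappa>" for \<kappa>
    by (intro smooth_germ_intros smooth_germ_fst smooth_germ_snd smooth_germ_compose[OF that]) simp
  note P = smooth_germ_fibre_primitive[OF fibre_basis(1)[OF b] k]
  define E where "E x = ?P K x - (q x * ?P U x + r x)" for x
  have E: "smooth_germ E" unfolding E_def by (intro smooth_germ_intros P U K q r)
  \<comment> \<open>Since \<open>q\<close> and \<open>r\<close> do not depend on the fibre
    coordinate, only the two primitives are differentiated, and both derivatives contain the factor
    \<open>t^2 - s\<close>.\<close>
  have dE: "\<forall>\<^sub>F x in nhds 0. pd ?B E x = ((fst x \<bullet> b)\<^sup>2 - snd x) * (K (fst x) - q x * U (fst x))"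
    using pd_fibre_primitive[OF fibre_basis(1)[OF b] k[OF K]] pd_fibre_primitive[OF fibre_basis(1)[OF b] k[OF U(1)]]
      smooth_germ_has_derivative[OF q] smooth_germ_has_derivative[OF r]
      smooth_germ_has_derivative[OF P[OF K]] smooth_germ_has_derivative[OF P[OF U(1)]]
  proof eventually_elim
    case (elim x)
    have "pd ?B E x = pd ?B (?P K) x - (q x * pd ?B (?P U) x + pd ?B q x * ?P U x + pd ?B r x)"
      unfolding E_def[abs_def]
      by (rule pd_eqI[OF has_derivative_diff[OF elim(5) has_derivative_add[OF has_derivative_mult[OF elim(3,6)] elim(4)]]])
    then show ?case
      unfolding zero[OF elim(3) qB] zero[OF elim(4) rB] elim(1,2) by (simp add: algebra_simps)
  qed
  have PV: "?P \<kappa> (z, (z \<bullet> b)\<^sup>2) = (z \<bullet> b) ^ 3 * V \<kappa> z" for \<kappa> z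
  proof -
    have "?P \<kappa> (z, (z \<bullet> b)\<^sup>2) = (z \<bullet> b) * integral {0..1} (\<lambda>\<tau>. (z \<bullet> b)\<^sup>2 * ((\<tau>\<^sup>2 - 1) * \<kappa> (upd b z (\<tau> * (z \<bullet> b)))))"
      by (simp add: fibre_primitive_def inner_fibre upd_fibre b power_mult_distrib algebra_simps)
    then show ?thesis by (simp add: V_def power3_eq_cube power2_eq_square)
  qed
  define i where "i z = (z, (z \<bullet> b)\<^sup>2)" for z
  have i: "smooth_germ i" "i 0 = 0" unfolding i_def by (auto intro!: smooth_germ_intros simp: prod_eq_iff)
  have nz: "\<forall>\<^sub>F z in nhds 0. U0 (p (i z)) \<noteq> 0"
  proof -
    have "smooth_germ (\<lambda>z. U0 (p (i z)))"
      by (rule smooth_germ_compose[OF smooth_germ_compose[OF U01(1) p] i])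
    from tendsto_imp_eventually_ne[OF smooth_germ_tendsto[OF this], of 0] show ?thesis by (simp add: i p U0)
  qed
  have "\<forall>\<^sub>F z in nhds 0. E (z, (z \<bullet> b)\<^sup>2) = 0"
    using U01(3) W01(3) nz
  proof eventually_elim
    case (elim z)
    let ?u0 = "U0 (upd b z ((z \<bullet> b)\<^sup>2))" and ?u1 = "U1 (upd b z ((z \<bullet> b)\<^sup>2))"
      and ?w0 = "W0 (upd b z ((z \<bullet> b)\<^sup>2))" and ?w1 = "W1 (upd b z ((z \<bullet> b)\<^sup>2))" and ?t = "z \<bullet> b"
    have nz: "?u0 \<noteq> 0" using elim(3) by (simp add: p_def i_def)
    have "E (z, ?t\<^sup>2) = ?t ^ 3 * (?w0 + ?t * ?w1) - (?w0 / ?u0 * (?t ^ 3 * (?u0 + ?t * ?u1)) + (?t\<^sup>2)\<^sup>2 * (?w1 - ?u1 * (?w0 / ?u0)))"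
      unfolding E_def PV elim(1,2) by (simp add: q_def r_def p_def)
    also have "\<dots> = 0" using nz by (simp add: field_simps power3_eq_cube power2_eq_square)
    finally show ?case .
  qed
  from double_division[OF b E this dE] obtain E2 where E2: "smooth_germ E2"
    "\<forall>\<^sub>F x in nhds 0. E x = ((fst x \<bullet> b)\<^sup>2 - snd x)\<^sup>2 * E2 x" .
  have "\<forall>\<^sub>F x in nhds 0. ?P K x = q x * ?P U x + r x + ((fst x \<bullet> b)\<^sup>2 - snd x)\<^sup>2 * E2 x"
    using E2(2) by (rule eventually_mono) (simp add: E_def)
  then show thesis using that[OF E2(1) q r qB rB] by blast
qed

text \<open>Because \<open>s\<close> is constant along the fibre, substituting \<open>s z\<close>
  for the independent variable commutes with integration along the fibre.\<close>

lemma fibre_primitive_restrict: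
  fixes s \<kappa> :: "'a::euclidean_space \<Rightarrow> real"
  assumes "b \<in> Basis" "\<And>z t. s (upd b z t) = s z"
  shows "fibre_primitive (b, 0) (\<lambda>x. ((fst x \<bullet> b)\<^sup>2 - snd x) * \<kappa> (fst x)) (z, s z)
    = fibre_primitive b (\<lambda>z. ((z \<bullet> b)\<^sup>2 - s z) * \<kappa> z) z"
  by (simp add: fibre_primitive_def inner_fibre upd_fibre assms)

text \<open>The universal division is pulled back along \<open>z \<mapsto> (z, s z)\<close>. There
  \<open>(t^2 - s)^2\<close> becomes the squared Jacobian divided by \<open>U^2\<close>, and
  \<open>q\<close> and \<open>r\<close> become functions of the parameters alone.\<close>

lemma ramification_decomposes_cusp:
  fixes g s U :: "real^'n \<Rightarrow> real"
  assumes g: "smooth_germ g" and U: "smooth_germ U" "U 0 \<noteq> 0"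
    and s: "smooth_germ s" "s 0 = 0" "\<And>z t. s (upd (axis k 1) z t) = s z"
    and dg: "\<forall>\<^sub>F z in nhds 0. pd (axis k 1) g z = ((z $ k)\<^sup>2 - s z) * U z"
  shows "ramification_decomposes (graph_map k g)"
proof (rule ramification_decomposes_graph_mapI[OF g])
  let ?b = "axis k (1::real)"
  fix \<phi> a assume \<phi>: "smooth_germ \<phi>" and a: "smooth_germ a"
    and d\<phi>: "\<forall>\<^sub>F z in nhds 0. pd ?b \<phi> z = a z * pd ?b g z"
  define K where "K z = a z * U z" for z
  have K: "smooth_germ K" unfolding K_def by (intro smooth_germ_mult a U)
  obtain E2 q r where E2: "smooth_germ E2" and q: "smooth_germ q" and r: "smooth_germ r"
    and qB: "\<And>x t. q (upd (?b, 0) x t) = q x" and rB: "\<And>x t. r (upd (?b, 0) x t) = r x"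
    and eq: "\<forall>\<^sub>F x in nhds 0. fibre_primitive (?b, 0) (\<lambda>x. ((fst x \<bullet> ?b)\<^sup>2 - snd x) * K (fst x)) x
       = q x * fibre_primitive (?b, 0) (\<lambda>x. ((fst x \<bullet> ?b)\<^sup>2 - snd x) * U (fst x)) x + r x
         + ((fst x \<bullet> ?b)\<^sup>2 - snd x)\<^sup>2 * E2 x"
    by (rule universal_cusp_division[OF axis_1_in_Basis U K]) blast
  define i where "i z = (z, s z)" for z
  have i: "smooth_germ i" "i 0 = 0" unfolding i_def by (auto intro!: smooth_germ_intros s simp: prod_eq_iff s(2))
  have \<phi>P: "\<forall>\<^sub>F z in nhds 0. \<phi> z = \<phi> (upd ?b z 0) + fibre_primitive ?b (\<lambda>z. ((z \<bullet> ?b)\<^sup>2 - s z) * K z) z"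
    unfolding fibre_primitive_def
    by (rule hadamard_germ[OF axis_1_in_Basis \<phi>]) (use d\<phi> dg in \<open>eventually_elim, simp add: K_def\<close>)
  have gP: "\<forall>\<^sub>F z in nhds 0. g z = g (upd ?b z 0) + fibre_primitive ?b (\<lambda>z. ((z \<bullet> ?b)\<^sup>2 - s z) * U z) z"
    unfolding fibre_primitive_def
    by (rule hadamard_germ[OF axis_1_in_Basis g]) (use dg in \<open>eventually_elim, simp\<close>)
  \<comment> \<open>The primitive of the Jacobian is \<open>g\<close> minus its value at fibre
    coordinate 0, and \<open>w $ k\<close> stands for the value of \<open>g\<close> in the
    target.\<close>
  define \<eta> where "\<eta> w = \<phi> (upd ?b w 0) + (w $ k - g (upd ?b w 0)) * q (i w) + r (i w)" for w
  have iu: "i (graph_map k g z) = upd (?b, 0) (i z) (g z)" for z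
    by (simp add: i_def upd_fibre graph_map_def s(3))
  have \<eta>g: "\<eta> (graph_map k g z) = \<phi> (upd ?b z 0) + (g z - g (upd ?b z 0)) * q (i z) + r (i z)" for z
    unfolding \<eta>_def iu qB rB by (simp add: graph_map_nth)
  have upd0: "smooth_germ (\<lambda>w. upd ?b w 0)" "upd ?b 0 0 = 0"
    by (auto intro: smooth_germ_ident smooth_germ_const)
  have "smooth_germ \<eta>" unfolding \<eta>_def
    by (intro smooth_germ_intros smooth_germ_vec_nth smooth_germ_compose[OF \<phi> upd0] smooth_germ_compose[OF g upd0]
        smooth_germ_compose[OF q i] smooth_germ_compose[OF r i])
  moreover have "smooth_germ (\<lambda>z. E2 (i z) / (U z)\<^sup>2)"
    by (intro smooth_germ_divide smooth_germ_power smooth_germ_compose[OF E2 i] U) (simp add: U)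
  moreover have Unz: "\<forall>\<^sub>F z in nhds 0. U z \<noteq> 0"
    by (rule tendsto_imp_eventually_ne[OF smooth_germ_tendsto[OF U(1)] U(2)])
  have "\<forall>\<^sub>F z in nhds 0. \<phi> z = (E2 (i z) / (U z)\<^sup>2) * (pd ?b g z)\<^sup>2 + \<eta> (graph_map k g z)"
    using eventually_germ_compose[OF i eq] \<phi>P gP dg Unz
  proof eventually_elim
    case (elim z)
    let ?PK = "fibre_primitive ?b (\<lambda>z. ((z \<bullet> ?b)\<^sup>2 - s z) * K z) z"
      and ?PU = "fibre_primitive ?b (\<lambda>z. ((z \<bullet> ?b)\<^sup>2 - s z) * U z) z"
    have "?PK = q (i z) * ?PU + r (i z) + ((z $ k)\<^sup>2 - s z)\<^sup>2 * E2 (i z)"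
      using elim(1) fibre_primitive_restrict[OF axis_1_in_Basis s(3), of K z] fibre_primitive_restrict[OF axis_1_in_Basis s(3), of U z]
      by (simp add: i_def)
    then have "\<phi> z = \<eta> (graph_map k g z) + ((z $ k)\<^sup>2 - s z)\<^sup>2 * E2 (i z)"
      unfolding \<eta>g using elim(2,3) by (simp add: mult.commute)
    moreover have "((z $ k)\<^sup>2 - s z)\<^sup>2 * E2 (i z) = (E2 (i z) / (U z)\<^sup>2) * (pd ?b g z)\<^sup>2"
      using elim(4,5) by (simp add: power_mult_distrib)
    ultimately show ?case by simp
  qed
  ultimately show "\<exists>c \<eta>. smooth_germ c \<and> smooth_germ \<eta> \<and>
      (\<forall>\<^sub>F z in nhds 0. \<phi> z = c z * (pd ?b g z)\<^sup>2 + \<eta> (graph_map k g z))"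
    by (intro exI[of _ "\<lambda>z. E2 (i z) / (U z)\<^sup>2"] exI[of _ \<eta>] conjI)
qed

text \<open>The fibre derivative of \<open>g\<close> itself serves as the new fibre coordinate; the
  derivative of the coordinate change is the unit \<open>U\<close>.\<close>

lemma ramification_decomposes_fold_order:
  fixes g :: "real^'n \<Rightarrow> real"
  assumes g: "smooth_germ g" "g 0 = 0" "pd (axis k 1) g 0 = 0" "pd (axis k 1) (pd (axis k 1) g) 0 \<noteq> 0"
  shows "ramification_decomposes (graph_map k g)"
proof -
  let ?b = "axis k (1::real)"
  obtain \<Lambda> where \<Lambda>: "smooth_germ \<Lambda>" "\<Lambda> 0 = 0"
    and u: "\<forall>\<^sub>F w in nhds 0. pd ?b g (\<Lambda> w) = w $ k"
    and nz: "pd ?b (\<lambda>w. \<Lambda> w $ k) 0 \<noteq> 0"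
    and chain: "\<And>h. smooth_germ h \<Longrightarrow> \<forall>\<^sub>F w in nhds 0. pd ?b (\<lambda>w. h (\<Lambda> w)) w = pd ?b h (\<Lambda> w) * pd ?b (\<lambda>w. \<Lambda> w $ k) w"
    and dec: "\<And>g. smooth_germ g \<Longrightarrow> g 0 = 0 \<Longrightarrow> ramification_decomposes (graph_map k (\<lambda>w. g (\<Lambda> w)))
       \<Longrightarrow> ramification_decomposes (graph_map k g)"
    by (rule fibre_coordinate_change[OF smooth_germ_frechet_derivative[OF g(1)] g(3,4)]) blast
  have "\<forall>\<^sub>F w in nhds 0. pd ?b (\<lambda>w. g (\<Lambda> w)) w = w $ k * pd ?b (\<lambda>w. \<Lambda> w $ k) w"
    using chain[OF g(1)] u by eventually_elim simp
  from ramification_decomposes_fold[OF smooth_germ_compose[OF g(1) \<Lambda>] smooth_germ_frechet_derivative[OF smooth_germ_vec_nth[OF \<Lambda>(1)]] nz this]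
  show ?thesis by (rule dec[OF g(1,2)])
qed

text \<open>Two changes of the fibre coordinate. With the second derivative of \<open>g\<close> as
  coordinate, the first derivative \<open>q\<close> loses its linear term in the fibre variable; the
  second change then absorbs the unit in front of the remaining square.\<close>

lemma ramification_decomposes_cusp_order:
  fixes g :: "real^'n \<Rightarrow> real"
  assumes g: "smooth_germ g" "g 0 = 0" "pd (axis k 1) g 0 = 0" "pd (axis k 1) (pd (axis k 1) g) 0 = 0"
    "pd (axis k 1) (pd (axis k 1) (pd (axis k 1) g)) 0 \<noteq> 0"
  shows "ramification_decomposes (graph_map k g)"
proof -
  let ?b = "axis k (1::real)"
  have g': "smooth_germ (pd ?b g)" by (rule smooth_germ_frechet_derivative[OF g(1)])
  obtain \<Lambda> where \<Lambda>: "smooth_germ \<Lambda>" "\<Lambda> 0 = 0"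
    and u: "\<forall>\<^sub>F w in nhds 0. pd ?b (pd ?b g) (\<Lambda> w) = w $ k"
    and nz: "pd ?b (\<lambda>w. \<Lambda> w $ k) 0 \<noteq> 0"
    and chain: "\<And>h. smooth_germ h \<Longrightarrow> \<forall>\<^sub>F w in nhds 0. pd ?b (\<lambda>w. h (\<Lambda> w)) w = pd ?b h (\<Lambda> w) * pd ?b (\<lambda>w. \<Lambda> w $ k) w"
    and dec: "\<And>g. smooth_germ g \<Longrightarrow> g 0 = 0 \<Longrightarrow> ramification_decomposes (graph_map k (\<lambda>w. g (\<Lambda> w)))
       \<Longrightarrow> ramification_decomposes (graph_map k g)"
    by (rule fibre_coordinate_change[OF smooth_germ_frechet_derivative[OF g'] g(4,5)]) blast
  define X where "X = pd ?b (\<lambda>w. \<Lambda> w $ k)"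
  have X: "smooth_germ X" "X 0 \<noteq> 0" unfolding X_def
    by (rule smooth_germ_frechet_derivative[OF smooth_germ_vec_nth[OF \<Lambda>(1)]], rule nz)
  define q where "q w = pd ?b g (\<Lambda> w)" for w
  have q: "smooth_germ q" "q 0 = 0" unfolding q_def using smooth_germ_compose[OF g' \<Lambda>] \<Lambda>(2) g(3) by auto
  \<comment> \<open>The fibre derivative of \<open>q\<close> is \<open>w $ k * X w\<close>, so by
    Hadamard's lemma \<open>q\<close> is its value at coordinate 0 plus
    \<open>(w $ k)^2 * e w\<close>; at 0 the integral gives \<open>e 0 = X 0 / 2\<close>.\<close>
  define e where "e w = integral {0..1} (\<lambda>\<tau>. \<tau> * X (upd ?b w (\<tau> * (w \<bullet> ?b))))" for w
  have e: "smooth_germ e" unfolding e_def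
    by (rule smooth_germ_scale_integral[OF axis_1_in_Basis X(1) smooth_on_real_poly(1)])
  have e0: "e 0 \<noteq> 0"
  proof -
    have "((\<lambda>\<tau>::real. \<tau>) has_integral ((1\<^sup>2 - 0\<^sup>2) / 2)) {0..1}"
      by (rule ident_has_integral) simp
    then have "integral {0..1} (\<lambda>\<tau>::real. \<tau>) = 1/2" by (simp add: integral_unique)
    then show ?thesis using X(2) by (simp add: e_def)
  qed
  have "\<forall>\<^sub>F w in nhds 0. pd ?b q w = w $ k * X w"
    using chain[OF g'] u unfolding q_def X_def by eventually_elim simp
  from hadamard_germ[OF axis_1_in_Basis q(1) this]
  have qe: "\<forall>\<^sub>F w in nhds 0. q w = q (upd ?b w 0) + (w $ k)\<^sup>2 * e w"
  proof (rule eventually_mono)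
    fix w
    assume q: "q w = q (upd ?b w 0) + (w \<bullet> ?b) * integral {0..1} (\<lambda>\<tau>. upd ?b w (\<tau> * (w \<bullet> ?b)) $ k * X (upd ?b w (\<tau> * (w \<bullet> ?b))))"
    have "(\<lambda>\<tau>. upd ?b w (\<tau> * (w \<bullet> ?b)) $ k * X (upd ?b w (\<tau> * (w \<bullet> ?b))))
        = (\<lambda>\<tau>. w $ k * (\<tau> * X (upd ?b w (\<tau> * (w \<bullet> ?b)))))"
      by (simp add: upd_axis_nth mult_ac)
    then have "integral {0..1} (\<lambda>\<tau>. upd ?b w (\<tau> * (w \<bullet> ?b)) $ k * X (upd ?b w (\<tau> * (w \<bullet> ?b)))) = w $ k * e w"
      unfolding e_def by (simp only: integral_mult_right)
    with q show "q w = q (upd ?b w 0) + (w $ k)\<^sup>2 * e w" by (simp add: power2_eq_square)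
  qed
  \<comment> \<open>The sign of the unit \<open>e\<close>, extracted so that the square root in
    \<open>\<zeta>\<close> is taken of a positive germ.\<close>
  define \<kappa> where "\<kappa> = sgn (e 0)"
  have \<kappa>: "\<kappa> * e 0 > 0" "\<kappa> * \<kappa> = 1" using e0 by (auto simp: \<kappa>_def sgn_if)
  define \<zeta> where "\<zeta> w = (w \<bullet> ?b) * sqrt (\<kappa> * e w)" for w
  have \<kappa>e: "smooth_germ (\<lambda>w. \<kappa> * e w)" by (intro smooth_germ_intros e)
  have sq: "smooth_germ (\<lambda>w. sqrt (\<kappa> * e w))" by (rule smooth_germ_sqrt[OF \<kappa>e \<kappa>(1)])
  have \<zeta>: "smooth_germ \<zeta>" "\<zeta> 0 = 0" unfolding \<zeta>_def by (intro smooth_germ_mult smooth_germ_inner sq) simp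
  have "pd ?b \<zeta> 0 = sqrt (\<kappa> * e 0)" unfolding \<zeta>_def[abs_def] by (rule pd_mult_linear_at_0[OF axis_1_in_Basis sq])
  then have \<zeta>': "pd ?b \<zeta> 0 \<noteq> 0" using \<kappa> by auto
  have "\<forall>\<^sub>F w in nhds 0. \<kappa> * e w > 0" by (rule order_tendstoD(1)[OF smooth_germ_tendsto[OF \<kappa>e] \<kappa>(1)])
  then have "\<forall>\<^sub>F w in nhds 0. (\<zeta> w)\<^sup>2 = (w $ k)\<^sup>2 * (\<kappa> * e w)"
    by (rule eventually_mono) (simp add: \<zeta>_def power_mult_distrib)
  with qe have q\<zeta>: "\<forall>\<^sub>F w in nhds 0. q w = q (upd ?b w 0) + \<kappa> * (\<zeta> w)\<^sup>2"
  proof eventually_elim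
    case (elim w)
    have "\<kappa> * (\<zeta> w)\<^sup>2 = (\<kappa> * \<kappa>) * ((w $ k)\<^sup>2 * e w)" unfolding elim(2) by (simp add: mult_ac)
    then show ?case using elim(1) by (simp add: \<kappa>)
  qed
  obtain \<Gamma> where \<Gamma>: "smooth_germ \<Gamma>" "\<Gamma> 0 = 0"
    and fib\<Gamma>: "\<forall>\<^sub>F w in nhds 0. \<Gamma> w = upd ?b w (\<Gamma> w $ k)"
    and u\<Gamma>: "\<forall>\<^sub>F w in nhds 0. \<zeta> (\<Gamma> w) = w $ k"
    and nz\<Gamma>: "pd ?b (\<lambda>w. \<Gamma> w $ k) 0 \<noteq> 0"
    and chain\<Gamma>: "\<And>h. smooth_germ h \<Longrightarrow> \<forall>\<^sub>F w in nhds 0. pd ?b (\<lambda>w. h (\<Gamma> w)) w = pd ?b h (\<Gamma> w) * pd ?b (\<lambda>w. \<Gamma> w $ k) w"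
    and dec\<Gamma>: "\<And>g. smooth_germ g \<Longrightarrow> g 0 = 0 \<Longrightarrow> ramification_decomposes (graph_map k (\<lambda>w. g (\<Gamma> w)))
       \<Longrightarrow> ramification_decomposes (graph_map k g)"
    by (rule fibre_coordinate_change[OF \<zeta> \<zeta>']) blast
  define U where "U w = \<kappa> * X (\<Gamma> w) * pd ?b (\<lambda>w. \<Gamma> w $ k) w" for w
  have "smooth_germ U" unfolding U_def
    by (intro smooth_germ_intros smooth_germ_compose[OF X(1) \<Gamma>] smooth_germ_frechet_derivative smooth_germ_vec_nth \<Gamma>)
  moreover have "U 0 \<noteq> 0" using X(2) nz\<Gamma> \<kappa> by (auto simp: U_def \<Gamma>)
  \<comment> \<open>From \<open>q = q0 + \<kappa> * t^2\<close>, with \<open>q0\<close> free of the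
    fibre coordinate, and \<open>\<kappa> * \<kappa> = 1\<close> one gets
    \<open>q = \<kappa> * (t^2 - s)\<close> for \<open>s = - \<kappa> * q0\<close>.\<close>
  moreover define s where "s w = - \<kappa> * q (upd ?b w 0)" for w
  moreover have "smooth_germ (\<lambda>w. - \<kappa> * q (upd ?b w 0))"
    by (intro smooth_germ_intros smooth_germ_compose[OF q(1)]) (auto intro: smooth_germ_ident smooth_germ_const)
  moreover have "s 0 = 0" by (simp add: s_def q)
  moreover have "s (upd ?b z t) = s z" for z t by (simp add: s_def)
  moreover have "\<forall>\<^sub>F w in nhds 0. pd ?b (\<lambda>w. g (\<Lambda> (\<Gamma> w))) w = ((w $ k)\<^sup>2 - s w) * U w"
    using chain\<Gamma>[OF smooth_germ_compose[OF g(1) \<Lambda>]] eventually_germ_compose[OF \<Gamma> chain[OF g(1)]]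
      eventually_germ_compose[OF \<Gamma> q\<zeta>] u\<Gamma> fib\<Gamma>
  proof eventually_elim
    case (elim w)
    have "upd ?b (\<Gamma> w) 0 = upd ?b w 0" using elim(5) upd_upd[OF axis_1_in_Basis] by metis
    then have "q (\<Gamma> w) = q (upd ?b w 0) + \<kappa> * (w $ k)\<^sup>2" using elim(3,4) by simp
    then have "q (\<Gamma> w) = \<kappa> * ((w $ k)\<^sup>2 - s w)"
      using \<kappa>(2) by (simp add: s_def algebra_simps)
    then show ?case unfolding elim(1,2) by (simp add: q_def[symmetric] U_def) (simp add: X_def)
  qed
  ultimately have "ramification_decomposes (graph_map k (\<lambda>w. g (\<Lambda> (\<Gamma> w))))"
    using ramification_decomposes_cusp[OF smooth_germ_compose[OF smooth_germ_compose[OF g(1) \<Lambda>] \<Gamma>], of U s k]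
    by (simp add: s_def[abs_def])
  then have "ramification_decomposes (graph_map k (\<lambda>w. g (\<Lambda> w)))"
    by (rule dec\<Gamma>[OF smooth_germ_compose[OF g(1) \<Lambda>], rotated]) (simp add: \<Lambda> g)
  then show ?thesis by (rule dec[OF g(1,2)])
qed

subsection \<open>Consequences of small multiplicity\<close>

text \<open>Gaussian elimination: \<open>I\<close> indexes the unknowns and \<open>B\<close> the
  equations. Solving one equation for one unknown leaves a system with one fewer of each.\<close>

lemma linear_system_nontrivial_solution:
  fixes D :: "'i \<Rightarrow> 'b \<Rightarrow> real"
  assumes "finite B" "finite I" "card B < card I"
  shows "\<exists>c. (\<exists>i\<in>I. c i \<noteq> 0) \<and> (\<forall>b\<in>B. (\<Sum>i\<in>I. c i * D i b) = 0)"
  using assms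
proof (induction B arbitrary: I D rule: finite_induct)
  case empty
  then obtain i where "i \<in> I" by fastforce
  then show ?case by (intro exI[of _ "\<lambda>_. 1"]) auto
next
  case (insert b B)
  show ?case
  proof (cases "\<forall>i\<in>I. D i b = 0")
    case True
    from insert.prems insert.hyps have "card B < card I" by simp
    from insert.IH[OF insert.prems(1) this, of D] True show ?thesis by auto
  next
    case False
    then obtain i0 where i0: "i0 \<in> I" "D i0 b \<noteq> 0" by blast
    let ?I = "I - {i0}"
    have "card B < card ?I" using insert.prems insert.hyps i0 by simp
    from insert.IH[OF _ this, of "\<lambda>i b'. D i b' - D i b / D i0 b * D i0 b'"] insert.prems
    obtain c where c: "\<exists>i\<in>?I. c i \<noteq> 0"
      and s: "\<And>b'. b' \<in> B \<Longrightarrow> (\<Sum>i\<in>?I. c i * (D i b' - D i b / D i0 b * D i0 b')) = 0" by auto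
    \<comment> \<open>The value of the unknown \<open>i0\<close> that solves equation
      \<open>b\<close>; the modified coefficients in the induction hypothesis come from substituting
      it into the other equations.\<close>
    define c0 where "c0 = - (\<Sum>i\<in>?I. c i * (D i b / D i0 b))"
    have split: "(\<Sum>i\<in>I. (c(i0 := c0)) i * D i b') = c0 * D i0 b' + (\<Sum>i\<in>?I. c i * D i b')" for b'
      using insert.prems(1) i0(1) by (simp add: sum.remove)
    have "c0 * D i0 b = - (\<Sum>i\<in>?I. c i * D i b)"
      using i0(2) by (simp add: c0_def sum_distrib_right)
    then have "(\<Sum>i\<in>I. (c(i0 := c0)) i * D i b) = 0" unfolding split by simp
    moreover have "(\<Sum>i\<in>I. (c(i0 := c0)) i * D i b') = 0" if "b' \<in> B" for b'
    proof -
      have "c0 * D i0 b' = - (\<Sum>i\<in>?I. c i * (D i b / D i0 b * D i0 b'))"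
        by (simp add: c0_def sum_distrib_right mult.assoc)
      then have "c0 * D i0 b' + (\<Sum>i\<in>?I. c i * D i b') = (\<Sum>i\<in>?I. c i * (D i b' - D i b / D i0 b * D i0 b'))"
        by (simp add: right_diff_distrib sum_subtractf)
      then show ?thesis unfolding split using s[OF that] by simp
    qed
    moreover have "\<exists>i\<in>I. (c(i0 := c0)) i \<noteq> 0" using c by auto
    ultimately show ?thesis by (intro exI[of _ "c(i0 := c0)"]) auto
  qed
qed

text \<open>More germs than spanning classes of the local algebra satisfy a linear relation modulo
  the ideal. The coordinates of the germs in the spanning classes form an underdetermined linear
  system.\<close>

lemma local_algebra_dependent:
  fixes p :: "nat \<Rightarrow> real^'n \<Rightarrow> real"
  assumes dim: "local_algebra_dim_le f m" and p: "\<And>i. smooth_germ (p i)" and "m < N"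
  obtains c a where "\<exists>i<N. c i \<noteq> 0" "\<And>i. smooth_germ (a i)"
    "\<forall>\<^sub>F x in nhds 0. (\<Sum>i<N. c i * p i x) = (\<Sum>j\<in>UNIV. a j x * f x $ j)"
proof -
  from dim obtain B where B: "finite B" "card B \<le> m"
    and span: "\<forall>\<phi>. smooth_germ \<phi> \<longrightarrow> (\<exists>c. (\<lambda>x. \<phi> x - (\<Sum>b\<in>B. c b * b x)) \<in> comp_ideal f)"
    unfolding local_algebra_dim_le_def by (elim exE conjE)
  have "\<forall>i. \<exists>d. (\<lambda>x. p i x - (\<Sum>b\<in>B. d b * b x)) \<in> comp_ideal f" using span p by simp
  from choice[OF this] obtain D where D: "\<forall>i. (\<lambda>x. p i x - (\<Sum>b\<in>B. D i b * b x)) \<in> comp_ideal f" ..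
  then have "\<forall>i. \<exists>a. (\<forall>j. smooth_germ (a j)) \<and>
      (\<forall>\<^sub>F x in nhds 0. p i x - (\<Sum>b\<in>B. D i b * b x) = (\<Sum>j\<in>UNIV. a j x * f x $ j))"
    unfolding comp_ideal_def by simp
  from choice[OF this] obtain A where A: "\<And>i j. smooth_germ (A i j)"
    and eq: "\<And>i. \<forall>\<^sub>F x in nhds 0. p i x - (\<Sum>b\<in>B. D i b * b x) = (\<Sum>j\<in>UNIV. A i j x * f x $ j)" by blast
  obtain c where c: "\<exists>i\<in>{..<N}. c i \<noteq> 0" and cD: "\<And>b. b \<in> B \<Longrightarrow> (\<Sum>i<N. c i * D i b) = 0"
    using linear_system_nontrivial_solution[of B "{..<N}" D] B \<open>m < N\<close> by auto
  have "\<forall>\<^sub>F x in nhds 0. \<forall>i\<in>{..<N}. p i x - (\<Sum>b\<in>B. D i b * b x) = (\<Sum>j\<in>UNIV. A i j x * f x $ j)"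
    by (rule eventually_ball_finite) (use eq in auto)
  then have "\<forall>\<^sub>F x in nhds 0. (\<Sum>i<N. c i * p i x) = (\<Sum>j\<in>UNIV. (\<Sum>i<N. c i * A i j x) * f x $ j)"
  proof eventually_elim
    case (elim x)
    have "(\<Sum>i<N. c i * (\<Sum>b\<in>B. D i b * b x)) = (\<Sum>b\<in>B. (\<Sum>i<N. c i * D i b) * b x)"
      by (simp add: sum_distrib_left sum_distrib_right mult.assoc) (rule sum.swap)
    also have "\<dots> = 0" by (simp add: cD)
    finally have z: "(\<Sum>i<N. c i * (\<Sum>b\<in>B. D i b * b x)) = 0" .
    have "(\<Sum>i<N. c i * p i x) = (\<Sum>i<N. c i * (p i x - (\<Sum>b\<in>B. D i b * b x)))"
      using z by (simp add: right_diff_distrib sum_subtractf)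
    also have "\<dots> = (\<Sum>i<N. c i * (\<Sum>j\<in>UNIV. A i j x * f x $ j))"
      using elim by (intro sum.cong) auto
    also have "\<dots> = (\<Sum>j\<in>UNIV. (\<Sum>i<N. c i * A i j x) * f x $ j)"
      by (simp add: sum_distrib_left sum_distrib_right mult.assoc) (rule sum.swap)
    finally show ?case .
  qed
  moreover have "smooth_germ (\<lambda>x. \<Sum>i<N. c i * A i j x)" for j
    by (intro smooth_germ_sum smooth_germ_mult smooth_germ_const A)
  ultimately show thesis using that[of c "\<lambda>j x. \<Sum>i<N. c i * A i j x"] c by auto
qed

text \<open>The product rule at 0: because of \<open>f 0 = 0\<close> the derivatives of the
  coefficients drop out, so the linear part of a member of the ideal is a combination of the linear
  parts of the components.\<close>

lemma comp_ideal_derivative_at_0: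
  fixes f :: "real^'n \<Rightarrow> real^'n"
  assumes f: "smooth_germ f" "f 0 = 0" and a: "\<And>j. smooth_germ (a j)"
    and eq: "\<forall>\<^sub>F x in nhds 0. h x = (\<Sum>j\<in>UNIV. a j x * f x $ j)"
    and dh: "(h has_derivative h') (at 0)"
  shows "h 0 = 0" "h' v = (\<Sum>j\<in>UNIV. a j 0 * frechet_derivative f (at 0) v $ j)"
proof -
  show "h 0 = 0" using eventually_nhds_x_imp_x[OF eq] by (simp add: f)
  have "((\<lambda>x. \<Sum>j\<in>UNIV. a j x * f x $ j) has_derivative
      (\<lambda>v. \<Sum>j\<in>UNIV. a j 0 * frechet_derivative f (at 0) v $ j + frechet_derivative (a j) (at 0) v * f 0 $ j)) (at 0)"
    by (intro has_derivative_sum has_derivative_mult smooth_germ_has_derivative_0 a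
        bounded_linear.has_derivative[OF bounded_linear_vec_nth] f)
  then have "(h has_derivative
      (\<lambda>v. \<Sum>j\<in>UNIV. a j 0 * frechet_derivative f (at 0) v $ j + frechet_derivative (a j) (at 0) v * f 0 $ j)) (at 0)"
    by (rule has_derivative_transform_nhds) (use eq in \<open>auto elim: eventually_mono\<close>)
  from has_derivative_unique[OF dh this]
  show "h' v = (\<Sum>j\<in>UNIV. a j 0 * frechet_derivative f (at 0) v $ j)" by (simp add: f)
qed

text \<open>The kernel is the orthogonal complement of the row space, and row rank equals column
  rank.\<close>

lemma dim_kernel_transpose:
  fixes A :: "real^'n^'n"
  shows "dim {v. transpose A *v v = 0} = dim {v. A *v v = 0}"
proof -
  have k: "dim {v. A *v v = 0} + rank A = CARD('n)" for A :: "real^'n^'n"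
  proof -
    have "{y \<in> UNIV. \<forall>x\<in>span (rows A). orthogonal x y} = {v. A *v v = 0}"
    proof (intro set_eqI iffI)
      fix v assume "v \<in> {v. A *v v = 0}"
      then show "v \<in> {y \<in> UNIV. \<forall>x\<in>span (rows A). orthogonal x y}"
        using orthogonal_nullspace_rowspace[of A v] by (auto simp: orthogonal_commute)
    next
      fix v assume v: "v \<in> {y \<in> UNIV. \<forall>x\<in>span (rows A). orthogonal x y}"
      have "(A *v v) $ i = 0" for i
      proof -
        have "row i A \<in> span (rows A)" by (rule span_base) (auto simp: rows_def)
        with v have "row i A \<bullet> v = 0" by (auto simp: orthogonal_def)
        then show ?thesis by (simp add: matrix_vector_mult_def row_def inner_vec_def)
      qed
      then show "v \<in> {v. A *v v = 0}" by (simp add: vec_eq_iff)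
    qed
    then show ?thesis
      using dim_subspace_orthogonal_to_vectors[of "span (rows A)" "UNIV::(real^'n) set"] by (simp add: row_rank_def)
  qed
  show ?thesis using k[of A] k[of "transpose A"] by (simp add: rank_transpose)
qed

lemma subspace_kernel_matrix: "subspace {v. (A::real^'n^'m) *v v = 0}"
  by (auto simp: subspace_def matrix_vector_right_distrib matrix_vector_mult_scaleR)

lemma DERIV_0_imp_tendsto_quotient:
  "(h has_real_derivative D) (at 0) \<Longrightarrow> h 0 = 0 \<Longrightarrow> ((\<lambda>t. h t / t) \<longlongrightarrow> D) (at (0::real))"
  by (simp add: DERIV_def)

text \<open>If the kernel has dimension at least 2, then every germ without constant term whose differential vanishes on
  \<open>v1\<close> and \<open>v2\<close> lies in the ideal. Three kernel vectors contradict this with a linear form. For a two-dimensional kernel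
  the three quadratic monomials lie in the ideal, while their coefficient vectors at 0 lie in the two-dimensional
  cokernel; a dependency yields a non-zero quadratic form vanishing to third order on the kernel.\<close>
lemma kernel_dim_le_1:
  fixes f :: "real^'n \<Rightarrow> real^'n"
  assumes f: "smooth_germ f" "f 0 = 0" and dim: "local_algebra_dim_le f 3"
  shows "dim {v. matrix (frechet_derivative f (at 0)) *v v = 0} \<le> 1"
proof (rule ccontr)
  define f' where "f' = frechet_derivative f (at 0)"
  define A where "A = matrix f'"
  have df: "(f has_derivative f') (at 0)" unfolding f'_def by (rule smooth_germ_has_derivative_0[OF f(1)])
  have Af: "A *v v = f' v" for v unfolding A_def by (rule matrix_frechet_mult[OF df])
  let ?K = "{v. A *v v = 0}"
  assume "\<not> dim {v. matrix (frechet_derivative f (at 0)) *v v = 0} \<le> 1"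
  then have d2: "dim ?K \<ge> 2" by (simp add: A_def f'_def)
  obtain B where B: "B \<subseteq> ?K" "pairwise orthogonal B" "\<And>x. x \<in> B \<Longrightarrow> norm x = 1"
    "independent B" "card B = dim ?K" "span B = ?K"
    using orthonormal_basis_subspace[OF subspace_kernel_matrix[of A]] by metis
  have fin: "finite B" using B(4) by (rule independent_imp_finite)
  have ker: "f' v = 0" if "v \<in> B" for v using that B(1) Af by auto
  have inn: "x \<bullet> y = (if x = y then 1 else 0)" if "x \<in> B" "y \<in> B" for x y
    using that B(2) B(3)[of x] by (auto simp: pairwise_def orthogonal_def dot_square_norm)
  have lin: "((\<lambda>x::real^'n. x \<bullet> v) has_derivative (\<lambda>x. x \<bullet> v)) (at 0)" for v
    by (rule bounded_linear_imp_has_derivative[OF bounded_linear_inner_left])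
  obtain v1 where v1: "v1 \<in> B" using B(5) d2 by (metis card.empty ex_in_conv not_numeral_le_zero)
  have "card (B - {v1}) \<ge> 1" using v1 fin B(5) d2 by (simp add: card_Diff_singleton)
  then obtain v2 where v2: "v2 \<in> B" "v2 \<noteq> v1" by (metis Diff_iff card.empty ex_in_conv not_one_le_zero singletonI)
  \<comment> \<open>Among the four germs \<open>1\<close>, \<open>x \<bullet> v1\<close>,
    \<open>x \<bullet> v2\<close>, \<open>P\<close> there is a relation modulo the ideal. Its value
    at 0 and its derivative on \<open>v1\<close> and \<open>v2\<close> force the first three
    coefficients to vanish, so \<open>P\<close> itself lies in the ideal.\<close>
  have in_ideal: "\<exists>a. (\<forall>j. smooth_germ (a j)) \<and> (\<forall>\<^sub>F x in nhds 0. P x = (\<Sum>j\<in>UNIV. a j x * f x $ j))"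
    if P: "smooth_germ P" "P 0 = 0" and dP: "(P has_derivative P') (at 0)" and P': "P' v1 = 0" "P' v2 = 0" for P P'
  proof -
    define p where "p i x = (if i = 0 then 1 else if i = 1 then x \<bullet> v1 else if i = 2 then x \<bullet> v2 else P x)" for i :: nat and x :: "real^'n"
    have p: "smooth_germ (p i)" for i unfolding p_def by (cases "i = 0"; cases "i = 1"; cases "i = 2") (auto intro: smooth_germ_intros P)
    obtain c a where c: "\<exists>i<4. c i \<noteq> 0" and a: "\<And>i. smooth_germ (a i)"
      and eq: "\<forall>\<^sub>F x in nhds 0. (\<Sum>i<4. c i * p i x) = (\<Sum>j\<in>UNIV. a j x * f x $ j)"
      by (rule local_algebra_dependent[of f 3 p 4, OF dim p]) auto
    have expand: "(\<Sum>i<4. c i * p i x) = c 0 + c 1 * (x \<bullet> v1) + c 2 * (x \<bullet> v2) + c 3 * P x" for x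
      by (simp add: p_def eval_nat_numeral)
    have "((\<lambda>x. \<Sum>i<4. c i * p i x) has_derivative (\<lambda>x. c 1 * (x \<bullet> v1) + c 2 * (x \<bullet> v2) + c 3 * P' x)) (at 0)"
      unfolding expand by (auto intro!: derivative_eq_intros lin dP)
    note z = comp_ideal_derivative_at_0[OF f a eq this]
    have c0: "c 0 = 0" using z(1) by (simp add: expand P)
    have "c 1 * (v \<bullet> v1) + c 2 * (v \<bullet> v2) + c 3 * P' v = 0" if "v \<in> B" for v
      using z(2)[of v] ker[OF that] by (simp add: f'_def)
    from this[OF v1] this[OF v2(1)] have c12: "c 1 = 0" "c 2 = 0"
      using v1 v2 P' by (simp_all add: inn)
    with c0 c have c3: "c 3 \<noteq> 0" by (auto simp: eval_nat_numeral less_Suc_eq)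
    have "smooth_germ (\<lambda>x. a j x / c 3)" for j
      using smooth_germ_mult[OF a smooth_germ_const[of "1 / c 3"]] by simp
    moreover have "\<forall>\<^sub>F x in nhds 0. P x = (\<Sum>j\<in>UNIV. a j x / c 3 * f x $ j)"
      using eq
    proof eventually_elim
      case (elim x)
      then have "c 3 * P x = (\<Sum>j\<in>UNIV. a j x * f x $ j)"
        unfolding expand using c0 c12 by simp
      then show ?case using c3 by (simp add: sum_divide_distrib[symmetric] field_simps)
    qed
    ultimately show ?thesis by (intro exI[of _ "\<lambda>j x. a j x / c 3"]) blast
  qed
  show False
  proof (cases "dim ?K \<ge> 3")
    case True
    have "card (B - {v1, v2}) \<ge> 1" using v1 v2 fin B(5) True by (simp add: card_Diff_subset)
    then obtain v3 where v3: "v3 \<in> B" "v3 \<noteq> v1" "v3 \<noteq> v2"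
      by (metis Diff_iff card.empty ex_in_conv not_one_le_zero insertCI)
    have "\<exists>a. (\<forall>j. smooth_germ (a j)) \<and> (\<forall>\<^sub>F x in nhds 0. x \<bullet> v3 = (\<Sum>j\<in>UNIV. a j x * f x $ j))"
      by (rule in_ideal[OF smooth_germ_inner _ lin]) (use v1 v2 v3 in \<open>simp_all add: inn\<close>)
    then obtain a where a: "\<And>j. smooth_germ (a j)" and eq: "\<forall>\<^sub>F x in nhds 0. x \<bullet> v3 = (\<Sum>j\<in>UNIV. a j x * f x $ j)"
      by blast
    from comp_ideal_derivative_at_0(2)[OF f a eq lin, of v3] ker[OF v3(1)] show False
      using v3 by (simp add: inn f'_def)
  next
    case False
    then have K2: "dim ?K = 2" using d2 by simp
    \<comment> \<open>A product of two linear forms has no linear part, so its coefficients at 0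
      annihilate the image of \<open>f'\<close>.\<close>
    have quad: "\<exists>a. (\<forall>j. smooth_germ (a j)) \<and> (\<forall>v. (\<Sum>j\<in>UNIV. a j 0 * f' v $ j) = 0) \<and>
        (\<forall>\<^sub>F x in nhds 0. (x \<bullet> w1) * (x \<bullet> w2) = (\<Sum>j\<in>UNIV. a j x * f x $ j))" for w1 w2
    proof -
      have d: "((\<lambda>x::real^'n. (x \<bullet> w1) * (x \<bullet> w2)) has_derivative (\<lambda>x. 0)) (at 0)"
        by (auto intro!: derivative_eq_intros lin)
      have "\<exists>a. (\<forall>j. smooth_germ (a j)) \<and> (\<forall>\<^sub>F x in nhds 0. (x \<bullet> w1) * (x \<bullet> w2) = (\<Sum>j\<in>UNIV. a j x * f x $ j))"
        by (rule in_ideal[OF smooth_germ_mult[OF smooth_germ_inner smooth_germ_inner] _ d]) simp_all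
      then obtain a where a: "\<And>j. smooth_germ (a j)"
        and eq: "\<forall>\<^sub>F x in nhds 0. (x \<bullet> w1) * (x \<bullet> w2) = (\<Sum>j\<in>UNIV. a j x * f x $ j)" by blast
      have "(\<Sum>j\<in>UNIV. a j 0 * f' v $ j) = 0" for v
        using comp_ideal_derivative_at_0(2)[OF f a eq d, of v] by (simp add: f'_def)
      with a eq show ?thesis by (intro exI[of _ a]) simp
    qed
    \<comment> \<open>The indices 0, 1, 2 stand for the products \<open>v1 * v1\<close>,
      \<open>v1 * v2\<close>, \<open>v2 * v2\<close>.\<close>
    define w1 where "w1 i = (if i = 2 then v2 else v1)" for i :: nat
    define w2 where "w2 i = (if i = 0 then v1 else v2)" for i :: nat
    have "\<forall>i. \<exists>a. (\<forall>j. smooth_germ (a j)) \<and> (\<forall>v. (\<Sum>j\<in>UNIV. a j 0 * f' v $ j) = 0) \<and>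
        (\<forall>\<^sub>F x in nhds 0. (x \<bullet> w1 i) * (x \<bullet> w2 i) = (\<Sum>j\<in>UNIV. a j x * f x $ j))"
      using quad by blast
    from choice[OF this] obtain a where a: "\<And>i j. smooth_germ (a i j)"
      and a0: "\<And>i v. (\<Sum>j\<in>UNIV. a i j 0 * f' v $ j) = 0"
      and eq: "\<And>i. \<forall>\<^sub>F x in nhds 0. (x \<bullet> w1 i) * (x \<bullet> w2 i) = (\<Sum>j\<in>UNIV. a i j x * f x $ j)" by blast
    let ?K' = "{v. transpose A *v v = 0}"
    have inK': "(\<chi> j. a i j 0) \<in> ?K'" for i
    proof -
      have "(transpose A *v (\<chi> j. a i j 0)) $ m = 0" for m
      proof -
        have "A *v axis m 1 = column m A" by (rule matrix_vector_mult_basis)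
        then have "f' (axis m 1) $ j = A $ j $ m" for j unfolding Af by (simp add: column_def)
        with a0[of i "axis m 1"] show ?thesis
          by (simp add: matrix_vector_mult_def transpose_def mult.commute)
      qed
      then show ?thesis by (simp add: vec_eq_iff)
    qed
    obtain B' where B': "B' \<subseteq> ?K'" "independent B'" "card B' = dim ?K'" "span B' = ?K'"
      using orthonormal_basis_subspace[OF subspace_kernel_matrix[of "transpose A"]] by metis
    have fin': "finite B'" using B'(2) by (rule independent_imp_finite)
    \<comment> \<open>Three coefficient vectors lie in a space of dimension 2. The combination
      \<open>w\<close> found below is orthogonal to that space and contained in it, hence 0.\<close>
    have "card B' < card {..<3::nat}" using B'(3) K2 dim_kernel_transpose[of A] by simp
    then obtain c where c: "\<exists>i\<in>{..<3::nat}. c i \<noteq> 0" and cB: "\<And>b. b \<in> B' \<Longrightarrow> (\<Sum>i<3. c i * ((\<chi> j. a i j 0) \<bullet> b)) = 0"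
      using linear_system_nontrivial_solution[OF fin' finite_lessThan, of "3::nat" "\<lambda>i b. (\<chi> j. a i j 0) \<bullet> b"] by blast
    define w where "w = (\<Sum>i<3. c i *\<^sub>R (\<chi> j. a i j 0))"
    have "w \<in> ?K'" unfolding w_def
      by (intro subspace_sum subspace_mul subspace_kernel_matrix inK')
    moreover have "orthogonal w b" if "b \<in> span B'" for b
      by (rule orthogonal_to_span[OF that]) (simp add: orthogonal_def w_def inner_sum_left cB)
    ultimately have "w = 0" using B'(4) orthogonal_self by blast
    define \<alpha> where "\<alpha> j x = (\<Sum>i<3. c i * a i j x)" for j x
    have \<alpha>: "smooth_germ (\<alpha> j)" for j unfolding \<alpha>_def by (intro smooth_germ_sum smooth_germ_mult smooth_germ_const a)
    have \<alpha>0: "\<alpha> j 0 = 0" for j using arg_cong[OF \<open>w = 0\<close>, of "\<lambda>w. w $ j"] by (simp add: w_def \<alpha>_def)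
    define Q where "Q x = (\<Sum>i<3. c i * ((x \<bullet> w1 i) * (x \<bullet> w2 i)))" for x
    have "\<forall>\<^sub>F x in nhds 0. \<forall>i\<in>{..<3}. (x \<bullet> w1 i) * (x \<bullet> w2 i) = (\<Sum>j\<in>UNIV. a i j x * f x $ j)"
      by (rule eventually_ball_finite) (use eq in auto)
    then have Q: "\<forall>\<^sub>F x in nhds 0. Q x = (\<Sum>j\<in>UNIV. \<alpha> j x * f x $ j)"
    proof eventually_elim
      case (elim x)
      then have "Q x = (\<Sum>i<3. c i * (\<Sum>j\<in>UNIV. a i j x * f x $ j))" unfolding Q_def by (intro sum.cong) auto
      also have "\<dots> = (\<Sum>j\<in>UNIV. \<alpha> j x * f x $ j)"
        unfolding \<alpha>_def by (simp add: sum_distrib_left sum_distrib_right mult.assoc) (rule sum.swap)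
      finally show ?case .
    qed
    \<comment> \<open>Along the line through a kernel vector both \<open>\<alpha> j\<close> and the
      components of \<open>f\<close> vanish at 0, and the latter have derivative 0 there. The
      combination is therefore of smaller order than \<open>t^2\<close>, whereas \<open>Q\<close> is
      homogeneous of degree 2.\<close>
    have Q0: "Q k = 0" if k: "f' k = 0" for k
    proof -
      have line: "filterlim (\<lambda>t::real. t *\<^sub>R k) (nhds 0) (at 0)"
        using tendsto_scaleR[OF tendsto_ident_at tendsto_const, of k 0 UNIV] by simp
      have "((\<lambda>t. \<alpha> j (0 + t *\<^sub>R k)) has_real_derivative frechet_derivative (\<alpha> j) (at 0) k) (at 0)" for j
        by (rule has_real_derivative_along_line) (use smooth_germ_has_derivative_0[OF \<alpha>] in simp)
      then have l1: "((\<lambda>t. \<alpha> j (t *\<^sub>R k) / t) \<longlongrightarrow> frechet_derivative (\<alpha> j) (at 0) k) (at 0)" for j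
        using DERIV_0_imp_tendsto_quotient[of "\<lambda>t. \<alpha> j (t *\<^sub>R k)"] by (simp add: \<alpha>0)
      have "((\<lambda>t. f (0 + t *\<^sub>R k) $ j) has_real_derivative f' k $ j) (at 0)" for j
        by (rule has_real_derivative_along_line) (use bounded_linear.has_derivative[OF bounded_linear_vec_nth df] in simp)
      then have l2: "((\<lambda>t. f (t *\<^sub>R k) $ j / t) \<longlongrightarrow> 0) (at 0)" for j
        using DERIV_0_imp_tendsto_quotient[of "\<lambda>t. f (t *\<^sub>R k) $ j"] by (simp add: f k)
      have "((\<lambda>t. \<Sum>j\<in>UNIV. (\<alpha> j (t *\<^sub>R k) / t) * (f (t *\<^sub>R k) $ j / t)) \<longlongrightarrow> (\<Sum>j\<in>UNIV. frechet_derivative (\<alpha> j) (at 0) k * 0)) (at 0)"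
        by (intro tendsto_sum tendsto_mult l1 l2)
      moreover have "\<forall>\<^sub>F t in at 0. (\<Sum>j\<in>UNIV. (\<alpha> j (t *\<^sub>R k) / t) * (f (t *\<^sub>R k) $ j / t)) = Q k"
      proof -
        have "\<forall>\<^sub>F t in at 0. Q (t *\<^sub>R k) = (\<Sum>j\<in>UNIV. \<alpha> j (t *\<^sub>R k) * f (t *\<^sub>R k) $ j)"
          by (rule eventually_compose_filterlim[OF Q line])
        moreover have "\<forall>\<^sub>F t in at (0::real). t \<noteq> 0" by (simp add: eventually_at_filter)
        ultimately show ?thesis
        proof eventually_elim
          case (elim t)
          have "Q (t *\<^sub>R k) = t\<^sup>2 * Q k" by (simp add: Q_def sum_distrib_left power2_eq_square mult_ac)
          with elim show ?case by (simp add: sum_divide_distrib[symmetric] power2_eq_square field_simps)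
        qed
      qed
      ultimately have "((\<lambda>t::real. Q k) \<longlongrightarrow> 0) (at 0)" by (simp add: tendsto_cong)
      then show ?thesis by (simp add: tendsto_const_iff)
    qed
    have lin': "linear f'" using df has_derivative_linear by blast
    have Qx: "Q x = c 0 * (x \<bullet> v1)\<^sup>2 + c 1 * ((x \<bullet> v1) * (x \<bullet> v2)) + c 2 * (x \<bullet> v2)\<^sup>2" for x
      by (simp add: Q_def w1_def w2_def eval_nat_numeral)
    \<comment> \<open>The values at \<open>v1\<close>, \<open>v2\<close> and \<open>v1 + v2\<close>
      determine the three coefficients of a binary quadratic form.\<close>
    have "c 0 = 0" using Q0[OF ker[OF v1]] v1 v2 by (simp add: Qx inn)
    moreover have "c 2 = 0" using Q0[OF ker[OF v2(1)]] v1 v2 by (simp add: Qx inn)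
    moreover have "f' (v1 + v2) = 0" using ker[OF v1] ker[OF v2(1)] by (simp add: linear_add[OF lin'])
    from Q0[OF this] have "c 0 + c 1 + c 2 = 0" using v1 v2 by (simp add: Qx inn inner_add_left)
    ultimately show False using c by (auto simp: eval_nat_numeral less_Suc_eq)
  qed
qed

section \<open>Order of vanishing along the fibre axis\<close>

lemma abs_le_power_Suc_of_derivative:
  fixes p p' :: "real \<Rightarrow> real"
  assumes "\<And>t. \<bar>t\<bar> < d \<Longrightarrow> (p has_real_derivative p' t) (at t)"
    and "\<And>t. \<bar>t\<bar> < d \<Longrightarrow> \<bar>p' t\<bar> \<le> C * \<bar>t\<bar> ^ n" and "p 0 = 0" "\<bar>t\<bar> < d" "C \<ge> 0"
  shows "\<bar>p t\<bar> \<le> C * \<bar>t\<bar> ^ Suc n"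
proof -
  have "norm (p t - p 0) \<le> C * \<bar>t\<bar> ^ n * norm (t - 0)"
  proof (rule field_differentiable_bound[of "{-\<bar>t\<bar>..\<bar>t\<bar>}"])
    fix s assume "s \<in> {-\<bar>t\<bar>..\<bar>t\<bar>}"
    then have s: "\<bar>s\<bar> \<le> \<bar>t\<bar>" by auto
    then have sd: "\<bar>s\<bar> < d" using assms(4) by simp
    show "(p has_real_derivative p' s) (at s within {-\<bar>t\<bar>..\<bar>t\<bar>})"
      using assms(1)[OF sd] by (rule has_field_derivative_at_within)
    have "\<bar>p' s\<bar> \<le> C * \<bar>s\<bar> ^ n" by (rule assms(2)[OF sd])
    also have "\<dots> \<le> C * \<bar>t\<bar> ^ n" using s assms(5) by (intro mult_left_mono power_mono) auto
    finally show "norm (p' s) \<le> C * \<bar>t\<bar> ^ n" by simp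
  qed auto
  then show ?thesis using assms(3) by (simp add: mult_ac)
qed

text \<open>By continuity the third derivative is below \<open>e / 2\<close> near 0, and three
  applications of the mean value bound along the axis turn this into
  \<open>e / 2 * \<bar>t\<bar> ^ 3\<close>. The factor \<open>1/2\<close> makes the final inequality
  strict.\<close>

lemma third_order_vanishing:
  fixes g :: "'a::euclidean_space \<Rightarrow> real"
  assumes b: "b \<in> Basis" and g: "smooth_germ g" "g 0 = 0" "pd b g 0 = 0" "pd b (pd b g) 0 = 0" "pd b (pd b (pd b g)) 0 = 0"
  shows "((\<lambda>t. g (t *\<^sub>R b) / t ^ 3) \<longlongrightarrow> 0) (at 0)"
proof (rule tendstoI)
  fix e :: real assume "e > 0"
  obtain r where r: "r > 0" and s0: "smooth_on g (ball 0 r)" using g(1) smooth_germE by metis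
  note s1 = smooth_on_frechet_derivative[OF s0, of b]
  note s2 = smooth_on_frechet_derivative[OF s1, of b]
  note s3 = smooth_on_frechet_derivative[OF s2, of b]
  have "isCont (pd b (pd b (pd b g))) 0"
    using smooth_on_imp_continuous_on[OF s3] r by (simp add: continuous_on_eq_continuous_at)
  then obtain d0 where d0: "d0 > 0" "\<And>x. norm x < d0 \<Longrightarrow> \<bar>pd b (pd b (pd b g)) x\<bar> < e / 2"
    using \<open>e > 0\<close> g(5) unfolding continuous_at_eps_delta by (metis diff_zero dist_0_norm dist_commute dist_norm half_gt_zero real_norm_def)
  define d where "d = min d0 r"
  have d: "d > 0" using d0 r by (simp add: d_def)
  have nb: "norm (t *\<^sub>R b) = \<bar>t\<bar>" for t using b by simp
  have deriv: "((\<lambda>t. h (t *\<^sub>R b)) has_real_derivative pd b h (t *\<^sub>R b)) (at t)" if "smooth_on h (ball 0 r)" "\<bar>t\<bar> < d" for h t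
    using has_real_derivative_along_line[of h _ 0 t b] smooth_on_has_derivative[OF open_ball that(1), of "t *\<^sub>R b"] that(2)
    by (simp add: d_def norm_Basis[OF b])
  have "\<bar>pd b (pd b g) (t *\<^sub>R b)\<bar> \<le> e / 2 * \<bar>t\<bar> ^ Suc 0" if "\<bar>t\<bar> < d" for t
    by (rule abs_le_power_Suc_of_derivative[where d = d, OF deriv[OF s2]])
      (use that d0(2)[of "_ *\<^sub>R b"] \<open>e > 0\<close> g(4) in \<open>auto simp: norm_Basis[OF b] d_def less_imp_le\<close>)
  then have "\<bar>pd b g (t *\<^sub>R b)\<bar> \<le> e / 2 * \<bar>t\<bar> ^ Suc (Suc 0)" if "\<bar>t\<bar> < d" for t
    by (intro abs_le_power_Suc_of_derivative[where d = d, OF deriv[OF s1] _ _ that]) (use \<open>e > 0\<close> g(3) in auto)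
  then have "\<bar>g (t *\<^sub>R b)\<bar> \<le> e / 2 * \<bar>t\<bar> ^ Suc (Suc (Suc 0))" if "\<bar>t\<bar> < d" for t
    by (intro abs_le_power_Suc_of_derivative[where d = d, OF deriv[OF s0] _ _ that]) (use \<open>e > 0\<close> g(2) in auto)
  then have main: "\<bar>g (t *\<^sub>R b)\<bar> \<le> e / 2 * \<bar>t\<bar> ^ 3" if "\<bar>t\<bar> < d" for t
    using that by (simp add: numeral_3_eq_3)
  show "\<forall>\<^sub>F t in at 0. dist (g (t *\<^sub>R b) / t ^ 3) 0 < e"
    unfolding eventually_at
  proof (intro exI[of _ d] conjI ballI impI)
    fix t :: real assume t: "t \<noteq> 0 \<and> dist t 0 < d"
    then have "\<bar>g (t *\<^sub>R b)\<bar> / \<bar>t\<bar> ^ 3 \<le> e / 2" using main[of t] by (simp add: divide_le_eq)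
    moreover have "dist (g (t *\<^sub>R b) / t ^ 3) 0 = \<bar>g (t *\<^sub>R b)\<bar> / \<bar>t\<bar> ^ 3" by (simp add: abs_divide power_abs)
    ultimately show "dist (g (t *\<^sub>R b) / t ^ 3) 0 < e" using \<open>e > 0\<close> by linarith
  qed (rule d)
qed

text \<open>Division by \<open>t ^ m\<close> isolates \<open>c m\<close> in the limit once the
  coefficients of lower index are known to vanish.\<close>

lemma cubic_coeffs_zero:
  fixes c :: "nat \<Rightarrow> real"
  assumes "((\<lambda>t. (\<Sum>i<4. c i * t ^ i) / t ^ 3) \<longlongrightarrow> 0) (at 0)"
  shows "\<forall>i<4. c i = 0"
proof -
  let ?P = "\<lambda>t. \<Sum>i<4. c i * t ^ i"
  have P: "?P t = c 0 + c 1 * t + c 2 * t ^ 2 + c 3 * t ^ 3" for t by (simp add: eval_nat_numeral)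
  have pw: "((\<lambda>t::real. t ^ n) \<longlongrightarrow> 0) (at 0)" if "n > 0" for n
    using tendsto_power[OF tendsto_ident_at[of "0::real" UNIV], of n] that by (simp add: zero_power)
  have lim: "((\<lambda>t. ?P t / t ^ m) \<longlongrightarrow> 0) (at 0)" if "m \<le> 3" for m
  proof (cases "m = 3")
    case False
    have "((\<lambda>t. ?P t / t ^ 3 * t ^ (3 - m)) \<longlongrightarrow> 0 * 0) (at 0)"
      using that False by (intro tendsto_mult assms pw) auto
    moreover have "\<forall>\<^sub>F t in at (0::real). ?P t / t ^ 3 * t ^ (3 - m) = ?P t / t ^ m"
    proof -
      have "?P t / t ^ 3 * t ^ (3 - m) = ?P t / t ^ m" if "t \<noteq> 0" for t
      proof -
        have "t ^ 3 = t ^ m * t ^ (3 - m)" using \<open>m \<le> 3\<close> by (simp add: power_add[symmetric])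
        then show ?thesis using that by simp
      qed
      then show ?thesis by (auto simp: eventually_at_filter)
    qed
    ultimately show ?thesis by (simp add: tendsto_cong)
  qed (use assms in simp)
  have quot: "x = 0" if "((\<lambda>t. h t / t ^ m) \<longlongrightarrow> 0) (at 0)" "\<And>t. t \<noteq> 0 \<Longrightarrow> h t / t ^ m = x + k t" "(k \<longlongrightarrow> 0) (at 0)" for x :: real and h k m
  proof -
    have "((\<lambda>t. x + k t) \<longlongrightarrow> x + 0) (at 0)" by (intro tendsto_intros that)
    moreover have "((\<lambda>t. x + k t) \<longlongrightarrow> 0) (at 0)"
      by (rule Lim_transform_eventually[OF that(1)]) (use that(2) in \<open>auto simp: eventually_at_filter\<close>)
    ultimately show ?thesis using tendsto_unique[of "at (0::real)"] by fastforce
  qed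
  have c0: "c 0 = 0"
    by (rule quot[OF lim[of 0], of _ "\<lambda>t. c 1 * t + c 2 * t ^ 2 + c 3 * t ^ 3"])
      (auto simp: P intro!: tendsto_eq_intros)
  have c1: "c 1 = 0"
    by (rule quot[OF lim[of 1], of _ "\<lambda>t. c 2 * t + c 3 * t ^ 2"])
      (auto simp: P c0 field_simps power2_eq_square power3_eq_cube intro!: tendsto_eq_intros)
  have c2: "c 2 = 0"
    by (rule quot[OF lim[of 2], of _ "\<lambda>t. c 3 * t"])
      (auto simp: P c0 c1[simplified] field_simps power2_eq_square power3_eq_cube intro!: tendsto_eq_intros)
  have c3: "c 3 = 0"
    by (rule quot[OF lim[of 3], of _ "\<lambda>t. 0"])
      (auto simp: P c0 c1[simplified] c2)
  show ?thesis using c0 c1 c2 c3 by (auto simp: eval_nat_numeral less_Suc_eq)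
qed

section \<open>Reduction to the normal forms\<close>

lemma ramification_decomposes_multiplicity_le_3:
  fixes f :: "real^'n \<Rightarrow> real^'n"
  assumes f: "smooth_germ f" "f 0 = 0" and dim: "local_algebra_dim_le f 3"
  shows "ramification_decomposes f"
proof (cases "jac f 0 = 0")
  case False
  then show ?thesis by (rule ramification_decomposes_regular[OF f(1)])
next
  case True
  define f' where "f' = frechet_derivative f (at 0)"
  define A where "A = matrix f'"
  have df: "(f has_derivative f') (at 0)" unfolding f'_def by (rule smooth_germ_has_derivative_0[OF f(1)])
  have Af: "A *v v = f' v" for v unfolding A_def by (rule matrix_frechet_mult[OF df])
  have "det A = 0" using True by (simp add: jac_def A_def f'_def)
  then have ninv: "\<not> invertible A" by (simp add: invertible_det_nz)
  then obtain v0 where v0: "A *v v0 = 0" "v0 \<noteq> 0"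
    by (auto simp: invertible_left_inverse matrix_left_invertible_ker)
  then obtain k where k: "v0 $ k \<noteq> 0" by (auto simp: vec_eq_iff)
  define v where "v = (1 / v0 $ k) *\<^sub>R v0"
  have v: "A *v v = 0" "v $ k = 1" using v0 k by (simp_all add: v_def matrix_vector_mult_scaleR)
  have "v \<noteq> 0" using v(2) by auto
  have ker: "\<exists>c. w = c *\<^sub>R v" if "A *v w = 0" for w
  proof -
    have "dim {v. A *v v = 0} \<le> 1" using kernel_dim_le_1[OF f dim] by (simp add: A_def f'_def)
    then have "{v. A *v v = 0} \<subseteq> span {v}"
      by (intro card_ge_dim_independent) (use v \<open>v \<noteq> 0\<close> in auto)
    then show ?thesis using that by (auto simp: span_singleton)
  qed
  have "\<not> surj ((*v) A)" using ninv by (simp add: invertible_right_inverse matrix_right_invertible_surjective)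
  then obtain u where u: "\<And>w. A *v w \<noteq> u" by (metis surjI)
  \<comment> \<open>\<open>A\<close> plus a rank-one map sending \<open>v\<close> to
    \<open>u\<close>. As \<open>v\<close> spans the kernel of \<open>A\<close> and \<open>u\<close>
    lies outside its image, the sum is invertible.\<close>
  define M where "M = (\<chi> i j. A $ i $ j + (if j = k then u $ i else 0))"
  have M: "M *v z = A *v z + (z $ k) *\<^sub>R u" for z
    by (simp add: M_def vec_eq_iff matrix_vector_mult_def distrib_right sum.distrib
        if_distrib[where f = "\<lambda>x. x * _"] cong: if_cong)
  have "z = 0" if "M *v z = 0" for z
  proof -
    have e: "A *v z = - (z $ k) *\<^sub>R u" using that unfolding M by (simp add: add_eq_0_iff2)
    have "z $ k = 0"
    proof (rule ccontr)
      assume "z $ k \<noteq> 0"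
      moreover have "A *v (r *\<^sub>R z) = r *\<^sub>R (- (z $ k) *\<^sub>R u)" for r by (simp only: matrix_vector_mult_scaleR e)
      ultimately have "A *v ((- inverse (z $ k)) *\<^sub>R z) = u" by (simp only: scaleR_scaleR) simp
      then show False using u by blast
    qed
    moreover from this obtain c where "z = c *\<^sub>R v" using ker[of z] e by auto
    ultimately show "z = 0" using v(2) by simp
  qed
  then obtain R where RM: "R ** M = mat 1" by (metis matrix_left_invertible_ker)
  then have MR: "M ** R = mat 1" using matrix_left_right_inverse by blast
  have Ru: "R *v u = v"
  proof -
    have "M *v v = u" using v by (simp add: M)
    then have "R *v u = (R ** M) *v v" by (simp add: matrix_vector_mul_assoc[symmetric])
    then show ?thesis by (simp add: RM)
  qed
  \<comment> \<open>After the target change by \<open>R\<close> the linear part is the projection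
    along \<open>v\<close> onto the vectors with component \<open>k\<close> equal to 0, because
    \<open>v $ k = 1\<close>.\<close>
  have RA: "R *v (A *v z) = z - (z $ k) *\<^sub>R v" for z
  proof -
    have "A *v z = M *v z - (z $ k) *\<^sub>R u" by (simp add: M)
    then have "R *v (A *v z) = (R ** M) *v z - (z $ k) *\<^sub>R (R *v u)"
      by (simp add: matrix_vector_mult_diff_distrib matrix_vector_mult_scaleR matrix_vector_mul_assoc)
    then show ?thesis by (simp add: RM Ru)
  qed
  define f1 where "f1 x = R *v f x" for x
  have f1: "smooth_germ f1" "f1 0 = 0" unfolding f1_def
    by (rule smooth_germ_bounded_linear[OF matrix_vector_mul_bounded_linear f(1)]) (simp add: f)
  have df1: "(f1 has_derivative (\<lambda>z. z - (z $ k) *\<^sub>R v)) (at 0)"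
    using bounded_linear.has_derivative[OF matrix_vector_mul_bounded_linear df, of R]
    unfolding f1_def[abs_def] by (simp add: Af[symmetric] RA)
  \<comment> \<open>The components of \<open>f1\<close> other than \<open>k\<close>, completed by
    \<open>x $ k\<close>, form a coordinate system; in it \<open>f1\<close> becomes a graph
    map.\<close>
  define \<Phi> where "\<Phi> x = upd (axis k 1) (f1 x) (x $ k)" for x
  have \<Phi>: "smooth_germ \<Phi>" "\<Phi> 0 = 0" unfolding \<Phi>_def
    by (intro smooth_germ_upd f1 smooth_germ_vec_nth smooth_germ_ident) (simp add: f1)
  have d\<Phi>: "(\<Phi> has_derivative (\<lambda>z. upd (axis k 1) (z - (z $ k) *\<^sub>R v) (z $ k))) (at 0)"
  proof -
    have "(\<Phi> has_derivative (\<lambda>z. (z - (z $ k) *\<^sub>R v) + (z $ k - (z - (z $ k) *\<^sub>R v) $ k) *\<^sub>R axis k 1)) (at 0)"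
      unfolding \<Phi>_def[abs_def] upd_def inner_axis_1
      by (intro has_derivative_add df1 has_derivative_scaleR_left has_derivative_diff
          bounded_linear_imp_has_derivative[OF bounded_linear_vec_nth] bounded_linear.has_derivative[OF bounded_linear_vec_nth])
    then show ?thesis by (simp add: upd_def)
  qed
  have "jac \<Phi> 0 \<noteq> 0"
  proof -
    have "z = 0" if "matrix (\<lambda>z. upd (axis k 1) (z - (z $ k) *\<^sub>R v) (z $ k)) *v z = 0" for z
    proof -
      have 0: "upd (axis k 1) (z - (z $ k) *\<^sub>R v) (z $ k) = 0"
        using that by (simp add: matrix_frechet_mult[OF d\<Phi>])
      have "z $ k = 0" using arg_cong[OF 0, of "\<lambda>w. w $ k"] by (simp add: upd_axis_nth)
      then show "z = 0" using 0 upd_same[of "axis k 1" z] by simp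
    qed
    then have "invertible (matrix (\<lambda>z. upd (axis k 1) (z - (z $ k) *\<^sub>R v) (z $ k)))"
      by (simp add: invertible_left_inverse matrix_left_invertible_ker)
    then show ?thesis by (simp add: jac_def frechet_derivative_at[OF d\<Phi>, symmetric] invertible_det_nz)
  qed
  then obtain \<Psi> where \<Psi>: "smooth_germ \<Psi>" "\<Psi> 0 = 0"
    and inv: "\<forall>\<^sub>F x in nhds 0. \<Psi> (\<Phi> x) = x" "\<forall>\<^sub>F y in nhds 0. \<Phi> (\<Psi> y) = y"
    by (rule smooth_inverse_germ[OF \<Phi>])
  define g where "g w = f1 (\<Psi> w) $ k" for w
  have g: "smooth_germ g" "g 0 = 0" unfolding g_def
    by (rule smooth_germ_vec_nth[OF smooth_germ_compose[OF f1(1) \<Psi>]]) (simp add: \<Psi> f1)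
  have graph: "\<forall>\<^sub>F w in nhds 0. graph_map k g w = f1 (\<Psi> w)"
    using inv(2)
  proof eventually_elim
    case (elim w)
    have "f1 (\<Psi> w) $ i = w $ i" if "i \<noteq> k" for i
      using arg_cong[OF elim, of "\<lambda>w. w $ i"] that by (simp add: \<Phi>_def upd_axis_nth)
    then show ?case by (simp add: vec_eq_iff graph_map_nth g_def)
  qed
  have \<Psi>k: "\<forall>\<^sub>F w in nhds 0. \<Psi> w $ k = w $ k"
    using inv(2) by (rule eventually_mono) (metis \<Phi>_def upd_axis_nth)
  let ?b = "axis k (1::real)"
  \<comment> \<open>Component \<open>k\<close> of the linear part of \<open>f1\<close> is
    \<open>z $ k - z $ k * v $ k = 0\<close>.\<close>
  have dg: "pd ?b g 0 = 0"
  proof -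
    have d1: "(f1 has_derivative (\<lambda>z. z - (z $ k) *\<^sub>R v)) (at (\<Psi> 0))" using df1 \<Psi>(2) by simp
    have "(g has_derivative (\<lambda>w. (frechet_derivative \<Psi> (at 0) w - (frechet_derivative \<Psi> (at 0) w $ k) *\<^sub>R v) $ k)) (at 0)"
      unfolding g_def[abs_def]
      by (rule bounded_linear.has_derivative[OF bounded_linear_vec_nth has_derivative_compose[OF smooth_germ_has_derivative_0[OF \<Psi>(1)] d1]])
    from pd_eqI[OF this] show ?thesis by (simp add: v(2))
  qed
  have "ramification_decomposes (graph_map k g)"
  proof (cases "pd ?b (pd ?b g) 0 = 0")
    case False
    then show ?thesis by (rule ramification_decomposes_fold_order[OF g dg])
  next
    case d2: True
    show ?thesis
    proof (cases "pd ?b (pd ?b (pd ?b g)) 0 = 0")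
      case False
      then show ?thesis by (rule ramification_decomposes_cusp_order[OF g dg d2])
    next
      case d3: True
      \<comment> \<open>This case is contradictory: four powers of the fibre coordinate are
        dependent modulo the ideal, but on the fibre axis every member of the ideal is a multiple of
        \<open>g\<close>, which here is of smaller order than \<open>t^3\<close>.\<close>
      have p: "smooth_germ (\<lambda>x::real^'n. (x $ k) ^ i)" for i
        by (intro smooth_germ_power smooth_germ_vec_nth smooth_germ_ident)
      obtain c a where c: "\<exists>i<4. c i \<noteq> 0" and a: "\<And>i. smooth_germ (a i)"
        and eq: "\<forall>\<^sub>F x in nhds 0. (\<Sum>i<4. c i * (x $ k) ^ i) = (\<Sum>j\<in>UNIV. a j x * f x $ j)"
        by (rule local_algebra_dependent[of f 3 "\<lambda>i x. (x $ k) ^ i" 4, OF dim p]) auto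
      \<comment> \<open>On the axis \<open>f1 (\<Psi> w)\<close> is \<open>g w\<close> times the
        unit vector \<open>k\<close>, so \<open>f (\<Psi> w)\<close> is \<open>g w\<close> times
        column \<open>k\<close> of \<open>M\<close>; \<open>H\<close> collects the resulting
        coefficient of \<open>g\<close>.\<close>
      define H where "H w = (\<Sum>j\<in>UNIV. a j (\<Psi> w) * M $ j $ k)" for w
      have H: "smooth_germ H" unfolding H_def
        by (intro smooth_germ_sum smooth_germ_mult smooth_germ_const smooth_germ_compose[OF a \<Psi>])
      have line: "filterlim (\<lambda>t::real. t *\<^sub>R ?b) (nhds 0) (at 0)"
        using tendsto_scaleR[OF tendsto_ident_at tendsto_const, of ?b 0 UNIV] by simp
      have "\<forall>\<^sub>F w in nhds 0. (\<forall>i. i \<noteq> k \<longrightarrow> w $ i = 0) \<longrightarrow> (\<Sum>i<4. c i * (w $ k) ^ i) = g w * H w"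
        using eventually_germ_compose[OF \<Psi> eq] graph \<Psi>k
      proof eventually_elim
        case (elim w)
        show ?case
        proof
          assume w: "\<forall>i. i \<noteq> k \<longrightarrow> w $ i = 0"
          have "f1 (\<Psi> w) = g w *\<^sub>R ?b"
            unfolding elim(2)[symmetric] using w by (simp add: vec_eq_iff graph_map_nth axis_component)
          then have "M *v f1 (\<Psi> w) = g w *\<^sub>R column k M" by (simp add: matrix_vector_mult_scaleR matrix_vector_mult_basis)
          moreover have "M *v f1 (\<Psi> w) = f (\<Psi> w)" by (simp add: f1_def matrix_vector_mul_assoc MR)
          ultimately have "f (\<Psi> w) $ j = g w * M $ j $ k" for j by (simp add: column_def)
          then show "(\<Sum>i<4. c i * (w $ k) ^ i) = g w * H w"
            using elim(1,3) by (simp add: H_def sum_distrib_left mult_ac)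
        qed
      qed
      then have "\<forall>\<^sub>F t in at 0. (\<Sum>i<4. c i * t ^ i) = g (t *\<^sub>R ?b) * H (t *\<^sub>R ?b)"
        using line unfolding filterlim_iff by (fastforce simp: axis_component elim: eventually_mono)
      then have ev: "\<forall>\<^sub>F t in at 0. g (t *\<^sub>R ?b) / t ^ 3 * H (t *\<^sub>R ?b) = (\<Sum>i<4. c i * t ^ i) / t ^ 3"
        by (rule eventually_mono) simp
      have "((\<lambda>t. g (t *\<^sub>R ?b) / t ^ 3 * H (t *\<^sub>R ?b)) \<longlongrightarrow> 0 * H 0) (at 0)"
        by (intro tendsto_mult third_order_vanishing[OF axis_1_in_Basis g dg d2 d3] filterlim_compose[OF smooth_germ_tendsto[OF H] line])
      from Lim_transform_eventually[OF this ev]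
      have "((\<lambda>t. (\<Sum>i<4. c i * t ^ i) / t ^ 3) \<longlongrightarrow> 0) (at 0)" by simp
      from cubic_coeffs_zero[OF this] c show ?thesis by blast
    qed
  qed
  from ramification_decomposes_cong[OF graph this]
  have "ramification_decomposes f1"
    by (rule ramification_decomposes_source_change[OF f1 \<Phi> \<Psi> inv(1)])
  then show ?thesis unfolding f1_def[abs_def]
    by (rule ramification_decomposes_target_change[OF f(1) MR])
qed

theorem theorem2:
  fixes F :: "real^'n \<Rightarrow> real^('n + 'l::finite)"
    and h :: "real^'n \<Rightarrow> real^'n"
    and H :: "real^('n + 'l) \<Rightarrow> real^('n + 'l)"
    and f :: "real^'n \<Rightarrow> real^'n"
    and \<psi> :: "'l \<Rightarrow> real^'n \<Rightarrow> real"
  assumes F_germ: "smooth_germ F" "F 0 = 0"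
    and F_frontal: "frontal F"
    and h_diffeo: "diffeo_germ h"
    and H_diffeo: "diffeo_germ H"
    and f_germ: "smooth_germ f" "f 0 = 0"
    and f_mult: "local_algebra_dim_le f 3"
    and \<psi>_ram: "\<And>k. \<psi> k \<in> ramification f"
    and eq: "\<forall>\<^sub>F x in nhds 0. H (F (h x)) =
               (\<chi> j. case j of Inl i \<Rightarrow> f x $ i | Inr k \<Rightarrow> \<psi> k x)"
  shows "germ_sum (germ_ideal1 (\<lambda>x. (jac f x)^2)) (pullback f) = ramification f"
proof
  show "germ_sum (germ_ideal1 (\<lambda>x. (jac f x)^2)) (pullback f) \<subseteq> ramification f"
    by (rule germ_sum_subset_ramification[OF f_germ])
  show "ramification f \<subseteq> germ_sum (germ_ideal1 (\<lambda>x. (jac f x)^2)) (pullback f)"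
    by (rule ramification_decomposes_imp_subset[OF ramification_decomposes_multiplicity_le_3[OF f_germ f_mult]])
qed

end
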